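(* Let $(M_t)_{t\ge0}$ be a $\circlearrowright$-homogeneous Markov process on $\mathbb T$ with $M_0=1$, defined on a probability space $(\Omega,\mathcal F,\mathbb P)$ and adapted to a filtration $(\mathcal F_t)_{t\ge0}$. Let $P_t=\mathbb E[\,\cdot\,|\mathcal F_t]$ be the conditional expectation, viewed as an orthogonal projection on $L^2(\Omega,\mathcal F,\mathbb P)$, and regard $M_t$ as a multiplication operator on $L^2(\Omega,\mathcal F,\mathbb P)$. Then the process $(U_t)_{t\ge0}$ defined by $$U_t=I+(M_t-I)P_t$$ is a unitary multiplicative monotone increment process (UMIP) on the concrete quantum probability space $(L^2(\Omega,\mathcal F,\mathbb P),\mathbf 1_\Omega)$.
   Context: $\mathbb D=\{|z|<1\}$, $\mathbb T=\partial\mathbb D$. For a probability measure $\mu$ on $\mathbb T$: $\psi_\mu(z)=\int_{\mathbb T}\frac{xz}{1-xz}\mu(dx)$ and $\eta_\mu=\frac{\psi_\mu}{1+\psi_\mu}$ on $\mathbb D$. Multiplicative monotone convolution $\mu\circlearrowright\nu$ is the probability measure on $\mathbb T$ with $\eta_{\mu\circlearrowright\nu}=\eta_\mu\circ\eta_\nu$. Transition kernels on $\mathbb T$ are probability kernels $(k_{st})_{0\le s\le t}$ with $k_{ss}(x,\cdot)=\delta_x$ and $k_{su}(x,B)=\int k_{st}(x,dy)k_{tu}(y,B)$ for $s\le t\le u$. A Markov process with these kernels is a $\mathbb T$-valued process $(M_t)$ adapted to a filtration $(\mathcal F_t)$ with $\mathbb P[M_t\in B|\mathcal F_s]=k_{st}(M_s,B)$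 a.s. for $s\le t$ and Borel $B\subset\mathbb T$. It is $\circlearrowright$-homogeneous if (a) $(s,t)\mapsto k_{st}(x,\cdot)$ is weakly continuous for every $x\in\mathbb T$, and (b) $\delta_x\circlearrowright k_{st}(y,\cdot)=k_{st}(xy,\cdot)$ for all $x,y\in\mathbb T$, $0\le s\le t$. Concrete quantum probability space: a pair $(H,\xi)$ of a complex Hilbert space $H$ (inner product linear in the second argument) and a unit vector $\xi\in H$; $\Phi_\xi(X)=\langle\xi,X\xi\rangle$ for $X\in B(H)$. The distribution of a unitary $U$ is the unique probability measure $\mu$ on $\mathbb T$ with $\Phi_\xi(U^n)=\int_{\mathbb T}x^n\mu(dx)$, $n\in\mathbb N$. Monotone independence: *-subalgebras $(\mathcal A_\iota)_{\iota\in I}$ of $B(H)$ indexed by a linearly ordered set $I$ are monotonically independent if (i) for all $r,s\ge 0$, $i_1>\cdots>i_r>j<k_s<\cdots<k_1$ in $I$ and $X_p\in\mathcal A_{i_p}$, $Y\in\mathcal A_j$, $Z_q\in\mathcal A_{k_q}$: $\Phi_\xi(X_1\cdots X_rYZ_s\cdots Z_1)=\Phi_\xi(X_1)\cdots\Phi_\xi(X_r)\Phi_\xi(Y)\Phi_\xi(Z_s)\cdots\Phi_\xi(Z_1)$; and (ii) for $i<j>k$ in $I$, $X\in\mathcal A_i,Y\in\mathcal A_j,Z\in\mathcal A_k$: $XYZ=\Phi_\xi(Y)XZ$. A tuple $(X_1,\dots,X_n)$ of normal operators is monotonically independent if the algebras $\mathcal A_i=\{f(X_i): f\in C_b(\mathbb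 C), f(0)=0\}$ ($C_b$ = bounded continuous complex functions), $i\in\{1<\dots<n\}$, are. UMIP: a family $(U_t)_{t\ge0}\subset B(H)$ of unitary operators with $U_0=I$ such that (a) $(s,t)\mapsto\mu_{st}$ is weakly continuous, where $\mu_{st}$ is the distribution of $U_s^{-1}U_t$ ($0\le s\le t$); (b) the tuple $(U_{t_1}-I,U_{t_1}^{-1}U_{t_2}-I,\dots,U_{t_{n-1}}^{-1}U_{t_n}-I)$ is monotonically independent for all $n\in\mathbb N$ and $0\le t_1\le\cdots\le t_n$. *)

theory Defs
  imports "HOL-Probability.Probability"
begin

section \<open>Complex Hilbert spaces and bounded operators\<close>

text \<open>
  The Hilbert space of the theorem, \<open>L\<^sup>2\<close> of an arbitrary probability space, depends on a term and
  so cannot be a type. Hilbert spaces are therefore records with an explicit carrier.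
\<close>

record 'v hspace =
  vecs :: "'v set"
  vzero :: 'v
  vadd :: "'v \<Rightarrow> 'v \<Rightarrow> 'v"
  vscale :: "complex \<Rightarrow> 'v \<Rightarrow> 'v"
  vinner :: "'v \<Rightarrow> 'v \<Rightarrow> complex"

definition vnorm :: "'v hspace \<Rightarrow> 'v \<Rightarrow> real" where
  "vnorm H x = sqrt (Re (vinner H x x))"

definition vdiff :: "'v hspace \<Rightarrow> 'v \<Rightarrow> 'v \<Rightarrow> 'v" where
  "vdiff H x y = vadd H x (vscale H (-1) y)"

text \<open>The inner product is linear in the second argument.\<close>

locale complex_hilbert_space =
  fixes H :: "'v hspace"
  assumes zero_closed: "vzero H \<in> vecs H"
    and add_closed: "\<lbrakk>x \<in> vecs H; y \<in> vecs H\<rbrakk> \<Longrightarrow> vadd H x y \<in> vecs H"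
    and scale_closed: "x \<in> vecs H \<Longrightarrow> vscale H a x \<in> vecs H"
    and add_assoc: "\<lbrakk>x \<in> vecs H; y \<in> vecs H; z \<in> vecs H\<rbrakk>
      \<Longrightarrow> vadd H (vadd H x y) z = vadd H x (vadd H y z)"
    and add_commute: "\<lbrakk>x \<in> vecs H; y \<in> vecs H\<rbrakk> \<Longrightarrow> vadd H x y = vadd H y x"
    and add_zero: "x \<in> vecs H \<Longrightarrow> vadd H x (vzero H) = x"
    and add_inverse: "x \<in> vecs H \<Longrightarrow> vadd H x (vscale H (-1) x) = vzero H"
    and scale_one: "x \<in> vecs H \<Longrightarrow> vscale H 1 x = x"
    and scale_scale: "x \<in> vecs H \<Longrightarrow> vscale H a (vscale H b x) = vscale H (a * b) x"
    and scale_add_right: "\<lbrakk>x \<in> vecs H; y \<in> vecs H\<rbrakk>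
      \<Longrightarrow> vscale H a (vadd H x y) = vadd H (vscale H a x) (vscale H a y)"
    and scale_add_left: "x \<in> vecs H
      \<Longrightarrow> vscale H (a + b) x = vadd H (vscale H a x) (vscale H b x)"
    and inner_add_right: "\<lbrakk>x \<in> vecs H; y \<in> vecs H; z \<in> vecs H\<rbrakk>
      \<Longrightarrow> vinner H x (vadd H y z) = vinner H x y + vinner H x z"
    and inner_scale_right: "\<lbrakk>x \<in> vecs H; y \<in> vecs H\<rbrakk>
      \<Longrightarrow> vinner H x (vscale H a y) = a * vinner H x y"
    and inner_commute: "\<lbrakk>x \<in> vecs H; y \<in> vecs H\<rbrakk> \<Longrightarrow> vinner H y x = cnj (vinner H x y)"
    and inner_nonneg: "x \<in> vecs H \<Longrightarrow> Re (vinner H x x) \<ge> 0"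
    and inner_definite: "\<lbrakk>x \<in> vecs H; vinner H x x = 0\<rbrakk> \<Longrightarrow> x = vzero H"
    and complete: "\<lbrakk>\<And>n. f n \<in> vecs H;
        \<forall>e>0. \<exists>N. \<forall>m\<ge>N. \<forall>n\<ge>N. vnorm H (vdiff H (f m) (f n)) < e\<rbrakk>
      \<Longrightarrow> \<exists>x\<in>vecs H. (\<lambda>n. vnorm H (vdiff H (f n) x)) \<longlonglongrightarrow> 0"

definition quantum_probability_space :: "'v hspace \<Rightarrow> 'v \<Rightarrow> bool" where
  "quantum_probability_space H \<xi> \<longleftrightarrow>
     complex_hilbert_space H \<and> \<xi> \<in> vecs H \<and> vinner H \<xi> \<xi> = 1"

text \<open>
  \<open>B(H)\<close>. Operators are \<^emph>\<open>extensional\<close> functions (undefined off the carrier), so that HOL equality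
  is equality of operators.
\<close>

definition bounded_ops :: "'v hspace \<Rightarrow> ('v \<Rightarrow> 'v) set" where
  "bounded_ops H = {T \<in> vecs H \<rightarrow>\<^sub>E vecs H.
     (\<forall>x\<in>vecs H. \<forall>y\<in>vecs H. T (vadd H x y) = vadd H (T x) (T y)) \<and>
     (\<forall>a. \<forall>x\<in>vecs H. T (vscale H a x) = vscale H a (T x)) \<and>
     (\<exists>C. \<forall>x\<in>vecs H. vnorm H (T x) \<le> C * vnorm H x)}"

definition op_id :: "'v hspace \<Rightarrow> 'v \<Rightarrow> 'v" where
  "op_id H = (\<lambda>x\<in>vecs H. x)"

definition op_add :: "'v hspace \<Rightarrow> ('v \<Rightarrow> 'v) \<Rightarrow> ('v \<Rightarrow> 'v) \<Rightarrow> 'v \<Rightarrow> 'v" where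
  "op_add H S T = (\<lambda>x\<in>vecs H. vadd H (S x) (T x))"

definition op_diff :: "'v hspace \<Rightarrow> ('v \<Rightarrow> 'v) \<Rightarrow> ('v \<Rightarrow> 'v) \<Rightarrow> 'v \<Rightarrow> 'v" where
  "op_diff H S T = (\<lambda>x\<in>vecs H. vdiff H (S x) (T x))"

definition op_scale :: "'v hspace \<Rightarrow> complex \<Rightarrow> ('v \<Rightarrow> 'v) \<Rightarrow> 'v \<Rightarrow> 'v" where
  "op_scale H a T = (\<lambda>x\<in>vecs H. vscale H a (T x))"

definition op_mult :: "'v hspace \<Rightarrow> ('v \<Rightarrow> 'v) \<Rightarrow> ('v \<Rightarrow> 'v) \<Rightarrow> 'v \<Rightarrow> 'v" where
  "op_mult H S T = compose (vecs H) S T"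

definition op_power :: "'v hspace \<Rightarrow> ('v \<Rightarrow> 'v) \<Rightarrow> nat \<Rightarrow> 'v \<Rightarrow> 'v" where
  "op_power H T n = (op_mult H T ^^ n) (op_id H)"

definition op_prod :: "'v hspace \<Rightarrow> ('v \<Rightarrow> 'v) list \<Rightarrow> 'v \<Rightarrow> 'v" where
  "op_prod H Ts = foldr (op_mult H) Ts (op_id H)"

definition op_inverse :: "'v hspace \<Rightarrow> ('v \<Rightarrow> 'v) \<Rightarrow> 'v \<Rightarrow> 'v" where
  "op_inverse H T = (\<lambda>x\<in>vecs H. inv_into (vecs H) T x)"

definition is_adjoint :: "'v hspace \<Rightarrow> ('v \<Rightarrow> 'v) \<Rightarrow> ('v \<Rightarrow> 'v) \<Rightarrow> bool" where
  "is_adjoint H T S \<longleftrightarrow> S \<in> bounded_ops H \<and>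
     (\<forall>x\<in>vecs H. \<forall>y\<in>vecs H. vinner H (T x) y = vinner H x (S y))"

definition unitary_op :: "'v hspace \<Rightarrow> ('v \<Rightarrow> 'v) \<Rightarrow> bool" where
  "unitary_op H U \<longleftrightarrow> U \<in> bounded_ops H \<and>
     (\<exists>S. is_adjoint H U S \<and> op_mult H S U = op_id H \<and> op_mult H U S = op_id H)"

definition normal_op :: "'v hspace \<Rightarrow> ('v \<Rightarrow> 'v) \<Rightarrow> bool" where
  "normal_op H T \<longleftrightarrow> T \<in> bounded_ops H \<and>
     (\<exists>S. is_adjoint H T S \<and> op_mult H S T = op_mult H T S)"

definition op_spectrum :: "'v hspace \<Rightarrow> ('v \<Rightarrow> 'v) \<Rightarrow> complex set" where
  "op_spectrum H T = {z. \<not> (\<exists>S\<in>bounded_ops H.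
     op_mult H S (op_diff H T (op_scale H z (op_id H))) = op_id H \<and>
     op_mult H (op_diff H T (op_scale H z (op_id H))) S = op_id H)}"

text \<open>
  \<open>\<Theta>\<close> is the continuous functional calculus of \<open>T\<close>: a unital *-homomorphism
  \<open>C(\<sigma>(T)) \<rightarrow> B(H)\<close> sending the identity function to \<open>T\<close>. Elements of \<open>C(\<sigma>(T))\<close> are represented
  by total functions that are continuous on \<open>\<sigma>(T)\<close>; the first two clauses say that \<open>\<Theta>\<close> is a
  well-defined map on \<open>C(\<sigma>(T))\<close>. For normal \<open>T\<close> there is exactly one such \<open>\<Theta>\<close> on \<open>C(\<sigma>(T))\<close>.
\<close>

definition functional_calculus ::
  "'v hspace \<Rightarrow> ('v \<Rightarrow> 'v) \<Rightarrow> ((complex \<Rightarrow> complex) \<Rightarrow> 'v \<Rightarrow> 'v) \<Rightarrow> bool" where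
  "functional_calculus H T \<Theta> \<longleftrightarrow>
    (let \<sigma> = op_spectrum H T; C = {f. continuous_on \<sigma> f} in
      (\<forall>f\<in>C. \<Theta> f \<in> bounded_ops H) \<and>
      (\<forall>f\<in>C. \<forall>g\<in>C. (\<forall>z\<in>\<sigma>. f z = g z) \<longrightarrow> \<Theta> f = \<Theta> g) \<and>
      (\<forall>f\<in>C. \<forall>g\<in>C. \<Theta> (\<lambda>z. f z + g z) = op_add H (\<Theta> f) (\<Theta> g)) \<and>
      (\<forall>a. \<forall>f\<in>C. \<Theta> (\<lambda>z. a * f z) = op_scale H a (\<Theta> f)) \<and>
      (\<forall>f\<in>C. \<forall>g\<in>C. \<Theta> (\<lambda>z. f z * g z) = op_mult H (\<Theta> f) (\<Theta> g)) \<and>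
      (\<forall>f\<in>C. is_adjoint H (\<Theta> f) (\<Theta> (\<lambda>z. cnj (f z)))) \<and>
      \<Theta> (\<lambda>z. 1) = op_id H \<and> \<Theta> (\<lambda>z. z) = T)"

text \<open>The algebra \<open>{f(T) : f \<in> C\<^sub>b(\<complex>), f(0) = 0}\<close>.\<close>

definition generated_algebra :: "'v hspace \<Rightarrow> ('v \<Rightarrow> 'v) \<Rightarrow> ('v \<Rightarrow> 'v) set" where
  "generated_algebra H T = {\<Theta> f | \<Theta> f. functional_calculus H T \<Theta> \<and>
     continuous_on UNIV f \<and> bounded (range f) \<and> f 0 = 0}"

section \<open>Measures on the unit circle\<close>

definition circle :: "complex measure" where
  "circle = restrict_space borel (sphere 0 1)"

abbreviation circle_prob :: "complex measure \<Rightarrow> bool" where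
  "circle_prob \<mu> \<equiv> \<mu> \<in> space (prob_algebra circle)"

definition psi_transform :: "complex measure \<Rightarrow> complex \<Rightarrow> complex" where
  "psi_transform \<mu> z = (\<integral>x. x * z / (1 - x * z) \<partial>\<mu>)"

definition eta_transform :: "complex measure \<Rightarrow> complex \<Rightarrow> complex" where
  "eta_transform \<mu> z = psi_transform \<mu> z / (1 + psi_transform \<mu> z)"

text \<open>\<open>\<rho>\<close> is the multiplicative monotone convolution of \<open>\<mu>\<close> and \<open>\<nu>\<close>.\<close>

definition is_mult_monotone_conv ::
  "complex measure \<Rightarrow> complex measure \<Rightarrow> complex measure \<Rightarrow> bool" where
  "is_mult_monotone_conv \<mu> \<nu> \<rho> \<longleftrightarrow> circle_prob \<rho> \<and>
     (\<forall>z\<in>ball 0 1. eta_transform \<rho> z = eta_transform \<mu> (eta_transform \<nu> z))"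

definition weakly_continuous :: "(real \<Rightarrow> real \<Rightarrow> complex measure) \<Rightarrow> bool" where
  "weakly_continuous \<mu> \<longleftrightarrow> (\<forall>f :: complex \<Rightarrow> real. continuous_on (sphere 0 1) f \<longrightarrow>
     continuous_on {(s, t). 0 \<le> s \<and> s \<le> t} (\<lambda>(s, t). \<integral>x. f x \<partial>\<mu> s t))"

section \<open>Markov processes on the unit circle\<close>

definition transition_kernels :: "(real \<Rightarrow> real \<Rightarrow> complex \<Rightarrow> complex measure) \<Rightarrow> bool" where
  "transition_kernels k \<longleftrightarrow>
     (\<forall>s t. 0 \<le> s \<and> s \<le> t \<longrightarrow> k s t \<in> circle \<rightarrow>\<^sub>M prob_algebra circle) \<and>
     (\<forall>s\<ge>0. \<forall>x\<in>sphere 0 1. k s s x = return circle x) \<and>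
     (\<forall>s t u. 0 \<le> s \<and> s \<le> t \<and> t \<le> u \<longrightarrow>
       (\<forall>x\<in>sphere 0 1. \<forall>B\<in>sets circle.
         emeasure (k s u x) B = (\<integral>\<^sup>+y. emeasure (k t u y) B \<partial>k s t x)))"

definition is_filtration :: "'w measure \<Rightarrow> (real \<Rightarrow> 'w measure) \<Rightarrow> bool" where
  "is_filtration M F \<longleftrightarrow> (\<forall>t\<ge>0. subalgebra M (F t)) \<and>
     (\<forall>s t. 0 \<le> s \<and> s \<le> t \<longrightarrow> sets (F s) \<subseteq> sets (F t))"

definition markov_process ::
  "'w measure \<Rightarrow> (real \<Rightarrow> 'w measure) \<Rightarrow> (real \<Rightarrow> real \<Rightarrow> complex \<Rightarrow> complex measure)
    \<Rightarrow> (real \<Rightarrow> 'w \<Rightarrow> complex) \<Rightarrow> bool" where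
  "markov_process M F k X \<longleftrightarrow> transition_kernels k \<and>
     (\<forall>t\<ge>0. X t \<in> F t \<rightarrow>\<^sub>M circle) \<and>
     (\<forall>s t. 0 \<le> s \<and> s \<le> t \<longrightarrow> (\<forall>B\<in>sets circle. AE w in M.
       real_cond_exp M (F s) (indicator (X t -` B \<inter> space M)) w = measure (k s t (X s w)) B))"

definition monotone_homogeneous ::
  "(real \<Rightarrow> real \<Rightarrow> complex \<Rightarrow> complex measure) \<Rightarrow> bool" where
  "monotone_homogeneous k \<longleftrightarrow>
     (\<forall>x\<in>sphere 0 1. weakly_continuous (\<lambda>s t. k s t x)) \<and>
     (\<forall>x\<in>sphere 0 1. \<forall>y\<in>sphere 0 1. \<forall>s t. 0 \<le> s \<and> s \<le> t \<longrightarrow>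
       is_mult_monotone_conv (return circle x) (k s t y) (k s t (x * y)))"

section \<open>Monotone independence and monotone increment processes\<close>

definition state :: "'v hspace \<Rightarrow> 'v \<Rightarrow> ('v \<Rightarrow> 'v) \<Rightarrow> complex" where
  "state H \<xi> T = vinner H \<xi> (T \<xi>)"

definition unitary_distribution :: "'v hspace \<Rightarrow> 'v \<Rightarrow> ('v \<Rightarrow> 'v) \<Rightarrow> complex measure" where
  "unitary_distribution H \<xi> U = (THE \<mu>. circle_prob \<mu> \<and>
     (\<forall>n. state H \<xi> (op_power H U n) = (\<integral>x. x ^ n \<partial>\<mu>)))"

text \<open>
  Monotone independence of a family \<open>A\<close> of *-subalgebras of \<open>B(H)\<close>. In the first clause \<open>is\<close> is
  \<open>[i\<^sub>1, \<dots>, i\<^sub>r]\<close> and \<open>ks\<close> is \<open>[k\<^sub>1, \<dots>, k\<^sub>s]\<close>, both decreasing with all entries above \<open>j\<close>, and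
  \<open>Xs\<close>, \<open>Zs\<close> are \<open>[X\<^sub>1, \<dots>, X\<^sub>r]\<close>, \<open>[Z\<^sub>1, \<dots>, Z\<^sub>s]\<close>.
\<close>

definition monotonically_independent ::
  "'v hspace \<Rightarrow> 'v \<Rightarrow> 'i::linorder set \<Rightarrow> ('i \<Rightarrow> ('v \<Rightarrow> 'v) set) \<Rightarrow> bool" where
  "monotonically_independent H \<xi> I A \<longleftrightarrow>
     (\<forall>is j ks Xs Y Zs.
        set is \<subseteq> I \<and> j \<in> I \<and> set ks \<subseteq> I \<and>
        sorted_wrt (>) (is @ [j]) \<and> sorted_wrt (>) (ks @ [j]) \<and>
        list_all2 (\<lambda>i X. X \<in> A i) is Xs \<and> Y \<in> A j \<and> list_all2 (\<lambda>k Z. Z \<in> A k) ks Zs \<longrightarrow>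
        state H \<xi> (op_prod H (Xs @ [Y] @ rev Zs)) =
          prod_list (map (state H \<xi>) Xs) * state H \<xi> Y * prod_list (map (state H \<xi>) Zs)) \<and>
     (\<forall>i\<in>I. \<forall>j\<in>I. \<forall>k\<in>I. i < j \<and> k < j \<longrightarrow>
        (\<forall>X\<in>A i. \<forall>Y\<in>A j. \<forall>Z\<in>A k.
          op_prod H [X, Y, Z] = op_scale H (state H \<xi> Y) (op_mult H X Z)))"

definition monotonically_independent_tuple ::
  "'v hspace \<Rightarrow> 'v \<Rightarrow> nat \<Rightarrow> (nat \<Rightarrow> 'v \<Rightarrow> 'v) \<Rightarrow> bool" where
  "monotonically_independent_tuple H \<xi> n X \<longleftrightarrow>
     (\<forall>i\<in>{1..n}. normal_op H (X i)) \<and>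
     monotonically_independent H \<xi> {1..n} (\<lambda>i. generated_algebra H (X i))"

definition mult_increment :: "'v hspace \<Rightarrow> (real \<Rightarrow> 'v \<Rightarrow> 'v) \<Rightarrow> real \<Rightarrow> real \<Rightarrow> 'v \<Rightarrow> 'v" where
  "mult_increment H U s t = op_mult H (op_inverse H (U s)) (U t)"

definition UMIP :: "'v hspace \<Rightarrow> 'v \<Rightarrow> (real \<Rightarrow> 'v \<Rightarrow> 'v) \<Rightarrow> bool" where
  "UMIP H \<xi> U \<longleftrightarrow> quantum_probability_space H \<xi> \<and>
     (\<forall>t\<ge>0. unitary_op H (U t)) \<and> U 0 = op_id H \<and>
     weakly_continuous (\<lambda>s t. unitary_distribution H \<xi> (mult_increment H U s t)) \<and>
     (\<forall>n\<ge>1. \<forall>t :: nat \<Rightarrow> real. 0 \<le> t 1 \<and> (\<forall>i\<in>{1..<n}. t i \<le> t (Suc i)) \<longrightarrow>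
        monotonically_independent_tuple H \<xi> n
          (\<lambda>i. op_diff H (if i = 1 then U (t 1) else mult_increment H U (t (i - 1)) (t i))
             (op_id H)))"

section \<open>The Hilbert space \<open>L\<^sup>2(M)\<close>\<close>

definition L2_fun :: "'w measure \<Rightarrow> ('w \<Rightarrow> complex) set" where
  "L2_fun M = {f \<in> borel_measurable M. integrable M (\<lambda>x. (cmod (f x))\<^sup>2)}"

definition L2_rel :: "'w measure \<Rightarrow> (('w \<Rightarrow> complex) \<times> ('w \<Rightarrow> complex)) set" where
  "L2_rel M = {(f, g). f \<in> L2_fun M \<and> g \<in> L2_fun M \<and> (AE x in M. f x = g x)}"

definition L2_class :: "'w measure \<Rightarrow> ('w \<Rightarrow> complex) \<Rightarrow> ('w \<Rightarrow> complex) set" where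
  "L2_class M f = L2_rel M `` {f}"

definition L2_rep :: "('w \<Rightarrow> complex) set \<Rightarrow> 'w \<Rightarrow> complex" where
  "L2_rep A = (SOME f. f \<in> A)"

definition L2 :: "'w measure \<Rightarrow> ('w \<Rightarrow> complex) set hspace" where
  "L2 M = \<lparr>
     vecs = L2_fun M // L2_rel M,
     vzero = L2_class M (\<lambda>x. 0),
     vadd = (\<lambda>A B. L2_class M (\<lambda>x. L2_rep A x + L2_rep B x)),
     vscale = (\<lambda>a A. L2_class M (\<lambda>x. a * L2_rep A x)),
     vinner = (\<lambda>A B. \<integral>x. cnj (L2_rep A x) * L2_rep B x \<partial>M) \<rparr>"

definition multiplication_op ::
  "'w measure \<Rightarrow> ('w \<Rightarrow> complex) \<Rightarrow> ('w \<Rightarrow> complex) set \<Rightarrow> ('w \<Rightarrow> complex) set" where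
  "multiplication_op M m = (\<lambda>A\<in>vecs (L2 M). L2_class M (\<lambda>x. m x * L2_rep A x))"

definition complex_cond_exp :: "'w measure \<Rightarrow> 'w measure \<Rightarrow> ('w \<Rightarrow> complex) \<Rightarrow> 'w \<Rightarrow> complex" where
  "complex_cond_exp M F f x =
     Complex (real_cond_exp M F (\<lambda>w. Re (f w)) x) (real_cond_exp M F (\<lambda>w. Im (f w)) x)"

definition cond_exp_op ::
  "'w measure \<Rightarrow> 'w measure \<Rightarrow> ('w \<Rightarrow> complex) set \<Rightarrow> ('w \<Rightarrow> complex) set" where
  "cond_exp_op M F = (\<lambda>A\<in>vecs (L2 M). L2_class M (complex_cond_exp M F (L2_rep A)))"

end

theory Submission
  imports Defs
begin

text \<open>
  Write \<open>V = U\<^sub>s\<^sup>-\<^sup>1 U\<^sub>t\<close> and \<open>c n\<close> for the \<open>n\<close>-th moment of \<open>k\<^sub>s\<^sub>t(1, -)\<close>. The operator \<open>V\<close> is the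
  identity on the complement of \<open>L\<^sup>2(F\<^sub>t)\<close>, and \<open>P\<^sub>s V\<^sup>n P\<^sub>s = c n P\<^sub>s\<close>: for \<open>h\<close> in \<open>L\<^sup>2(F\<^sub>s)\<close> the vectors
  \<open>V\<^sup>n h\<close> satisfy a linear recursion, which the Markov property turns into a recursion for
  \<open>P\<^sub>s V\<^sup>n h\<close> with the moments of \<open>k\<^sub>s\<^sub>t(M\<^sub>s, -)\<close> as coefficients, and homogeneity, that is
  \<open>\<eta>\<^bsub>k(x)\<^esub> = x \<eta>\<^bsub>k(1)\<^esub>\<close>, says that \<open>c n h\<close> solves it. In particular \<open>V\<close> has distribution \<open>k\<^sub>s\<^sub>t(1, -)\<close>.

  By density of trigonometric polynomials on the circle both properties pass from the powers of
  \<open>V\<close> to every \<open>X = f(V - I)\<close> with \<open>f(0) = 0\<close>: \<open>P\<^sub>t X = X = X P\<^sub>t\<close> and \<open>P\<^sub>s X P\<^sub>s = \<Phi>(X) P\<^sub>s\<close>.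
  Monotone independence is a formal consequence of these two identities.
\<close>

text \<open>Three obstacles shape the proof. \<open>generated_algebra\<close> ranges over every
  functional calculus and every bounded continuous f, so only the clauses of
  \<open>functional_calculus\<close> are available; both identities are therefore proved weakly, as
  the vanishing of a functional that is linear in f and bounded by the supremum of f on the circle.
  The condition f(0) = 0 for f(V - I) becomes vanishing at the point 1, so functionals are tested on
  z^n - 1 instead of z^n; the negative powers come from the adjoint. Finally,
  \<open>markov_process\<close> speaks of single events only, whereas the recursion needs
  conditional moments.

  The recursion: on functions measurable at time t one has V f = M_t f - (M_s - 1) P_s V f. If P_s
  V^k h = c k h for k <= n, then V^n h = R_n h, where R_n is a polynomial in M_t with coefficients
  depending on M_s. The next step asks for E[M_t R_n | F_s] = M_s c (n + 1). This is exactly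
  coefficient n + 1 of the homogeneity relation once it is written for the psi transforms.\<close>

section \<open>Functionals and trigonometric polynomials on the unit circle\<close>

text \<open>Clearing denominators turns a trigonometric polynomial into an ordinary one.\<close>

definition trig_on_circle :: "(complex \<Rightarrow> complex) \<Rightarrow> bool" where
  "trig_on_circle f \<longleftrightarrow> (\<exists>N p. \<forall>z. cmod z = 1 \<longrightarrow> z ^ N * f z = poly p z)"

lemma trig_on_circle_add:
  assumes "trig_on_circle f" "trig_on_circle g"
  shows "trig_on_circle (\<lambda>z. f z + g z)"
proof -
  obtain N p where p: "\<And>z. cmod z = 1 \<Longrightarrow> z ^ N * f z = poly p z"
    using assms(1) by (auto simp: trig_on_circle_def)
  obtain K q where q: "\<And>z. cmod z = 1 \<Longrightarrow> z ^ K * g z = poly q z"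
    using assms(2) by (auto simp: trig_on_circle_def)
  have "z ^ (N + K) * (f z + g z) = poly (monom 1 K * p + monom 1 N * q) z" if "cmod z = 1" for z
    by (simp add: poly_monom power_add algebra_simps flip: p[OF that] q[OF that])
  then show ?thesis unfolding trig_on_circle_def by blast
qed

lemma trig_on_circle_mult:
  assumes "trig_on_circle f" "trig_on_circle g"
  shows "trig_on_circle (\<lambda>z. f z * g z)"
proof -
  obtain N p where p: "\<And>z. cmod z = 1 \<Longrightarrow> z ^ N * f z = poly p z"
    using assms(1) by (auto simp: trig_on_circle_def)
  obtain K q where q: "\<And>z. cmod z = 1 \<Longrightarrow> z ^ K * g z = poly q z"
    using assms(2) by (auto simp: trig_on_circle_def)
  have "z ^ (N + K) * (f z * g z) = poly (p * q) z" if "cmod z = 1" for z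
    by (simp add: power_add algebra_simps flip: p[OF that] q[OF that])
  then show ?thesis unfolding trig_on_circle_def by blast
qed

lemma trig_on_circle_const: "trig_on_circle (\<lambda>z. c)"
  unfolding trig_on_circle_def by (rule exI[of _ 0], rule exI[of _ "[:c:]"]) simp

text \<open>On the circle the conjugate of z is 1/z, so after multiplication by z the real and
  imaginary parts become combinations of z^2 and 1.\<close>

lemma trig_on_circle_linear:
  assumes "bounded_linear (f :: complex \<Rightarrow> real)"
  shows "trig_on_circle (\<lambda>z. of_real (f z))"
proof -
  interpret bounded_linear f by fact
  define a b where "a = complex_of_real (f 1)" and "b = complex_of_real (f \<i>)"
  have f: "complex_of_real (f z) = (a * (z + cnj z) - \<i> * b * (z - cnj z)) / 2" for z
  proof -
    have z: "z = Re z *\<^sub>R 1 + Im z *\<^sub>R \<i>"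
      by (simp add: complex_eq_iff)
    have "f z = Re z * f 1 + Im z * f \<i>"
      by (subst z) (simp only: add scaleR real_scaleR_def)
    then show ?thesis by (simp add: a_def b_def complex_eq_iff)
  qed
  have "z ^ 1 * of_real (f z) = poly [: (a + \<i> * b) / 2, 0, (a - \<i> * b) / 2 :] z"
    if "cmod z = 1" for z
  proof -
    have "z * cnj z = 1"
      using that by (simp add: complex_norm_square[symmetric])
    have "z ^ 1 * of_real (f z) = (a * (z * z + z * cnj z) - \<i> * b * (z * z - z * cnj z)) / 2"
      unfolding f by (simp add: algebra_simps)
    also have "\<dots> = poly [: (a + \<i> * b) / 2, 0, (a - \<i> * b) / 2 :] z"
      unfolding \<open>z * cnj z = 1\<close> by (simp add: field_simps)
    finally show ?thesis .
  qed
  then show ?thesis unfolding trig_on_circle_def by blast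
qed

lemma trig_on_circle_real_polynomial_function:
  assumes "real_polynomial_function (f :: complex \<Rightarrow> real)"
  shows "trig_on_circle (\<lambda>z. of_real (f z))"
  using assms
  by induction (auto intro: trig_on_circle_linear trig_on_circle_const
      trig_on_circle_add[simplified] trig_on_circle_mult[simplified])

lemma trig_on_circle_dense:
  fixes f :: "complex \<Rightarrow> complex"
  assumes "continuous_on (sphere 0 1) f" "e > 0"
  obtains g where "trig_on_circle g" "\<And>z. cmod z = 1 \<Longrightarrow> cmod (f z - g z) < e"
proof -
  have "compact (sphere (0::complex) 1)" by simp
  have SW: "\<exists>a. real_polynomial_function a \<and> (\<forall>z\<in>sphere 0 1. \<bar>h z - a z\<bar> < e/2)"
    if "continuous_on (sphere 0 1) h" for h :: "complex \<Rightarrow> real"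
    using Stone_Weierstrass_real_polynomial_function[OF \<open>compact (sphere (0::complex) 1)\<close> that, of "e/2"]
      assms(2) by (metis half_gt_zero)
  obtain a where a: "real_polynomial_function a" "\<And>z. z \<in> sphere 0 1 \<Longrightarrow> \<bar>Re (f z) - a z\<bar> < e/2"
    using SW[OF continuous_on_Re[OF assms(1)]] by blast
  obtain b where b: "real_polynomial_function b" "\<And>z. z \<in> sphere 0 1 \<Longrightarrow> \<bar>Im (f z) - b z\<bar> < e/2"
    using SW[OF continuous_on_Im[OF assms(1)]] by blast
  show thesis
  proof
    show "trig_on_circle (\<lambda>z. of_real (a z) + \<i> * of_real (b z))"
      by (intro trig_on_circle_add trig_on_circle_mult trig_on_circle_const
          trig_on_circle_real_polynomial_function a b)
    show "cmod (f z - (of_real (a z) + \<i> * of_real (b z))) < e" if "cmod z = 1" for z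
      using cmod_le[of "f z - (of_real (a z) + \<i> * of_real (b z))"] a(2)[of z] b(2)[of z] that
      by simp
  qed
qed

text \<open>The functions in \<open>pow\<close> span the trigonometric polynomials that vanish at 1,
  and these are dense among the continuous functions vanishing at 1. Since \<open>bound\<close>
  looks at the circle only, it also forces \<open>L\<close> to depend only on values there.\<close>

lemma functional_on_circle_eq_0:
  fixes L :: "(complex \<Rightarrow> complex) \<Rightarrow> complex"
  assumes add: "\<And>f g. continuous_on UNIV f \<Longrightarrow> continuous_on UNIV g \<Longrightarrow>
      L (\<lambda>z. f z + g z) = L f + L g"
    and scale: "\<And>a f. continuous_on UNIV f \<Longrightarrow> L (\<lambda>z. a * f z) = a * L f"
    and bound: "\<And>f e. continuous_on UNIV f \<Longrightarrow> e > 0 \<Longrightarrow>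
      (\<And>z. cmod z = 1 \<Longrightarrow> cmod (f z) < e) \<Longrightarrow> cmod (L f) \<le> C * e"
    and pow: "\<And>n. L (\<lambda>z. z ^ n - 1) = 0" "\<And>n. L (\<lambda>z. cnj z ^ n - 1) = 0"
    and f: "continuous_on UNIV f" "f 1 = 0"
  shows "L f = 0"
proof -
  have diff: "L (\<lambda>z. f z - g z) = L f - L g"
    if "continuous_on UNIV f" "continuous_on UNIV g" for f g
    using add[of f "\<lambda>z. - g z"] scale[of g "-1"] that by (auto simp: continuous_on_minus)
  have small: "w = 0" if w: "\<And>e. e > 0 \<Longrightarrow> cmod w \<le> C * e" for w
  proof -
    have "cmod w \<le> e" if "e > 0" for e
    proof -
      \<comment> \<open>\<open>C\<close> may have either sign, hence the positive divisor
        \<open>\<bar>C\<bar> + 1\<close>.\<close>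
      have "cmod w \<le> C * (e / (\<bar>C\<bar> + 1))"
        by (rule w) (use that in auto)
      also have "\<dots> \<le> (\<bar>C\<bar> + 1) * (e / (\<bar>C\<bar> + 1))"
        using that by (intro mult_right_mono) auto
      finally show ?thesis by simp
    qed
    then show ?thesis
      by (metis field_le_epsilon add_0 norm_le_zero_iff)
  qed
  have cong: "L f = L g"
    if "continuous_on UNIV f" "continuous_on UNIV g" "\<And>z. cmod z = 1 \<Longrightarrow> f z = g z" for f g
  proof -
    have "L (\<lambda>z. f z - g z) = 0"
      by (rule small, rule bound) (use that in \<open>auto intro!: continuous_intros\<close>)
    then show ?thesis using diff that by simp
  qed
  have zero: "L (\<lambda>z. 0) = 0"
    using scale[of "\<lambda>z. 0" 0] by simp
  have sum: "L (\<lambda>z. \<Sum>k\<in>K. h k z) = (\<Sum>k\<in>K. L (h k))"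
    if "finite K" "\<And>k. continuous_on UNIV (h k)" for K :: "nat set" and h
    using that(1) by induction (auto simp: zero add that(2) continuous_on_sum)
  have mono: "L (\<lambda>z. z ^ k * cnj z ^ N - 1) = 0" for k N
  proof (cases "N \<le> k")
    case True
    have "z ^ k * cnj z ^ N = z ^ (k - N)" if "cmod z = 1" for z
    proof -
      have "z ^ k * cnj z ^ N = z ^ (k - N) * (z * cnj z) ^ N"
        using True by (simp add: power_mult_distrib flip: power_add mult.assoc)
      then show ?thesis
        using that by (simp add: complex_norm_square[symmetric])
    qed
    then have "L (\<lambda>z. z ^ k * cnj z ^ N - 1) = L (\<lambda>z. z ^ (k - N) - 1)"
      by (intro cong) (auto intro!: continuous_intros)
    then show ?thesis using pow by simp
  next
    case False
    have "z ^ k * cnj z ^ N = cnj z ^ (N - k)" if "cmod z = 1" for z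
    proof -
      have "z ^ k * cnj z ^ N = cnj z ^ (N - k) * (z * cnj z) ^ k"
        using False by (simp add: power_mult_distrib flip: power_add mult.assoc)
      then show ?thesis
        using that by (simp add: complex_norm_square[symmetric])
    qed
    then have "L (\<lambda>z. z ^ k * cnj z ^ N - 1) = L (\<lambda>z. cnj z ^ (N - k) - 1)"
      by (intro cong) (auto intro!: continuous_intros)
    then show ?thesis using pow by simp
  qed
  show ?thesis
  proof (rule small)
    fix e :: real assume e: "e > 0"
    obtain g where g: "trig_on_circle g" "\<And>z. cmod z = 1 \<Longrightarrow> cmod (f z - g z) < e/2"
      using trig_on_circle_dense[of f "e/2"] f e continuous_on_subset by (metis half_gt_zero subset_UNIV)
    obtain N p where p: "\<And>z. cmod z = 1 \<Longrightarrow> z ^ N * g z = poly p z"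
      using g(1) by (auto simp: trig_on_circle_def)
    \<comment> \<open>On the circle \<open>h\<close> is \<open>g - g 1\<close>, written as a
      combination of functions that \<open>L\<close> kills; dividing \<open>poly p z\<close> by
      \<open>z ^ N\<close> is multiplication by \<open>cnj z ^ N\<close>.\<close>
    define h where "h z = (\<Sum>k\<le>degree p. coeff p k * (z ^ k * cnj z ^ N - 1))" for z
    have h: "h z = g z - g 1" if "cmod z = 1" for z
    proof -
      have "h z = (\<Sum>k\<le>degree p. cnj z ^ N * (coeff p k * z ^ k)) - (\<Sum>k\<le>degree p. coeff p k)"
        unfolding h_def sum_subtractf[symmetric] by (intro sum.cong) (auto simp: algebra_simps)
      also have "\<dots> = cnj z ^ N * poly p z - poly p 1"
        by (simp add: poly_altdef sum_distrib_left)
      also have "\<dots> = (z * cnj z) ^ N * g z - g 1"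
        using p[OF that, symmetric] p[of 1] by (simp add: power_mult_distrib)
      finally show ?thesis
        using that by (simp add: complex_norm_square[symmetric])
    qed
    have cont_h: "continuous_on UNIV h"
      unfolding h_def by (intro continuous_intros)
    have "L (\<lambda>z. coeff p k * (z ^ k * cnj z ^ N - 1)) = 0" for k
      by (subst scale) (auto intro!: continuous_intros simp: mono)
    then have "L h = 0"
      unfolding h_def by (subst sum) (auto intro!: continuous_intros)
    then have "L f = L (\<lambda>z. f z - h z)"
      using diff[OF f(1) cont_h] by simp
    also have "cmod \<dots> \<le> C * e"
    proof (rule bound[OF _ e])
      show "continuous_on UNIV (\<lambda>z. f z - h z)"
        by (intro continuous_intros f cont_h)
      fix z assume z: "cmod z = 1"
      have "f z - h z = (f z - g z) - (f 1 - g 1)"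
        using h[OF z] f(2) by simp
      then have "cmod (f z - h z) = cmod ((f z - g z) - (f 1 - g 1))"
        by (simp only:)
      also have "\<dots> \<le> cmod (f z - g z) + cmod (f 1 - g 1)"
        by (rule norm_triangle_ineq4)
      also have "\<dots> < e"
        using g(2)[OF z] g(2)[of 1] by simp
      finally show "cmod (f z - h z) < e" .
    qed
    finally show "cmod (L f) \<le> C * e" .
  qed
qed

section \<open>Inner product arithmetic in an abstract Hilbert space\<close>

context complex_hilbert_space begin

lemma vdiff_closed: "x \<in> vecs H \<Longrightarrow> y \<in> vecs H \<Longrightarrow> vdiff H x y \<in> vecs H"
  by (simp add: vdiff_def add_closed scale_closed)

lemma inner_add_left:
  "x \<in> vecs H \<Longrightarrow> y \<in> vecs H \<Longrightarrow> z \<in> vecs H \<Longrightarrow>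
    vinner H (vadd H x y) z = vinner H x z + vinner H y z"
  using inner_commute[of z] inner_add_right add_closed by (metis complex_cnj_add)

lemma inner_scale_left:
  "x \<in> vecs H \<Longrightarrow> z \<in> vecs H \<Longrightarrow> vinner H (vscale H a x) z = cnj a * vinner H x z"
  using inner_commute[of z] inner_scale_right scale_closed by (metis complex_cnj_mult)

lemma inner_diff_right:
  "x \<in> vecs H \<Longrightarrow> y \<in> vecs H \<Longrightarrow> z \<in> vecs H \<Longrightarrow>
    vinner H x (vdiff H y z) = vinner H x y - vinner H x z"
  by (simp add: vdiff_def inner_add_right inner_scale_right scale_closed)

lemma inner_diff_left:
  "x \<in> vecs H \<Longrightarrow> y \<in> vecs H \<Longrightarrow> z \<in> vecs H \<Longrightarrow>
    vinner H (vdiff H x y) z = vinner H x z - vinner H y z"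
  by (simp add: vdiff_def inner_add_left inner_scale_left scale_closed)

lemma vinner_self: "x \<in> vecs H \<Longrightarrow> vinner H x x = of_real ((vnorm H x)\<^sup>2)"
  using inner_commute[of x x] inner_nonneg[of x]
  by (auto simp: vnorm_def complex_eq_iff)

lemma vdiff_eq_zeroD:
  assumes x: "x \<in> vecs H" and y: "y \<in> vecs H" and 0: "vdiff H x y = vzero H"
  shows "x = y"
proof -
  note c = x y scale_closed[OF y] 
  have "vadd H (vadd H x (vscale H (-1) y)) y = vadd H x (vadd H y (vscale H (-1) y))"
    using c by (simp add: add_assoc add_commute[of "vscale H (-1) y" y])
  then show ?thesis
    using 0 c by (simp add: vdiff_def add_inverse add_zero add_commute[of "vzero H" y] zero_closed)
qed

text \<open>Testing against every vector reduces vector identities to arithmetic of complex numbers;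
  the operator identities below are obtained this way.\<close>

lemma vec_eqI:
  assumes "x \<in> vecs H" "y \<in> vecs H" "\<And>z. z \<in> vecs H \<Longrightarrow> vinner H z x = vinner H z y"
  shows "x = y"
proof -
  have d: "vdiff H x y \<in> vecs H"
    using assms by (simp add: vdiff_closed)
  have "vinner H (vdiff H x y) (vdiff H x y) = 0"
    using inner_diff_right[OF d assms(1,2)] assms(3)[OF d] by simp
  then show ?thesis
    using vdiff_eq_zeroD[OF assms(1,2)] inner_definite[OF d] by simp
qed

text \<open>A linearised Cauchy-Schwarz inequality, from expanding the square norm of
  \<open>e * u\<close> times x minus y, where \<open>u\<close> is the phase of the inner product.
  Its bound is a constant times \<open>e\<close>, as \<open>functional_on_circle_eq_0\<close>
  requires, and no division by a norm occurs.\<close>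

lemma inner_le_scaled_norms:
  assumes x: "x \<in> vecs H" and y: "y \<in> vecs H" and e: "e > 0"
    and le: "vnorm H y \<le> e * b" and b: "0 \<le> b"
  shows "cmod (vinner H x y) \<le> ((vnorm H x)\<^sup>2 + b\<^sup>2) / 2 * e"
proof -
  define c where "c = vinner H x y"
  define u where "u = (if c = 0 then 1 else c / cmod c)"
  have u: "cmod u = 1" "cnj u * c = cmod c"
    by (auto simp: u_def norm_divide complex_norm_square[symmetric] mult.commute power2_eq_square)
  have u': "c * cnj u = cmod c" "cnj c * u = cmod c"
    using u(2) by (simp_all add: mult.commute) (metis complex_cnj_cnj complex_cnj_complex_of_real complex_cnj_mult u(2))
  define a where "a = of_real e * u"
  have cy: "vinner H y x = cnj c" using inner_commute[OF x y] by (simp add: c_def)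
  let ?d = "vdiff H (vscale H a x) y"
  have "vinner H ?d ?d = cnj a * a * vinner H x x - cnj a * c - a * cnj c + vinner H y y"
    using x y
    by (simp add: inner_diff_right inner_diff_left scale_closed vdiff_closed inner_scale_left
        inner_scale_right cy c_def[symmetric] algebra_simps)
  also have "cnj a * a = of_real (e\<^sup>2)"
    using u(1) by (simp add: a_def complex_norm_square[symmetric] mult.commute power2_eq_square mult.left_commute)
  also have "cnj a * c = of_real (e * cmod c)"
    using u by (simp add: a_def mult.assoc)
  also have "a * cnj c = of_real (e * cmod c)"
    using u' by (simp add: a_def ac_simps)
  finally have "0 \<le> e\<^sup>2 * (vnorm H x)\<^sup>2 - 2 * e * cmod c + (vnorm H y)\<^sup>2"
    using inner_nonneg[of ?d] x y by (simp add: vinner_self vdiff_closed scale_closed)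
  moreover have "(vnorm H y)\<^sup>2 \<le> (e * b)\<^sup>2"
    using inner_nonneg[OF y] by (intro power_mono le) (auto simp: vnorm_def)
  ultimately have "e * (2 * cmod c) \<le> e * (e * ((vnorm H x)\<^sup>2 + b\<^sup>2))"
    by (simp add: power2_eq_square algebra_simps)
  then have "2 * cmod c \<le> e * ((vnorm H x)\<^sup>2 + b\<^sup>2)"
    using e by (rule mult_left_le_imp_le)
  then show ?thesis by (simp add: c_def algebra_simps)
qed

end

section \<open>Functional calculus of a unitary operator minus the identity\<close>

context complex_hilbert_space begin

lemma bounded_ops_closed: "T \<in> bounded_ops H \<Longrightarrow> x \<in> vecs H \<Longrightarrow> T x \<in> vecs H"
  by (auto simp: bounded_ops_def)

lemma vnorm_nonneg: "x \<in> vecs H \<Longrightarrow> 0 \<le> vnorm H x"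
  by (simp add: vnorm_def inner_nonneg)

lemma functional_calculusD:
  assumes \<Theta>: "functional_calculus H T \<Theta>" and f: "continuous_on UNIV f" and x: "x \<in> vecs H"
  shows "\<Theta> f \<in> bounded_ops H"
    and "\<Theta> (\<lambda>z. a * f z) x = vscale H a (\<Theta> f x)"
    and "y \<in> vecs H \<Longrightarrow> vinner H (\<Theta> f x) y = vinner H x (\<Theta> (\<lambda>z. cnj (f z)) y)"
    and "continuous_on UNIV g \<Longrightarrow> \<Theta> (\<lambda>z. f z + g z) x = vadd H (\<Theta> f x) (\<Theta> g x)"
    and "continuous_on UNIV g \<Longrightarrow> \<Theta> (\<lambda>z. f z * g z) x = \<Theta> f (\<Theta> g x)"
proof -
  have c: "continuous_on (op_spectrum H T) g" if "continuous_on UNIV g" for g :: "complex \<Rightarrow> complex"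
    using continuous_on_subset[OF that] by blast
  note \<Theta> = \<Theta>[unfolded functional_calculus_def Let_def, simplified]
  note cf = c[OF f]
  show "\<Theta> f \<in> bounded_ops H"
    using \<Theta> cf by blast
  have "\<Theta> (\<lambda>z. a * f z) = op_scale H a (\<Theta> f)"
    using \<Theta> cf by blast
  then show "\<Theta> (\<lambda>z. a * f z) x = vscale H a (\<Theta> f x)"
    using x by (simp add: op_scale_def)
  have "is_adjoint H (\<Theta> f) (\<Theta> (\<lambda>z. cnj (f z)))"
    using \<Theta> cf by blast
  then show "y \<in> vecs H \<Longrightarrow> vinner H (\<Theta> f x) y = vinner H x (\<Theta> (\<lambda>z. cnj (f z)) y)"
    using x by (simp add: is_adjoint_def)
  assume "continuous_on UNIV g"
  then have cg: "continuous_on (op_spectrum H T) g" by (rule c)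
  have "\<Theta> (\<lambda>z. f z + g z) = op_add H (\<Theta> f) (\<Theta> g)"
    using \<Theta> cf cg by blast
  then show "\<Theta> (\<lambda>z. f z + g z) x = vadd H (\<Theta> f x) (\<Theta> g x)"
    using x by (simp add: op_add_def)
  have "\<Theta> (\<lambda>z. f z * g z) = op_mult H (\<Theta> f) (\<Theta> g)"
    using \<Theta> cf cg by blast
  then show "\<Theta> (\<lambda>z. f z * g z) x = \<Theta> f (\<Theta> g x)"
    using x by (simp add: op_mult_def compose_def)
qed

lemma functional_calculus_closed:
  "functional_calculus H T \<Theta> \<Longrightarrow> continuous_on UNIV f \<Longrightarrow> x \<in> vecs H \<Longrightarrow> \<Theta> f x \<in> vecs H"
  by (rule bounded_ops_closed[OF functional_calculusD(1)])

lemma functional_calculus_one: "functional_calculus H T \<Theta> \<Longrightarrow> x \<in> vecs H \<Longrightarrow> \<Theta> (\<lambda>z. 1) x = x"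
  by (simp add: functional_calculus_def op_id_def Let_def)

lemma functional_calculus_inner_sq:
  assumes "functional_calculus H T \<Theta>" "continuous_on UNIV f" "x \<in> vecs H" "y \<in> vecs H"
  shows "vinner H x (\<Theta> (\<lambda>z. cnj (f z) * f z) y) = vinner H (\<Theta> f x) (\<Theta> f y)"
  using functional_calculusD(3)[OF assms(1-3)] functional_calculusD(5)[OF assms(1) _ assms(4) assms(2)]
    assms functional_calculus_closed
  by (simp add: continuous_on_cnj)

text \<open>With h the square root of c^2 - |g|^2, the function |h|^2 + |g|^2 is the constant c^2.
  Hence the square norms of the images of x under h and g add up to c^2 times that of x.\<close>

lemma functional_calculus_norm_le:
  assumes \<Theta>: "functional_calculus H T \<Theta>" and g: "continuous_on UNIV g"
    and le: "\<And>z. cmod (g z) \<le> c" and x: "x \<in> vecs H"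
  shows "vnorm H (\<Theta> g x) \<le> c * vnorm H x"
proof -
  have c: "0 \<le> c" using norm_ge_zero le by (rule order_trans)
  define h where "h z = complex_of_real (sqrt (c\<^sup>2 - (cmod (g z))\<^sup>2))" for z
  have h: "continuous_on UNIV h"
    unfolding h_def by (intro continuous_intros g)
  have "cnj (h z) * h z + cnj (g z) * g z = of_real (c\<^sup>2) * 1" for z
  proof -
    have "(cmod (g z))\<^sup>2 \<le> c\<^sup>2" using le by (intro power_mono) auto
    then have "cnj (h z) * h z = of_real (c\<^sup>2 - (cmod (g z))\<^sup>2)"
      by (simp add: h_def del: of_real_diff of_real_power flip: of_real_mult)
    moreover have "cnj (g z) * g z = of_real ((cmod (g z))\<^sup>2)"
      by (metis complex_norm_square mult.commute)
    ultimately show ?thesis by simp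
  qed
  then have "\<Theta> (\<lambda>z. cnj (h z) * h z + cnj (g z) * g z) x = \<Theta> (\<lambda>z. of_real (c\<^sup>2) * 1) x"
    by presburger
  also have "\<dots> = vscale H (of_real (c\<^sup>2)) x"
    by (subst functional_calculusD(2)[OF \<Theta> _ x]) (auto simp: functional_calculus_one[OF \<Theta> x])
  finally have "vinner H x (\<Theta> (\<lambda>z. cnj (h z) * h z + cnj (g z) * g z) x) = of_real ((c * vnorm H x)\<^sup>2)"
    by (simp add: inner_scale_right x vinner_self power_mult_distrib)
  also have "\<Theta> (\<lambda>z. cnj (h z) * h z + cnj (g z) * g z) x =
      vadd H (\<Theta> (\<lambda>z. cnj (h z) * h z) x) (\<Theta> (\<lambda>z. cnj (g z) * g z) x)"
    by (intro functional_calculusD(4)[OF \<Theta> _ x] continuous_intros h g)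
  also have "vinner H x \<dots> = vinner H (\<Theta> h x) (\<Theta> h x) + vinner H (\<Theta> g x) (\<Theta> g x)"
    by (subst inner_add_right)
      (auto intro!: functional_calculus_closed[OF \<Theta>] continuous_intros h g x
        simp: functional_calculus_inner_sq[OF \<Theta>] h g x)
  also have "\<dots> = of_real ((vnorm H (\<Theta> h x))\<^sup>2 + (vnorm H (\<Theta> g x))\<^sup>2)"
    by (simp add: vinner_self functional_calculus_closed[OF \<Theta>] h g x)
  finally have "(vnorm H (\<Theta> h x))\<^sup>2 + (vnorm H (\<Theta> g x))\<^sup>2 = (c * vnorm H x)\<^sup>2"
    by (simp only: of_real_eq_iff)
  then have "(vnorm H (\<Theta> g x))\<^sup>2 \<le> (c * vnorm H x)\<^sup>2"
    using zero_le_power2[of "vnorm H (\<Theta> h x)"] by linarith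
  then show ?thesis
    by (rule power2_le_imp_le) (use c inner_nonneg[OF x] in \<open>auto simp: vnorm_def\<close>)
qed

lemma functional_calculus_shift_power:
  assumes V: "V \<in> bounded_ops H" and \<Theta>: "functional_calculus H (op_diff H V (op_id H)) \<Theta>"
    and x: "x \<in> vecs H"
  shows "\<Theta> (\<lambda>z. (z + 1) ^ n) x = (V ^^ n) x" "(V ^^ n) x \<in> vecs H"
proof -
  have one: "\<Theta> (\<lambda>z. z + 1) y = V y" if y: "y \<in> vecs H" for y
  proof -
    have "\<Theta> (\<lambda>z. z + 1) y = vadd H (\<Theta> (\<lambda>z. z) y) (\<Theta> (\<lambda>z. 1) y)"
      by (rule functional_calculusD(4)[OF \<Theta> _ y]) auto
    also have "\<dots> = vadd H (vdiff H (V y) y) y"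
      using \<Theta> y by (simp add: functional_calculus_one[OF \<Theta> y])
        (simp add: functional_calculus_def Let_def op_diff_def op_id_def)
    also have "\<dots> = V y"
      using bounded_ops_closed[OF V y] y
      by (simp add: vdiff_def add_assoc scale_closed add_commute[of "vscale H (-1) y" y]
          add_inverse add_zero)
    finally show ?thesis .
  qed
  show closed: "(V ^^ n) x \<in> vecs H" for n
    by (induction n) (auto simp: x bounded_ops_closed[OF V])
  show "\<Theta> (\<lambda>z. (z + 1) ^ n) x = (V ^^ n) x"
  proof (induction n)
    case 0
    show ?case by (simp add: functional_calculus_one[OF \<Theta> x])
  next
    case (Suc n)
    have "\<Theta> (\<lambda>z. (z + 1) ^ Suc n) x = \<Theta> (\<lambda>z. (z + 1) * (z + 1) ^ n) x"
      by simp
    also have "\<dots> = \<Theta> (\<lambda>z. z + 1) (\<Theta> (\<lambda>z. (z + 1) ^ n) x)"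
      by (rule functional_calculusD(5)[OF \<Theta> _ x]) (auto intro!: continuous_intros)
    also have "\<dots> = (V ^^ Suc n) x"
      by (simp add: Suc one closed)
    finally show ?case .
  qed
qed

text \<open>
  The spectrum of \<open>V - I\<close> need not be located: \<open>q z = \<bar>z + 1\<bar>\<^sup>2 - 1\<close> is annihilated by the
  functional calculus, and \<open>d\<close> differs from its truncation at height \<open>e\<close> by a multiple of \<open>q\<close>.
\<close>

lemma functional_calculus_shifted_circle_bound:
  assumes V: "V \<in> bounded_ops H"
    and iso: "\<And>x y. x \<in> vecs H \<Longrightarrow> y \<in> vecs H \<Longrightarrow> vinner H (V x) (V y) = vinner H x y"
    and \<Theta>: "functional_calculus H (op_diff H V (op_id H)) \<Theta>"
    and d: "continuous_on UNIV d" and e: "e > 0"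
    and small: "\<And>z. cmod (z + 1) = 1 \<Longrightarrow> cmod (d z) < e"
    and x: "x \<in> vecs H" and y: "y \<in> vecs H"
  shows "cmod (vinner H x (\<Theta> d y)) \<le> ((vnorm H x)\<^sup>2 + (vnorm H y)\<^sup>2) / 2 * e"
proof -
  define s where "s z = cnj (z + 1) * (z + 1)" for z :: complex
  define q where "q z = s z + (-1) * 1" for z
  define d1 where "d1 z = d z * of_real (e / max (cmod (d z)) e)" for z
  define g where "g z = (d z - d1 z) / q z" for z
  have q0: "q z = 0 \<longleftrightarrow> cmod (z + 1) = 1" for z
  proof -
    have "q z = of_real ((cmod (z + 1))\<^sup>2 - 1)"
    proof -
      have "s z = of_real ((cmod (z + 1))\<^sup>2)"
        unfolding s_def by (metis complex_norm_square mult.commute)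
      then show ?thesis by (simp add: q_def)
    qed
    then have "q z = 0 \<longleftrightarrow> (cmod (z + 1))\<^sup>2 = 1" by (simp del: of_real_diff)
    then show ?thesis by (simp add: power2_eq_1_iff) (use norm_ge_zero[of "z+1"] in linarith)
  qed
  have cs: "continuous_on UNIV s" unfolding s_def by (intro continuous_intros)
  then have cq: "continuous_on UNIV q" unfolding q_def by (intro continuous_intros)
  have max0: "max (cmod (d z)) e \<noteq> 0" for z using e by (auto simp: max_def)
  have cd1: "continuous_on UNIV d1"
    unfolding d1_def by (intro continuous_intros d) (use max0 in auto)
  have d1_le: "cmod (d1 z) \<le> e" for z
  proof -
    have "cmod (d1 z) = cmod (d z) * e / max (cmod (d z)) e"
      using e by (simp add: d1_def norm_mult norm_divide max_def)
    also have "\<dots> \<le> e"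
      using e by (auto simp: field_simps max_def)
    finally show ?thesis .
  qed
  have d1_eq: "d1 z = d z" if "cmod (d z) < e" for z
    using that e by (simp add: d1_def max_def)
  \<comment> \<open>At a zero of \<open>q\<close> the hypothesis \<open>small\<close> gives
    \<open>cmod (d z) < e\<close>, which is an open condition. So \<open>d1\<close> and
    \<open>d\<close> agree near z, and \<open>g\<close> vanishes in a neighbourhood.\<close>
  have "isCont g z" for z
  proof (cases "q z = 0")
    case True
    have "eventually (\<lambda>w. cmod (d w) < e) (nhds z)"
    proof -
      have "open {w. cmod (d w) < e}"
        by (intro open_Collect_less continuous_intros d)
      then show ?thesis
        using small True q0 by (auto intro!: eventually_nhds_in_open[of "{w. cmod (d w) < e}", simplified])
    qed
    then have ev: "eventually (\<lambda>w. g w = 0) (nhds z)"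
      by eventually_elim (simp add: g_def d1_eq)
    then have "isCont g z \<longleftrightarrow> isCont (\<lambda>_. 0 :: complex) z"
      by (intro isCont_cong)
    then show ?thesis by simp
  next
    case False
    have "isCont d z" "isCont d1 z" "isCont q z"
      using d cd1 cq by (auto simp: continuous_on_eq_continuous_at)
    then show ?thesis
      unfolding g_def using False by (intro continuous_intros)
  qed
  then have cg: "continuous_on UNIV g" by (simp add: continuous_on_eq_continuous_at)
  have dq: "d z = d1 z + q z * g z" for z
    using d1_eq small q0 by (cases "q z = 0") (auto simp: g_def)
  \<comment> \<open>The image of \<open>s\<close> is V* V in the weak sense, and \<open>iso\<close>
    identifies it with the identity.\<close>
  have q_zero: "vinner H x (\<Theta> q w) = 0" if w: "w \<in> vecs H" for w
  proof -
    have "\<Theta> q w = vadd H (\<Theta> s w) (\<Theta> (\<lambda>z. (-1) * 1) w)"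
      unfolding q_def by (intro functional_calculusD(4)[OF \<Theta> _ w] cs continuous_intros)
    also have "\<Theta> (\<lambda>z. (-1) * 1) w = vscale H (-1) w"
      by (subst functional_calculusD(2)[OF \<Theta> _ w]) (auto simp: functional_calculus_one[OF \<Theta> w])
    finally have "vinner H x (\<Theta> q w) = vinner H x (\<Theta> s w) - vinner H x w"
      using functional_calculus_closed[OF \<Theta> cs w] x w
      by (simp add: inner_add_right inner_scale_right scale_closed)
    moreover have "vinner H x (\<Theta> s w) = vinner H (\<Theta> (\<lambda>z. z + 1) x) (\<Theta> (\<lambda>z. z + 1) w)"
      unfolding s_def by (intro functional_calculus_inner_sq[OF \<Theta>] x w continuous_intros)
    moreover have "\<Theta> (\<lambda>z. z + 1) v = V v" if "v \<in> vecs H" for v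
      using functional_calculus_shift_power(1)[OF V \<Theta> that, of 1] by simp
    ultimately show ?thesis using iso x w by simp
  qed
  have "\<Theta> d y = \<Theta> (\<lambda>z. d1 z + q z * g z) y"
    using dq by presburger
  also have "\<dots> = vadd H (\<Theta> d1 y) (\<Theta> (\<lambda>z. q z * g z) y)"
    by (intro functional_calculusD(4)[OF \<Theta> _ y] continuous_intros cd1 cq cg)
  also have "\<Theta> (\<lambda>z. q z * g z) y = \<Theta> q (\<Theta> g y)"
    by (intro functional_calculusD(5)[OF \<Theta> _ y] cq cg)
  finally have "vinner H x (\<Theta> d y) = vinner H x (\<Theta> d1 y)"
    using functional_calculus_closed[OF \<Theta>] cd1 cq cg x y by (simp add: inner_add_right q_zero)
  moreover have "vnorm H (\<Theta> d1 y) \<le> e * vnorm H y"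
    by (rule functional_calculus_norm_le[OF \<Theta> cd1 d1_le y])
  ultimately show ?thesis
    using inner_le_scaled_norms[OF x functional_calculus_closed[OF \<Theta> cd1 y] e _ vnorm_nonneg[OF y]]
    by simp
qed

lemma generated_algebra_bounded: "X \<in> generated_algebra H T \<Longrightarrow> X \<in> bounded_ops H"
  using functional_calculusD(1)[OF _ _ zero_closed] by (auto simp: generated_algebra_def)

text \<open>Transfers a proportionality of matrix elements from the powers of V to all of its
  algebra. The hypotheses compare V^n - I instead of V^n because the admissible functions vanish at
  0; \<open>copow\<close> supplies the negative powers. The factor \<open>a\<close> lets one lemma
  serve both absorption (a = 1) and compression.\<close>

lemma generated_algebra_inner_eq:
  assumes V: "V \<in> bounded_ops H"
    and iso: "\<And>x y. x \<in> vecs H \<Longrightarrow> y \<in> vecs H \<Longrightarrow> vinner H (V x) (V y) = vinner H x y"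
    and X: "X \<in> generated_algebra H (op_diff H V (op_id H))"
    and v: "x1 \<in> vecs H" "y1 \<in> vecs H" "x2 \<in> vecs H" "y2 \<in> vecs H"
    and pow: "\<And>n. vinner H x1 ((V ^^ n) y1) - vinner H x1 y1 =
      a * (vinner H x2 ((V ^^ n) y2) - vinner H x2 y2)"
    and copow: "\<And>n. vinner H ((V ^^ n) x1) y1 - vinner H x1 y1 =
      a * (vinner H ((V ^^ n) x2) y2 - vinner H x2 y2)"
  shows "vinner H x1 (X y1) = a * vinner H x2 (X y2)"
proof -
  obtain \<Theta> f where \<Theta>: "functional_calculus H (op_diff H V (op_id H)) \<Theta>"
    and f: "continuous_on UNIV f" "f 0 = 0" "X = \<Theta> f"
    using X by (auto simp: generated_algebra_def)
  \<comment> \<open>\<open>F\<close> lives on the circle, while the calculus is that of V - I; hence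
    the shift by 1, undone below by the choice \<open>f (w - 1)\<close>.\<close>
  define L where "L F = vinner H x1 (\<Theta> (\<lambda>z. F (z + 1)) y1) - a * vinner H x2 (\<Theta> (\<lambda>z. F (z + 1)) y2)" for F
  have shift: "continuous_on UNIV (\<lambda>z. F (z + 1))" if "continuous_on UNIV F" for F :: "complex \<Rightarrow> complex"
    by (rule continuous_on_compose2[OF that]) (auto intro!: continuous_intros)
  note cl = functional_calculus_closed[OF \<Theta>]
  have add: "L (\<lambda>z. F z + G z) = L F + L G" if "continuous_on UNIV F" "continuous_on UNIV G" for F G
    unfolding L_def using that shift v cl
    by (simp add: functional_calculusD(4)[OF \<Theta>] inner_add_right algebra_simps)
  have scale: "L (\<lambda>z. b * F z) = b * L F" if "continuous_on UNIV F" for b F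
    unfolding L_def using that shift v cl
    by (simp add: functional_calculusD(2)[OF \<Theta>] inner_scale_right algebra_simps)
  define C where "C = ((vnorm H x1)\<^sup>2 + (vnorm H y1)\<^sup>2) / 2 +
    cmod a * (((vnorm H x2)\<^sup>2 + (vnorm H y2)\<^sup>2) / 2)"
  have one: "L (\<lambda>z. 1) = vinner H x1 y1 - a * vinner H x2 y2"
    by (simp add: L_def functional_calculus_one[OF \<Theta>] v)
  have minus: "L (\<lambda>z. F z - 1) = L F - L (\<lambda>z. 1)" if "continuous_on UNIV F" for F
    using add[OF that, of "\<lambda>z. (-1) * 1"] scale[of "\<lambda>z. 1" "-1"] by simp
  have "L (\<lambda>w. f (w - 1)) = 0"
  proof (rule functional_on_circle_eq_0[where L = L and C = C])
    fix F :: "complex \<Rightarrow> complex" and e :: real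
    assume F: "continuous_on UNIV F" "e > 0" "\<And>z. cmod z = 1 \<Longrightarrow> cmod (F z) < e"
    note b = functional_calculus_shifted_circle_bound[OF V iso \<Theta> shift[OF F(1)] F(2) F(3)]
    have "cmod (L F) \<le> cmod (vinner H x1 (\<Theta> (\<lambda>z. F (z + 1)) y1)) +
        cmod (a * vinner H x2 (\<Theta> (\<lambda>z. F (z + 1)) y2))"
      unfolding L_def by (rule norm_triangle_ineq4)
    also have "\<dots> \<le> C * e"
      unfolding C_def norm_mult distrib_right mult.assoc[of "cmod a"]
      by (intro add_mono mult_left_mono b v) auto
    finally show "cmod (L F) \<le> C * e" .
  next
    fix n
    have "L (\<lambda>z. z ^ n - 1) = L (\<lambda>z. z ^ n) - L (\<lambda>z. 1)"
      by (rule minus) (intro continuous_intros)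
    also have "L (\<lambda>z. z ^ n) = vinner H x1 ((V ^^ n) y1) - a * vinner H x2 ((V ^^ n) y2)"
      by (simp add: L_def functional_calculus_shift_power[OF V \<Theta>] v)
    finally show "L (\<lambda>z. z ^ n - 1) = 0"
      using pow[of n] by (simp add: one algebra_simps)
    have adj: "vinner H x (\<Theta> (\<lambda>z. cnj (z + 1) ^ n) y) = vinner H ((V ^^ n) x) y"
      if "x \<in> vecs H" "y \<in> vecs H" for x y
      using functional_calculusD(3)[OF \<Theta> _ that, of "\<lambda>z. (z + 1) ^ n"] that
      by (simp add: functional_calculus_shift_power[OF V \<Theta>] continuous_intros)
    have "L (\<lambda>z. cnj z ^ n - 1) = L (\<lambda>z. cnj z ^ n) - L (\<lambda>z. 1)"
      by (rule minus) (intro continuous_intros)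
    also have "L (\<lambda>z. cnj z ^ n) = vinner H ((V ^^ n) x1) y1 - a * vinner H ((V ^^ n) x2) y2"
      using adj v by (simp add: L_def)
    finally show "L (\<lambda>z. cnj z ^ n - 1) = 0"
      using copow[of n] by (simp add: one algebra_simps)
  next
    show "continuous_on UNIV (\<lambda>w. f (w - 1))"
      by (rule continuous_on_compose2[OF f(1)]) (auto intro!: continuous_intros)
  qed (simp_all add: f add scale)
  then show ?thesis by (simp add: L_def f)
qed

end

section \<open>A criterion for monotone independence\<close>

context complex_hilbert_space begin

lemma bounded_ops_scale:
  "T \<in> bounded_ops H \<Longrightarrow> x \<in> vecs H \<Longrightarrow> T (vscale H a x) = vscale H a (T x)"
  by (auto simp: bounded_ops_def)

lemma op_prod_Nil [simp]: "x \<in> vecs H \<Longrightarrow> op_prod H [] x = x"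
  by (simp add: op_prod_def op_id_def)

lemma op_prod_Cons [simp]: "x \<in> vecs H \<Longrightarrow> op_prod H (T # Ts) x = T (op_prod H Ts x)"
  by (simp add: op_prod_def op_mult_def compose_def)

lemma op_prod_closed:
  "set Ts \<subseteq> bounded_ops H \<Longrightarrow> x \<in> vecs H \<Longrightarrow> op_prod H Ts x \<in> vecs H"
  by (induction Ts) (auto simp: bounded_ops_closed)

lemma op_prod_append:
  "set Ts \<subseteq> bounded_ops H \<Longrightarrow> x \<in> vecs H \<Longrightarrow>
    op_prod H (Ss @ Ts) x = op_prod H Ss (op_prod H Ts x)"
  by (induction Ss) (auto simp: op_prod_closed)

lemma op_prod_scale:
  "set Ts \<subseteq> bounded_ops H \<Longrightarrow> x \<in> vecs H \<Longrightarrow>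
    op_prod H Ts (vscale H a x) = vscale H a (op_prod H Ts x)"
  by (induction Ts) (auto simp: op_prod_closed scale_closed bounded_ops_scale)

text \<open>Only the last factor of the product acts on the vector itself, so for a nonempty product
  agreement under that factor is enough.\<close>

lemma op_prod_absorb_right:
  assumes "Ts \<noteq> []" "set Ts \<subseteq> bounded_ops H" "x \<in> vecs H" "y \<in> vecs H"
    and "\<And>T. T \<in> set Ts \<Longrightarrow> T x = T y"
  shows "op_prod H Ts x = op_prod H Ts y"
  using assms
proof (induction Ts)
  case (Cons T Ts)
  then show ?case by (cases Ts) auto
qed simp

text \<open>\<open>Q j\<close> plays the projection onto the past of index j: it leaves everything
  produced by smaller indices unchanged, and between two copies of it an element of
  \<open>A j\<close> collapses to its state.\<close>

lemma monotonically_independentI: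
  fixes A :: "'i::linorder \<Rightarrow> ('v \<Rightarrow> 'v) set" and Q :: "'i \<Rightarrow> 'v \<Rightarrow> 'v"
  assumes A: "\<And>i X. i \<in> I \<Longrightarrow> X \<in> A i \<Longrightarrow> X \<in> bounded_ops H"
    and Q: "\<And>i x. i \<in> I \<Longrightarrow> x \<in> vecs H \<Longrightarrow> Q i x \<in> vecs H"
    and low: "\<And>i j X x. i \<in> I \<Longrightarrow> j \<in> I \<Longrightarrow> i < j \<Longrightarrow> X \<in> A i \<Longrightarrow> x \<in> vecs H \<Longrightarrow>
      Q j (X x) = X x \<and> X (Q j x) = X x"
    and compress: "\<And>j X x. j \<in> I \<Longrightarrow> X \<in> A j \<Longrightarrow> x \<in> vecs H \<Longrightarrow>
      Q j (X (Q j x)) = vscale H (state H \<xi> X) (Q j x)"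
    and \<xi>: "\<xi> \<in> vecs H" "\<And>j. j \<in> I \<Longrightarrow> Q j \<xi> = \<xi>"
      "\<And>j x. j \<in> I \<Longrightarrow> x \<in> vecs H \<Longrightarrow> vinner H \<xi> (Q j x) = vinner H \<xi> x"
  shows "monotonically_independent H \<xi> I A"
  unfolding monotonically_independent_def
proof (intro conjI allI impI ballI)
  fix i j k X Y Z
  assume I: "i \<in> I" "j \<in> I" "k \<in> I" and lt: "i < j \<and> k < j"
    and XYZ: "X \<in> A i" "Y \<in> A j" "Z \<in> A k"
  note b = A[OF I(1) XYZ(1)] A[OF I(2) XYZ(2)] A[OF I(3) XYZ(3)]
  show "op_prod H [X, Y, Z] = op_scale H (state H \<xi> Y) (op_mult H X Z)"
  proof (rule ext)
    fix x
    show "op_prod H [X, Y, Z] x = op_scale H (state H \<xi> Y) (op_mult H X Z) x"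
    proof (cases "x \<in> vecs H")
      case True
      note Zx = bounded_ops_closed[OF b(3) True]
      have "X (Y (Z x)) = X (Q j (Y (Q j (Z x))))"
        using low[OF I(1,2) _ XYZ(1)] low[OF I(3,2) _ XYZ(3) True] lt Zx
        by (simp add: bounded_ops_closed[OF b(2)])
      also have "\<dots> = vscale H (state H \<xi> Y) (X (Q j (Z x)))"
        by (simp add: compress[OF I(2) XYZ(2) Zx] bounded_ops_scale[OF b(1)] Q[OF I(2) Zx])
      also have "Q j (Z x) = Z x"
        using low[OF I(3,2) _ XYZ(3) True] lt by simp
      finally show ?thesis
        using True by (simp add: op_scale_def op_mult_def compose_def)
    qed (simp add: op_prod_def op_scale_def op_mult_def compose_def)
  qed
next
  fix "is" j ks Xs Y Zs
  assume "set is \<subseteq> I \<and> j \<in> I \<and> set ks \<subseteq> I \<and>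
    sorted_wrt (>) (is @ [j]) \<and> sorted_wrt (>) (ks @ [j]) \<and>
    list_all2 (\<lambda>i X. X \<in> A i) is Xs \<and> Y \<in> A j \<and> list_all2 (\<lambda>k Z. Z \<in> A k) ks Zs"
  then have I: "set is \<subseteq> I" "j \<in> I" "set ks \<subseteq> I"
    and sorted: "sorted_wrt (>) (is @ [j])" "sorted_wrt (>) (ks @ [j])"
    and Xs: "list_all2 (\<lambda>i X. X \<in> A i) is Xs" and Y: "Y \<in> A j"
    and Zs: "list_all2 (\<lambda>k Z. Z \<in> A k) ks Zs" by auto
  note Yb = A[OF I(2) Y]
  have mem: "\<exists>i\<in>set is'. X \<in> A i" if "list_all2 (\<lambda>i X. X \<in> A i) is' Xs'" "X \<in> set Xs'" for is' Xs' X
    using that by (induction rule: list_all2_induct) auto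
  have bdd: "set Xs' \<subseteq> bounded_ops H" if "list_all2 (\<lambda>i X. X \<in> A i) is' Xs'" "set is' \<subseteq> I" for is' Xs'
    using mem[OF that(1)] that(2) A by blast
  \<comment> \<open>Induction from the factor nearest to \<xi>. It has the largest index k, and
    every factor to its left has a smaller one, so \<open>Q k\<close> can be inserted after it.
    Since \<xi> is fixed by \<open>Q k\<close>, the factor is compressed to a scalar.\<close>
  have right: "op_prod H (Y # rev Zs) \<xi> = vscale H (prod_list (map (state H \<xi>) Zs)) (Y \<xi>)"
    using Zs sorted(2) I(3)
  proof (induction rule: list_all2_induct)
    case Nil
    then show ?case by (simp add: \<xi> scale_one bounded_ops_closed[OF Yb])
  next
    case (Cons k ks Z Zs)
    have k: "k \<in> I" "j < k" and ks: "set ks \<subseteq> I" "\<And>i. i \<in> set ks \<Longrightarrow> i < k"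
      using Cons.prems by auto
    have Zb: "Z \<in> bounded_ops H" using A[OF k(1)] Cons.hyps by simp
    note Z\<xi> = bounded_ops_closed[OF Zb \<xi>(1)]
    have Wb: "set (Y # rev Zs) \<subseteq> bounded_ops H"
      using bdd[OF Cons.hyps(2) ks(1)] Yb by auto
    have "op_prod H (Y # rev (Z # Zs)) \<xi> = op_prod H (Y # rev Zs) (Z \<xi>)"
      using op_prod_append[of "[Z]" \<xi> "Y # rev Zs"] Zb \<xi> by simp
    also have "\<dots> = op_prod H (Y # rev Zs) (Q k (Z \<xi>))"
    proof (rule op_prod_absorb_right[OF _ Wb Z\<xi> Q[OF k(1) Z\<xi>]])
      fix T assume "T \<in> set (Y # rev Zs)"
      then obtain i where i: "i \<in> I" "i < k" "T \<in> A i"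
        using mem[OF Cons.hyps(2)] Y I(2) k ks by fastforce
      show "T (Z \<xi>) = T (Q k (Z \<xi>))"
        using low[OF i(1) k(1) i(2,3) Z\<xi>] by simp
    qed simp
    also have "Q k (Z \<xi>) = vscale H (state H \<xi> Z) \<xi>"
      using compress[OF k(1) Cons.hyps(1) \<xi>(1)] by (simp add: \<xi>(2)[OF k(1)])
    also have "op_prod H (Y # rev Zs) \<dots> = vscale H (state H \<xi> Z) (op_prod H (Y # rev Zs) \<xi>)"
      by (rule op_prod_scale[OF Wb \<xi>(1)])
    also have "op_prod H (Y # rev Zs) \<xi> = vscale H (prod_list (map (state H \<xi>) Zs)) (Y \<xi>)"
      using Cons.IH Cons.prems by simp
    finally show ?case
      by (simp add: scale_scale bounded_ops_closed[OF Yb \<xi>(1)])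
  qed
  define v where "v = op_prod H (Y # rev Zs) \<xi>"
  have Zb: "set (rev Zs) \<subseteq> bounded_ops H"
    using bdd[OF Zs I(3)] by simp
  have v: "v \<in> vecs H" "v = Y (op_prod H (rev Zs) \<xi>)"
    unfolding v_def using Zb Yb \<xi>(1) by (simp_all add: op_prod_closed bounded_ops_closed)
  \<comment> \<open>The mirror image: the leftmost factor has the largest index, and the vector it
    acts on lies in the range of its projection.\<close>
  have left: "vinner H \<xi> (op_prod H Xs v) = prod_list (map (state H \<xi>) Xs) * vinner H \<xi> v"
    using Xs sorted(1) I(1)
  proof (induction rule: list_all2_induct)
    case Nil
    then show ?case using v(1) by simp
  next
    case (Cons i "is" X Xs)
    have i: "i \<in> I" "j < i" and is': "set is \<subseteq> I" "\<And>k. k \<in> set is \<Longrightarrow> k < i"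
      using Cons.prems by auto
    have Xb: "X \<in> bounded_ops H" using A[OF i(1)] Cons.hyps by simp
    note Xsb = bdd[OF Cons.hyps(2) is'(1)]
    let ?w = "op_prod H Xs v"
    have w: "?w \<in> vecs H" using op_prod_closed[OF Xsb v(1)] .
    \<comment> \<open>The outermost operator in \<open>?w\<close> has an index below i: it is the
      next X, or \<open>Y\<close> if none is left.\<close>
    have Qw: "Q i ?w = ?w"
    proof (cases Xs)
      case Nil
      then show ?thesis
        using low[OF I(2) i(1) i(2) Y op_prod_closed[OF Zb \<xi>(1)]] v by simp
    next
      case (Cons X' Xs')
      then obtain i' where i': "i' \<in> I" "i' < i" "X' \<in> A i'"
        using mem[OF Cons.hyps(2), of X'] is' by auto
      have "op_prod H Xs' v \<in> vecs H"
        using Xsb v Cons by (auto intro!: op_prod_closed)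
      then show ?thesis
        using low[OF i'(1) i(1) i'(2,3)] v Cons by simp
    qed
    have "vinner H \<xi> (op_prod H (X # Xs) v) = vinner H \<xi> (X (Q i ?w))"
      using v Qw by simp
    also have "\<dots> = vinner H \<xi> (Q i (X (Q i ?w)))"
      using \<xi>(3)[OF i(1)] bounded_ops_closed[OF Xb] Q[OF i(1) w] by simp
    also have "\<dots> = state H \<xi> X * vinner H \<xi> ?w"
      using compress[OF i(1) Cons.hyps(1) w] Qw w \<xi> by (simp add: inner_scale_right)
    finally show ?case
      using Cons.IH Cons.prems by simp
  qed
  have "op_prod H (Xs @ [Y] @ rev Zs) \<xi> = op_prod H Xs v"
    unfolding v_def using op_prod_append[of "Y # rev Zs" \<xi> Xs] Yb Zb \<xi> by simp
  then have "state H \<xi> (op_prod H (Xs @ [Y] @ rev Zs)) = vinner H \<xi> (op_prod H Xs v)"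
    by (simp only: state_def)
  also note left
  also have "vinner H \<xi> v = prod_list (map (state H \<xi>) Zs) * state H \<xi> Y"
    unfolding v_def right state_def[of H \<xi> Y]
    by (rule inner_scale_right[OF \<xi>(1) bounded_ops_closed[OF Yb \<xi>(1)]])
  finally show "state H \<xi> (op_prod H (Xs @ [Y] @ rev Zs)) =
    prod_list (map (state H \<xi>) Xs) * state H \<xi> Y * prod_list (map (state H \<xi>) Zs)"
    by (simp add: ac_simps)
qed

end

section \<open>Bounded, unitary and normal operators, and the algebra of one increment\<close>

context complex_hilbert_space begin

lemma bounded_opsD:
  assumes "T \<in> bounded_ops H"
  shows "T \<in> extensional (vecs H)"
    and "x \<in> vecs H \<Longrightarrow> y \<in> vecs H \<Longrightarrow> T (vadd H x y) = vadd H (T x) (T y)"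
    and "\<exists>C\<ge>0. \<forall>x\<in>vecs H. vnorm H (T x) \<le> C * vnorm H x"
proof -
  show "T \<in> extensional (vecs H)"
    "x \<in> vecs H \<Longrightarrow> y \<in> vecs H \<Longrightarrow> T (vadd H x y) = vadd H (T x) (T y)"
    using assms by (auto simp: bounded_ops_def PiE_def)
  obtain C where C: "\<forall>x\<in>vecs H. vnorm H (T x) \<le> C * vnorm H x"
    using assms by (auto simp: bounded_ops_def)
  have "vnorm H (T x) \<le> \<bar>C\<bar> * vnorm H x" if "x \<in> vecs H" for x
    using C[rule_format, OF that] mult_right_mono[OF abs_ge_self[of C] vnorm_nonneg[OF that]] by linarith
  then show "\<exists>C\<ge>0. \<forall>x\<in>vecs H. vnorm H (T x) \<le> C * vnorm H x"
    by (intro exI[of _ "\<bar>C\<bar>"]) auto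
qed

lemma op_eqI:
  assumes "S \<in> extensional (vecs H)" "T \<in> extensional (vecs H)" "\<And>x. x \<in> vecs H \<Longrightarrow> S x = T x"
  shows "S = T"
  using assms by (rule extensionalityI)

lemma op_mult_extensional: "op_mult H S T \<in> extensional (vecs H)"
  by (simp add: op_mult_def)

lemma op_id_extensional: "op_id H \<in> extensional (vecs H)"
  by (simp add: op_id_def)

lemma op_apply [simp]:
  assumes "x \<in> vecs H"
  shows "op_mult H S T x = S (T x)" "op_id H x = x" "op_diff H S T x = vdiff H (S x) (T x)"
    "op_add H S T x = vadd H (S x) (T x)"
  using assms by (simp_all add: op_mult_def compose_def op_id_def op_diff_def op_add_def)

lemma op_mult_bounded:
  assumes S: "S \<in> bounded_ops H" and T: "T \<in> bounded_ops H"
  shows "op_mult H S T \<in> bounded_ops H"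
proof -
  obtain C where C: "C \<ge> 0" "\<And>x. x \<in> vecs H \<Longrightarrow> vnorm H (S x) \<le> C * vnorm H x"
    using bounded_opsD(3)[OF S] by blast
  obtain D where D: "\<And>x. x \<in> vecs H \<Longrightarrow> vnorm H (T x) \<le> D * vnorm H x"
    using bounded_opsD(3)[OF T] by blast
  note cl = bounded_ops_closed[OF S] bounded_ops_closed[OF T]
  have "vnorm H (S (T x)) \<le> C * D * vnorm H x" if x: "x \<in> vecs H" for x
    using order_trans[OF C(2)[OF cl(2)[OF x]] mult_left_mono[OF D[OF x] C(1)]] by (simp add: mult.assoc)
  then show ?thesis
    unfolding bounded_ops_def
    by (auto simp: PiE_def op_mult_extensional cl add_closed scale_closed
        bounded_opsD(2)[OF S] bounded_opsD(2)[OF T] bounded_ops_scale[OF S] bounded_ops_scale[OF T])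
qed

lemma op_id_bounded: "op_id H \<in> bounded_ops H"
  unfolding bounded_ops_def
  by (auto simp: PiE_def op_id_extensional add_closed scale_closed intro!: exI[of _ 1])

text \<open>The parallelogram law with the term of the sum dropped. It takes the place of the
  triangle inequality in \<open>op_diff_bounded\<close>.\<close>

lemma vnorm_diff_sq_le:
  assumes "x \<in> vecs H" "y \<in> vecs H"
  shows "(vnorm H (vdiff H x y))\<^sup>2 \<le> 2 * (vnorm H x)\<^sup>2 + 2 * (vnorm H y)\<^sup>2"
proof -
  have sq: "(vnorm H z)\<^sup>2 = Re (vinner H z z)" if "z \<in> vecs H" for z
    using vinner_self[OF that] by simp
  have "vinner H (vdiff H x y) (vdiff H x y) + vinner H (vadd H x y) (vadd H x y) =
      2 * vinner H x x + 2 * vinner H y y"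
    using assms
    by (simp add: inner_diff_left inner_diff_right inner_add_left inner_add_right vdiff_closed add_closed)
  from arg_cong[OF this, of Re] show ?thesis
    using inner_nonneg[OF add_closed[OF assms]] assms by (simp add: sq vdiff_closed)
qed

lemma diff_add_swap:
  assumes "a \<in> vecs H" "b \<in> vecs H" "c \<in> vecs H" "d \<in> vecs H"
  shows "vdiff H (vadd H a b) (vadd H c d) = vadd H (vdiff H a c) (vdiff H b d)"
  using assms
  by (intro vec_eqI) (auto simp: vdiff_closed add_closed inner_diff_right inner_add_right)

lemma diff_scale:
  assumes "a \<in> vecs H" "b \<in> vecs H"
  shows "vdiff H (vscale H r a) (vscale H r b) = vscale H r (vdiff H a b)"
  using assms
  by (intro vec_eqI)
    (auto simp: vdiff_closed scale_closed inner_diff_right inner_scale_right algebra_simps)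

lemma op_diff_bounded:
  assumes S: "S \<in> bounded_ops H" and T: "T \<in> bounded_ops H"
  shows "op_diff H S T \<in> bounded_ops H"
proof -
  obtain C where C: "C \<ge> 0" "\<And>x. x \<in> vecs H \<Longrightarrow> vnorm H (S x) \<le> C * vnorm H x"
    using bounded_opsD(3)[OF S] by blast
  obtain D where D: "D \<ge> 0" "\<And>x. x \<in> vecs H \<Longrightarrow> vnorm H (T x) \<le> D * vnorm H x"
    using bounded_opsD(3)[OF T] by blast
  note cl = bounded_ops_closed[OF S] bounded_ops_closed[OF T]
  \<comment> \<open>The factor 2 absorbs the constants of \<open>vnorm_diff_sq_le\<close>: 2 C^2 + 2
    D^2 is at most (2 (C + D))^2.\<close>
  have "vnorm H (vdiff H (S x) (T x)) \<le> 2 * (C + D) * vnorm H x" if x: "x \<in> vecs H" for x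
  proof (rule power2_le_imp_le)
    note n = vnorm_nonneg[OF x]
    have "(vnorm H (vdiff H (S x) (T x)))\<^sup>2 \<le> 2 * (vnorm H (S x))\<^sup>2 + 2 * (vnorm H (T x))\<^sup>2"
      by (rule vnorm_diff_sq_le[OF cl[OF x]])
    also have "\<dots> \<le> 2 * (C * vnorm H x)\<^sup>2 + 2 * (D * vnorm H x)\<^sup>2"
      by (intro add_mono mult_left_mono power_mono C D x vnorm_nonneg cl) auto
    also have "\<dots> \<le> 4 * (C * vnorm H x)\<^sup>2 + 8 * (C * vnorm H x) * (D * vnorm H x) + 4 * (D * vnorm H x)\<^sup>2"
      using C D n by (intro add_mono) auto
    also have "\<dots> = (2 * (C + D) * vnorm H x)\<^sup>2"
      by (simp add: power2_eq_square algebra_simps)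
    finally show "(vnorm H (vdiff H (S x) (T x)))\<^sup>2 \<le> (2 * (C + D) * vnorm H x)\<^sup>2" .
    show "0 \<le> 2 * (C + D) * vnorm H x" using C D n by simp
  qed
  moreover have "op_diff H S T \<in> extensional (vecs H)" by (simp add: op_diff_def)
  ultimately show ?thesis
    unfolding bounded_ops_def
    by (auto simp: PiE_def cl add_closed scale_closed vdiff_closed diff_add_swap diff_scale
        bounded_opsD(2)[OF S] bounded_opsD(2)[OF T] bounded_ops_scale[OF S] bounded_ops_scale[OF T])
qed

lemma unitary_opD:
  assumes "unitary_op H U"
  obtains S where "U \<in> bounded_ops H" "S \<in> bounded_ops H"
    "\<And>x y. x \<in> vecs H \<Longrightarrow> y \<in> vecs H \<Longrightarrow> vinner H (U x) y = vinner H x (S y)"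
    "\<And>x. x \<in> vecs H \<Longrightarrow> S (U x) = x" "\<And>x. x \<in> vecs H \<Longrightarrow> U (S x) = x"
proof -
  obtain S where S: "is_adjoint H U S" "op_mult H S U = op_id H" "op_mult H U S = op_id H"
    and U: "U \<in> bounded_ops H"
    using assms by (auto simp: unitary_op_def)
  show thesis
  proof
    show "U \<in> bounded_ops H" by fact
    show "vinner H (U x) y = vinner H x (S y)" if "x \<in> vecs H" "y \<in> vecs H" for x y
      using S(1) that by (auto simp: is_adjoint_def)
    show "S (U x) = x" "U (S x) = x" if "x \<in> vecs H" for x
      using fun_cong[OF S(2), of x] fun_cong[OF S(3), of x] that by auto
    show "S \<in> bounded_ops H" using S(1) by (auto simp: is_adjoint_def)
  qed
qed

lemma unitary_opI:
  assumes U: "U \<in> bounded_ops H" and S: "S \<in> bounded_ops H"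
    and adj: "\<And>x y. x \<in> vecs H \<Longrightarrow> y \<in> vecs H \<Longrightarrow> vinner H (U x) y = vinner H x (S y)"
    and inv: "\<And>x. x \<in> vecs H \<Longrightarrow> S (U x) = x" "\<And>x. x \<in> vecs H \<Longrightarrow> U (S x) = x"
  shows "unitary_op H U"
  unfolding unitary_op_def is_adjoint_def
proof (intro conjI exI[of _ S] ballI)
  show "op_mult H S U = op_id H" "op_mult H U S = op_id H"
    by (intro op_eqI op_mult_extensional op_id_extensional; simp add: inv)+
qed (use U S adj in auto)

lemma unitary_op_inner:
  assumes "unitary_op H U" "x \<in> vecs H" "y \<in> vecs H"
  shows "vinner H (U x) (U y) = vinner H x y"
proof -
  obtain S where S: "U \<in> bounded_ops H"
    "\<And>x y. x \<in> vecs H \<Longrightarrow> y \<in> vecs H \<Longrightarrow> vinner H (U x) y = vinner H x (S y)"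
    "\<And>x. x \<in> vecs H \<Longrightarrow> S (U x) = x"
    using unitary_opD[OF assms(1)] by metis
  show ?thesis
    using S(2)[OF assms(2) bounded_ops_closed[OF S(1) assms(3)]] S(3)[OF assms(3)] by simp
qed

lemma op_inverse_eqI:
  assumes U: "\<And>x. x \<in> vecs H \<Longrightarrow> U x \<in> vecs H"
    and S: "S \<in> extensional (vecs H)" "\<And>x. x \<in> vecs H \<Longrightarrow> S x \<in> vecs H"
    and inv: "\<And>x. x \<in> vecs H \<Longrightarrow> S (U x) = x" "\<And>x. x \<in> vecs H \<Longrightarrow> U (S x) = x"
  shows "op_inverse H U = S"
proof (rule op_eqI[OF _ S(1)])
  show "op_inverse H U \<in> extensional (vecs H)" by (simp add: op_inverse_def)
  fix x assume x: "x \<in> vecs H"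
  have "inj_on U (vecs H)" by (rule inj_on_inverseI[of _ S]) (rule inv)
  then have "inv_into (vecs H) U x = S x"
    using S(2)[OF x] inv(2)[OF x] by (rule inv_into_f_eq)
  then show "op_inverse H U x = S x" using x by (simp add: op_inverse_def)
qed

lemma unitary_op_mult_inverse:
  assumes U: "unitary_op H U" and V: "unitary_op H V"
  shows "unitary_op H (op_mult H (op_inverse H U) V)"
proof -
  obtain S where S: "U \<in> bounded_ops H" "S \<in> bounded_ops H"
    "\<And>x y. x \<in> vecs H \<Longrightarrow> y \<in> vecs H \<Longrightarrow> vinner H (U x) y = vinner H x (S y)"
    "\<And>x. x \<in> vecs H \<Longrightarrow> S (U x) = x" "\<And>x. x \<in> vecs H \<Longrightarrow> U (S x) = x"
    by (rule unitary_opD[OF U]) blast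
  obtain T where T: "V \<in> bounded_ops H" "T \<in> bounded_ops H"
    "\<And>x y. x \<in> vecs H \<Longrightarrow> y \<in> vecs H \<Longrightarrow> vinner H (V x) y = vinner H x (T y)"
    "\<And>x. x \<in> vecs H \<Longrightarrow> T (V x) = x" "\<And>x. x \<in> vecs H \<Longrightarrow> V (T x) = x"
    by (rule unitary_opD[OF V]) blast
  note cl = bounded_ops_closed[OF S(1)] bounded_ops_closed[OF S(2)]
    bounded_ops_closed[OF T(1)] bounded_ops_closed[OF T(2)]
  have inv: "op_inverse H U = S"
    by (rule op_inverse_eqI) (use S cl bounded_opsD(1) in auto)
  have S_adj: "vinner H (S x) y = vinner H x (U y)" if "x \<in> vecs H" "y \<in> vecs H" for x y
    using S(3)[OF cl(2)[OF that(1)] cl(1)[OF that(2)]] S(4)[OF that(2)] S(5)[OF that(1)] by simp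
  show ?thesis
    unfolding inv
    by (rule unitary_opI[OF op_mult_bounded[OF S(2) T(1)] op_mult_bounded[OF T(2) S(1)]])
      (simp_all add: cl S T S_adj)
qed

lemma normal_op_unitary_minus_id:
  assumes "unitary_op H V"
  shows "normal_op H (op_diff H V (op_id H))"
proof -
  obtain S where S: "V \<in> bounded_ops H" "S \<in> bounded_ops H"
    "\<And>x y. x \<in> vecs H \<Longrightarrow> y \<in> vecs H \<Longrightarrow> vinner H (V x) y = vinner H x (S y)"
    "\<And>x. x \<in> vecs H \<Longrightarrow> S (V x) = x" "\<And>x. x \<in> vecs H \<Longrightarrow> V (S x) = x"
    by (rule unitary_opD[OF assms]) blast
  note cl = bounded_ops_closed[OF S(1)] bounded_ops_closed[OF S(2)]
  have S_adj: "vinner H (S x) y = vinner H x (V y)" if "x \<in> vecs H" "y \<in> vecs H" for x y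
    using S(3)[OF cl(2)[OF that(1)] cl(1)[OF that(2)]] S(4)[OF that(2)] S(5)[OF that(1)] by simp
  have VS: "vinner H x (V y) = vinner H (S x) y" "vinner H x (S y) = vinner H (V x) y"
    if "x \<in> vecs H" "y \<in> vecs H" for x y
    using S_adj[OF that] S(3)[OF that] by simp_all
  show ?thesis
    unfolding normal_op_def is_adjoint_def
  proof (intro conjI exI[of _ "op_diff H S (op_id H)"] ballI op_diff_bounded S op_id_bounded)
    show "vinner H (op_diff H V (op_id H) x) y = vinner H x (op_diff H S (op_id H) y)"
      if "x \<in> vecs H" "y \<in> vecs H" for x y
      using that by (simp add: inner_diff_left inner_diff_right cl S(3))
    show "op_mult H (op_diff H S (op_id H)) (op_diff H V (op_id H)) =
      op_mult H (op_diff H V (op_id H)) (op_diff H S (op_id H))"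
    proof (intro op_eqI op_mult_extensional)
      fix x assume x: "x \<in> vecs H"
      show "op_mult H (op_diff H S (op_id H)) (op_diff H V (op_id H)) x =
        op_mult H (op_diff H V (op_id H)) (op_diff H S (op_id H)) x"
        using x
        by (intro vec_eqI)
          (simp_all add: cl vdiff_closed inner_diff_right VS S(4,5))
    qed
  qed
qed

lemma op_inverse_id: "op_inverse H (op_id H) = op_id H"
  by (rule op_inverse_eqI) (simp_all add: op_id_extensional)

lemma op_mult_id_left:
  assumes "T \<in> bounded_ops H"
  shows "op_mult H (op_id H) T = T"
  by (rule op_eqI[OF op_mult_extensional bounded_opsD(1)[OF assms]])
    (simp add: bounded_ops_closed[OF assms])

lemma op_power_apply:
  assumes "\<And>x. x \<in> vecs H \<Longrightarrow> V x \<in> vecs H" "x \<in> vecs H"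
  shows "op_power H V n x = (V ^^ n) x"
  using assms(2) unfolding op_power_def by (induction n) auto

text \<open>In operator form, \<open>right\<close> is (I - P)(V^n - I) = 0 and \<open>left\<close>
  is (V^n - I)(I - P) = 0. Both are linear in V^n - I and so pass to every element of the
  algebra.\<close>

lemma generated_algebra_increment:
  assumes V: "unitary_op H V" and X: "X \<in> generated_algebra H (op_diff H V (op_id H))"
    and P: "\<And>x. x \<in> vecs H \<Longrightarrow> P x \<in> vecs H"
    and right: "\<And>n x y. x \<in> vecs H \<Longrightarrow> y \<in> vecs H \<Longrightarrow>
      vinner H x ((V ^^ n) y) - vinner H x y = vinner H (P x) ((V ^^ n) y) - vinner H (P x) y"
    and left: "\<And>n x y. x \<in> vecs H \<Longrightarrow> y \<in> vecs H \<Longrightarrow>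
      vinner H x ((V ^^ n) y) - vinner H x y = vinner H x ((V ^^ n) (P y)) - vinner H x (P y)"
    and adj: "\<And>x y. x \<in> vecs H \<Longrightarrow> y \<in> vecs H \<Longrightarrow> vinner H (P x) y = vinner H x (P y)"
    and x: "x \<in> vecs H"
  shows "P (X x) = X x" "X (P x) = X x"
proof -
  have Vb: "V \<in> bounded_ops H" using V by (simp add: unitary_op_def)
  have Vn: "(V ^^ n) x \<in> vecs H" if "x \<in> vecs H" for n x
    using that by (induction n) (auto intro: bounded_ops_closed[OF Vb])
  note Xc = bounded_ops_closed[OF generated_algebra_bounded[OF X]]
  note key = generated_algebra_inner_eq[OF Vb unitary_op_inner[OF V] X, where a = 1, simplified]
  have cnj_right: "vinner H ((V ^^ n) x) y - vinner H x y = vinner H ((V ^^ n) x) (P y) - vinner H x (P y)"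
    if "x \<in> vecs H" "y \<in> vecs H" for n x y
    using right[OF that(2,1), of n, THEN arg_cong[where f = cnj]] that
    by (simp add: inner_commute[symmetric] Vn P)
  have cnj_left: "vinner H ((V ^^ n) x) y - vinner H x y = vinner H ((V ^^ n) (P x)) y - vinner H (P x) y"
    if "x \<in> vecs H" "y \<in> vecs H" for n x y
    using left[OF that(2,1), of n, THEN arg_cong[where f = cnj]] that
    by (simp add: inner_commute[symmetric] Vn P)
  have 1: "vinner H z (X x) = vinner H (P z) (X x)" if z: "z \<in> vecs H" for z
    by (rule key[OF z x P[OF z] x right[OF z x] cnj_left[OF z x]])
  show "P (X x) = X x"
    using 1 adj Xc[OF x] by (intro vec_eqI P Xc x) simp
  have 2: "vinner H z (X x) = vinner H z (X (P x))" if z: "z \<in> vecs H" for z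
    by (rule key[OF z x z P[OF x] left[OF z x] cnj_right[OF z x]])
  show "X (P x) = X x"
    using 2 by (intro vec_eqI P Xc x) simp
qed

text \<open>The matrix element at (Q z, Q x) is compared with the one at (\<xi>, \<xi>). By
  \<open>compress\<close>, V^n - I contributes c n - 1 to both, with ratio
  \<open>vinner H (Q z) (Q x)\<close>; this ratio is then inherited by X.\<close>

lemma generated_algebra_compress:
  assumes V: "unitary_op H V" and X: "X \<in> generated_algebra H (op_diff H V (op_id H))"
    and Q: "\<And>x. x \<in> vecs H \<Longrightarrow> Q x \<in> vecs H"
    and adj: "\<And>x y. x \<in> vecs H \<Longrightarrow> y \<in> vecs H \<Longrightarrow> vinner H (Q x) y = vinner H x (Q y)"
    and compress: "\<And>n x. x \<in> vecs H \<Longrightarrow> Q ((V ^^ n) (Q x)) = vscale H (c n) (Q x)"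
    and \<xi>: "\<xi> \<in> vecs H" "Q \<xi> = \<xi>" "vinner H \<xi> \<xi> = 1"
    and x: "x \<in> vecs H"
  shows "Q (X (Q x)) = vscale H (state H \<xi> X) (Q x)"
proof -
  have Vb: "V \<in> bounded_ops H" using V by (simp add: unitary_op_def)
  have Vn: "(V ^^ n) x \<in> vecs H" if "x \<in> vecs H" for n x
    using that by (induction n) (auto intro: bounded_ops_closed[OF Vb])
  note Xc = bounded_ops_closed[OF generated_algebra_bounded[OF X]]
  have Vn_inner: "vinner H z ((V ^^ n) (Q y)) = c n * vinner H z (Q y)"
    if "z \<in> vecs H" "y \<in> vecs H" "Q z = z" for n z y
  proof -
    have "vinner H z ((V ^^ n) (Q y)) = vinner H z (Q ((V ^^ n) (Q y)))"
      using adj[OF that(1) Vn[OF Q[OF that(2)]], of n] that(3) by simp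
    then show ?thesis using that Q by (simp add: compress inner_scale_right)
  qed
  \<comment> \<open>The case n = 0 of \<open>compress\<close> makes Q Q a multiple of Q, and
    evaluation at \<xi> shows the multiple to be 1.\<close>
  have Q_idem: "Q (Q y) = Q y" if "y \<in> vecs H" for y
  proof -
    have "Q (Q y) = vscale H (c 0) (Q y)" if "y \<in> vecs H" for y
      using compress[OF that, of 0] by simp
    moreover have "c 0 = 1"
      using Vn_inner[OF \<xi>(1,1,2), of 0] \<xi> by simp
    ultimately show ?thesis using that Q scale_one by simp
  qed
  have cnj_inner: "vinner H ((V ^^ n) (Q y)) z = cnj (c n) * vinner H (Q y) z"
    if "z \<in> vecs H" "y \<in> vecs H" "Q z = z" for n z y
    using Vn_inner[OF that, of n, THEN arg_cong[where f = cnj]] that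
    by (simp add: inner_commute[symmetric] Vn Q)
  have "vinner H (Q z) (X (Q x)) = vinner H (Q z) (Q x) * vinner H \<xi> (X \<xi>)"
    if z: "z \<in> vecs H" for z
  proof (rule generated_algebra_inner_eq[OF Vb unitary_op_inner[OF V] X Q[OF z] Q[OF x] \<xi>(1,1)])
    fix n
    have \<xi>n: "vinner H \<xi> ((V ^^ n) \<xi>) = c n" "vinner H ((V ^^ n) \<xi>) \<xi> = cnj (c n)"
      using Vn_inner[OF \<xi>(1,1,2), of n] cnj_inner[OF \<xi>(1,1,2), of n] \<xi> by simp_all
    show "vinner H (Q z) ((V ^^ n) (Q x)) - vinner H (Q z) (Q x) =
        vinner H (Q z) (Q x) * (vinner H \<xi> ((V ^^ n) \<xi>) - vinner H \<xi> \<xi>)"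
      using Vn_inner[OF Q[OF z] x Q_idem[OF z], of n] by (simp add: \<xi>n \<xi> algebra_simps)
    show "vinner H ((V ^^ n) (Q z)) (Q x) - vinner H (Q z) (Q x) =
        vinner H (Q z) (Q x) * (vinner H ((V ^^ n) \<xi>) \<xi> - vinner H \<xi> \<xi>)"
      using cnj_inner[OF Q[OF x] z Q_idem[OF x], of n] by (simp add: \<xi>n \<xi> algebra_simps)
  qed
  then show ?thesis
    using adj Q_idem x
    by (intro vec_eqI) (auto simp: Q Xc scale_closed inner_scale_right state_def)
qed

end

section \<open>The Hilbert space of square-integrable functions\<close>

lemma borel_measurable_cnj [measurable (raw)]:
  assumes "f \<in> borel_measurable M"
  shows "(\<lambda>x. cnj (f x)) \<in> borel_measurable M"
  by (rule measurable_compose[OF assms]) (intro borel_measurable_continuous_onI continuous_intros)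

lemma L2_funD:
  assumes "f \<in> L2_fun M"
  shows "f \<in> borel_measurable M" "integrable M (\<lambda>x. (cmod (f x))\<^sup>2)"
  using assms by (auto simp: L2_fun_def)

lemma L2_funI_bound:
  assumes "f \<in> borel_measurable M" "integrable M g" "AE x in M. (cmod (f x))\<^sup>2 \<le> g x"
  shows "f \<in> L2_fun M"
  using assms unfolding L2_fun_def
  by (auto intro!: Bochner_Integration.integrable_bound[of M g])

lemma L2_fun_add:
  assumes "f \<in> L2_fun M" "g \<in> L2_fun M"
  shows "(\<lambda>x. f x + g x) \<in> L2_fun M"
proof (rule L2_funI_bound)
  show "(\<lambda>x. f x + g x) \<in> borel_measurable M"
    using assms by (auto simp: L2_fun_def)
  show "integrable M (\<lambda>x. 2 * (cmod (f x))\<^sup>2 + 2 * (cmod (g x))\<^sup>2)"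
    using assms by (auto simp: L2_fun_def)
  have "(cmod (u + v))\<^sup>2 \<le> 2 * (cmod u)\<^sup>2 + 2 * (cmod v)\<^sup>2" for u v :: complex
  proof -
    have "(cmod (u + v))\<^sup>2 \<le> (cmod u + cmod v)\<^sup>2"
      by (intro power_mono norm_triangle_ineq) auto
    also have "\<dots> \<le> 2 * (cmod u)\<^sup>2 + 2 * (cmod v)\<^sup>2"
      using sum_squares_bound[of "cmod u" "cmod v"] by (simp add: power2_sum)
    finally show ?thesis .
  qed
  then show "AE x in M. (cmod (f x + g x))\<^sup>2 \<le> 2 * (cmod (f x))\<^sup>2 + 2 * (cmod (g x))\<^sup>2"
    by simp
qed

lemma L2_fun_bounded_mult:
  assumes "f \<in> L2_fun M" "m \<in> borel_measurable M" "AE x in M. cmod (m x) \<le> C"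
  shows "(\<lambda>x. m x * f x) \<in> L2_fun M"
proof (rule L2_funI_bound)
  show "(\<lambda>x. m x * f x) \<in> borel_measurable M"
    using assms by (auto simp: L2_fun_def)
  show "integrable M (\<lambda>x. C\<^sup>2 * (cmod (f x))\<^sup>2)"
    using assms by (auto simp: L2_fun_def)
  show "AE x in M. (cmod (m x * f x))\<^sup>2 \<le> C\<^sup>2 * (cmod (f x))\<^sup>2"
    using assms(3)
    by eventually_elim (auto simp: norm_mult power_mult_distrib intro!: mult_right_mono power_mono)
qed

lemma L2_fun_scale: "f \<in> L2_fun M \<Longrightarrow> (\<lambda>x. a * f x) \<in> L2_fun M"
  by (rule L2_fun_bounded_mult[where C = "cmod a"]) auto

lemma L2_fun_diff:
  assumes "f \<in> L2_fun M" "g \<in> L2_fun M"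
  shows "(\<lambda>x. f x - g x) \<in> L2_fun M"
  using L2_fun_add[OF assms(1) L2_fun_scale[OF assms(2), of "-1"]] by simp

lemma L2_fun_zero [simp]: "(\<lambda>x. 0) \<in> L2_fun M"
  by (simp add: L2_fun_def)

lemma L2_integrable_mult:
  assumes "f \<in> L2_fun M" "g \<in> L2_fun M"
  shows "integrable M (\<lambda>x. f x * g x)"
proof (rule Bochner_Integration.integrable_bound)
  show "integrable M (\<lambda>x. (cmod (f x))\<^sup>2 + (cmod (g x))\<^sup>2)"
    using assms by (auto simp: L2_fun_def)
  show "(\<lambda>x. f x * g x) \<in> borel_measurable M"
    using assms by (auto simp: L2_fun_def)
  have "a * b \<le> a\<^sup>2 + b\<^sup>2" if "0 \<le> a" "0 \<le> b" for a b :: real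
  proof -
    have "2 * (a * b) \<le> a\<^sup>2 + b\<^sup>2" using sum_squares_bound[of a b] by simp
    moreover have "0 \<le> a * b" using that by simp
    ultimately show ?thesis by linarith
  qed
  then show "AE x in M. norm (f x * g x) \<le> norm ((cmod (f x))\<^sup>2 + (cmod (g x))\<^sup>2)"
    by (simp add: norm_mult)
qed

lemma L2_fun_cnj: "f \<in> L2_fun M \<Longrightarrow> (\<lambda>x. cnj (f x)) \<in> L2_fun M"
  by (auto simp: L2_fun_def)

lemma L2_integrable_inner:
  assumes "f \<in> L2_fun M" "g \<in> L2_fun M"
  shows "integrable M (\<lambda>x. cnj (f x) * g x)"
  using L2_integrable_mult[OF L2_fun_cnj[OF assms(1)] assms(2)] .

lemma equiv_L2_rel: "equiv (L2_fun M) (L2_rel M)"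
  by (rule equivI) (auto simp: L2_rel_def intro!: refl_onI symI transI)

lemma L2_class_eq_iff:
  assumes "f \<in> L2_fun M" "g \<in> L2_fun M"
  shows "L2_class M f = L2_class M g \<longleftrightarrow> (AE x in M. f x = g x)"
  using equiv_class_eq_iff[OF equiv_L2_rel[of M], of f g] assms
  by (auto simp: L2_class_def L2_rel_def)

lemma L2_rep_class:
  assumes "f \<in> L2_fun M"
  shows "L2_rep (L2_class M f) \<in> L2_fun M" "AE x in M. L2_rep (L2_class M f) x = f x"
proof -
  have "f \<in> L2_class M f"
    using assms by (auto simp: L2_class_def L2_rel_def)
  then have "L2_rep (L2_class M f) \<in> L2_class M f"
    unfolding L2_rep_def by (rule someI[where P = "\<lambda>g. g \<in> L2_class M f"])
  then show "L2_rep (L2_class M f) \<in> L2_fun M" "AE x in M. L2_rep (L2_class M f) x = f x"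
    by (auto simp: L2_class_def L2_rel_def elim: AE_mp)
qed

lemma vecs_L2: "vecs (L2 M) = L2_class M ` L2_fun M"
  by (auto simp: L2_def quotient_def L2_class_def)

lemma L2_class_in_vecs: "f \<in> L2_fun M \<Longrightarrow> L2_class M f \<in> vecs (L2 M)"
  by (simp add: vecs_L2)

lemma vzero_L2: "vzero (L2 M) = L2_class M (\<lambda>x. 0)"
  by (simp add: L2_def)

text \<open>The operations of \<open>L2\<close> are defined through a chosen representative; this
  equation and its companions compute them on an arbitrary one.\<close>

lemma vadd_L2:
  assumes "f \<in> L2_fun M" "g \<in> L2_fun M"
  shows "vadd (L2 M) (L2_class M f) (L2_class M g) = L2_class M (\<lambda>x. f x + g x)"
  using L2_rep_class[OF assms(1)] L2_rep_class[OF assms(2)] assms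
  by (auto simp: L2_def L2_class_eq_iff L2_fun_add)

lemma vscale_L2:
  assumes "f \<in> L2_fun M"
  shows "vscale (L2 M) a (L2_class M f) = L2_class M (\<lambda>x. a * f x)"
  using L2_rep_class[OF assms(1)] assms
  by (auto simp: L2_def L2_class_eq_iff L2_fun_scale)

lemma vdiff_L2:
  assumes "f \<in> L2_fun M" "g \<in> L2_fun M"
  shows "vdiff (L2 M) (L2_class M f) (L2_class M g) = L2_class M (\<lambda>x. f x - g x)"
  using vadd_L2[OF assms(1) L2_fun_scale[OF assms(2), of "-1"]] assms
  by (simp add: vdiff_def vscale_L2)

lemma vinner_L2:
  assumes "f \<in> L2_fun M" "g \<in> L2_fun M"
  shows "vinner (L2 M) (L2_class M f) (L2_class M g) = (\<integral>x. cnj (f x) * g x \<partial>M)"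
proof -
  note r = L2_rep_class[OF assms(1)] L2_rep_class[OF assms(2)]
  have "(\<integral>x. cnj (L2_rep (L2_class M f) x) * L2_rep (L2_class M g) x \<partial>M) =
      (\<integral>x. cnj (f x) * g x \<partial>M)"
    by (rule integral_cong_AE) (use r assms in \<open>auto simp: L2_fun_def\<close>)
  then show ?thesis by (simp add: L2_def)
qed

lemma integral_cnj_mult_self:
  "(\<integral>x. cnj (f x) * f x \<partial>M) = complex_of_real (\<integral>x. (cmod (f x))\<^sup>2 \<partial>M)"
proof -
  have "cnj (f x) * f x = complex_of_real ((cmod (f x))\<^sup>2)" for x
    by (metis complex_norm_square mult.commute)
  then show ?thesis by (simp only: integral_complex_of_real)
qed

lemma vnorm_L2:
  assumes "f \<in> L2_fun M"
  shows "vnorm (L2 M) (L2_class M f) = sqrt (\<integral>x. (cmod (f x))\<^sup>2 \<partial>M)"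
  using assms by (simp add: vnorm_def vinner_L2 integral_cnj_mult_self)

lemma multiplication_op_L2:
  assumes "f \<in> L2_fun M" "m \<in> borel_measurable M" "AE x in M. cmod (m x) \<le> C"
  shows "multiplication_op M m (L2_class M f) = L2_class M (\<lambda>x. m x * f x)"
  using L2_rep_class[OF assms(1)] assms
  by (auto simp: multiplication_op_def L2_class_in_vecs L2_class_eq_iff L2_fun_bounded_mult[where C = C])

lemma vecs_L2E:
  assumes "A \<in> vecs (L2 M)"
  obtains f where "f \<in> L2_fun M" "A = L2_class M f"
  using assms by (auto simp: vecs_L2)

section \<open>Completeness of the space of square-integrable functions\<close>

lemma (in finite_measure) L2_fun_integrable:
  assumes "f \<in> L2_fun M"
  shows "integrable M f"
  using L2_integrable_mult[OF assms, of "\<lambda>x. 1"] by (simp add: L2_fun_def)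

text \<open>The variance of |f| is nonnegative.\<close>

lemma (in prob_space) integral_norm_le_L2:
  assumes "f \<in> L2_fun M" "(\<integral>x. (cmod (f x))\<^sup>2 \<partial>M) \<le> e\<^sup>2" "0 \<le> e"
  shows "(\<integral>x. cmod (f x) \<partial>M) \<le> e"
proof -
  have i: "integrable M (\<lambda>x. cmod (f x))"
    using L2_fun_integrable[OF assms(1)] by simp
  have "0 \<le> (\<integral>x. (cmod (f x) - (\<integral>x. cmod (f x) \<partial>M))\<^sup>2 \<partial>M)"
    by simp
  also have "\<dots> = (\<integral>x. (cmod (f x))\<^sup>2 \<partial>M) - (\<integral>x. cmod (f x) \<partial>M)\<^sup>2"
    using variance_eq[OF i] L2_funD(2)[OF assms(1)] by simp
  finally have "(\<integral>x. cmod (f x) \<partial>M)\<^sup>2 \<le> e\<^sup>2"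
    using assms(2) by simp
  then show ?thesis
    using assms(3) power2_le_imp_le by blast
qed

text \<open>The successive differences have mean modulus at most 2^-n, so the sum of their moduli
  has finite expectation and is finite almost everywhere. The telescoping series then converges
  absolutely there.\<close>

lemma (in prob_space) AE_convergent_if_fast_L2_Cauchy:
  assumes f: "\<And>n. f n \<in> L2_fun M"
    and fast: "\<And>n. (\<integral>x. (cmod (f (Suc n) x - f n x))\<^sup>2 \<partial>M) \<le> ((1/2)^n)\<^sup>2"
  shows "AE x in M. convergent (\<lambda>n. f n x)"
proof -
  define d where "d n x = f (Suc n) x - f n x" for n x
  have d: "d n \<in> L2_fun M" for n
    unfolding d_def by (intro L2_fun_diff f)
  have [measurable]: "d n \<in> borel_measurable M" for n
    using d by (auto simp: L2_fun_def)
  have le: "(\<integral>x. cmod (d n x) \<partial>M) \<le> (1/2)^n" for n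
    using integral_norm_le_L2[OF d, of n "(1/2)^n"] fast[of n] by (simp add: d_def)
  have nn: "(\<integral>\<^sup>+x. ennreal (cmod (d n x)) \<partial>M) \<le> ennreal ((1/2)^n)" for n
    using L2_fun_integrable[OF d] le[of n]
    by (subst nn_integral_eq_integral) (auto simp: ennreal_leI)
  have "(\<integral>\<^sup>+x. (\<Sum>n. ennreal (cmod (d n x))) \<partial>M) = (\<Sum>n. \<integral>\<^sup>+x. ennreal (cmod (d n x)) \<partial>M)"
    by (rule nn_integral_suminf) auto
  also have "\<dots> \<le> (\<Sum>n. ennreal ((1/2)^n))"
    by (intro suminf_le nn) auto
  also have "\<dots> = ennreal (\<Sum>n. (1/2)^n)"
    by (intro suminf_ennreal2) (auto simp: summable_geometric)
  also have "\<dots> < \<infinity>" by simp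
  finally have "AE x in M. (\<Sum>n. ennreal (cmod (d n x))) \<noteq> \<infinity>"
    by (intro nn_integral_PInf_AE) auto
  then show ?thesis
  proof eventually_elim
    case (elim x)
    then have "summable (\<lambda>n. cmod (d n x))"
      using summable_suminf_not_top[of "\<lambda>n. cmod (d n x)"] by auto
    then have "summable (\<lambda>n. d n x)"
      by (rule summable_norm_cancel)
    then have "convergent (\<lambda>n. (\<Sum>i<n. d i x))"
      by (simp add: summable_iff_convergent)
    moreover have "(\<Sum>i<n. d i x) = f n x - f 0 x" for n
      unfolding d_def by (rule sum_lessThan_telescope)
    ultimately have "convergent (\<lambda>n. f n x - f 0 x)" by simp
    then show "convergent (\<lambda>n. f n x)"
      by (simp add: convergent_diff_const_right_iff)
  qed
qed

text \<open>Lower semicontinuity of the norm under almost everywhere convergence. In the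
  completeness proof it yields both the membership of the limit and the rate of convergence to
  it.\<close>

lemma L2_fun_Fatou:
  assumes f: "\<And>n. f n \<in> L2_fun M" and g: "g \<in> borel_measurable M"
    and lim: "AE x in M. (\<lambda>n. f n x) \<longlonglongrightarrow> g x"
    and bd: "eventually (\<lambda>n. (\<integral>x. (cmod (f n x))\<^sup>2 \<partial>M) \<le> C) sequentially"
  shows "g \<in> L2_fun M" "(\<integral>x. (cmod (g x))\<^sup>2 \<partial>M) \<le> C"
proof -
  have [measurable]: "f n \<in> borel_measurable M" for n using f by (auto simp: L2_fun_def)
  note [measurable] = g
  obtain n where "(\<integral>x. (cmod (f n x))\<^sup>2 \<partial>M) \<le> C"
    using bd by (auto simp: eventually_sequentially)
  moreover have "0 \<le> (\<integral>x. (cmod (f n x))\<^sup>2 \<partial>M)"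
    by simp
  ultimately have C: "0 \<le> C"
    by linarith
  have "(\<integral>\<^sup>+x. ennreal ((cmod (g x))\<^sup>2) \<partial>M) = (\<integral>\<^sup>+x. liminf (\<lambda>n. ennreal ((cmod (f n x))\<^sup>2)) \<partial>M)"
  proof (rule nn_integral_cong_AE, use lim in eventually_elim)
    case (elim x)
    have "(\<lambda>n. ennreal ((cmod (f n x))\<^sup>2)) \<longlonglongrightarrow> ennreal ((cmod (g x))\<^sup>2)"
      by (intro tendsto_ennrealI tendsto_intros elim)
    then show ?case
      by (metis lim_imp_Liminf trivial_limit_sequentially)
  qed
  also have "\<dots> \<le> liminf (\<lambda>n. \<integral>\<^sup>+x. ennreal ((cmod (f n x))\<^sup>2) \<partial>M)"
    by (rule nn_integral_liminf) auto
  also have "\<dots> = liminf (\<lambda>n. ennreal (\<integral>x. (cmod (f n x))\<^sup>2 \<partial>M))"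
    using f by (subst nn_integral_eq_integral) (auto simp: L2_fun_def)
  also have "\<dots> \<le> ennreal C"
  proof (rule Liminf_le)
    show "eventually (\<lambda>n. ennreal (\<integral>x. (cmod (f n x))\<^sup>2 \<partial>M) \<le> ennreal C) sequentially"
      using bd by eventually_elim (simp add: ennreal_leI)
  qed simp
  finally have *: "(\<integral>\<^sup>+x. ennreal ((cmod (g x))\<^sup>2) \<partial>M) \<le> ennreal C" .
  show "g \<in> L2_fun M"
    unfolding L2_fun_def
    using le_less_trans[OF * ennreal_less_top] by (auto intro!: integrableI_bounded g)
  then show "(\<integral>x. (cmod (g x))\<^sup>2 \<partial>M) \<le> C"
    using * C by (subst (asm) nn_integral_eq_integral) (auto simp: L2_fun_def)
qed

lemma (in prob_space) L2_complete:
  assumes "\<And>n. A n \<in> vecs (L2 M)"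
    and Cauchy: "\<forall>e>0. \<exists>N. \<forall>m\<ge>N. \<forall>n\<ge>N. vnorm (L2 M) (vdiff (L2 M) (A m) (A n)) < e"
  shows "\<exists>B\<in>vecs (L2 M). (\<lambda>n. vnorm (L2 M) (vdiff (L2 M) (A n) B)) \<longlonglongrightarrow> 0"
proof -
  have "\<exists>h. h \<in> L2_fun M \<and> A n = L2_class M h" for n
    using assms(1)[of n] by (auto elim: vecs_L2E)
  then obtain f where f: "f n \<in> L2_fun M" and A: "A n = L2_class M (f n)" for n
    by metis
  define D where "D m n = (\<integral>x. (cmod (f m x - f n x))\<^sup>2 \<partial>M)" for m n
  have norm: "vnorm (L2 M) (vdiff (L2 M) (A m) (A n)) = sqrt (D m n)" for m n
    by (simp add: A D_def vdiff_L2 vnorm_L2 f L2_fun_diff)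
  have C: "\<exists>N. \<forall>m\<ge>N. \<forall>n\<ge>N. D m n < e\<^sup>2" if "e > 0" for e
    using Cauchy[rule_format, OF that] real_sqrt_less_iff[of _ "e\<^sup>2"] that
    unfolding norm by simp
  obtain N where N: "\<And>k m n. m \<ge> N k \<Longrightarrow> n \<ge> N k \<Longrightarrow> D m n < ((1/2)^k)\<^sup>2"
    using C[of "(1/2)^_"] by (metis half_gt_zero_iff less_numeral_extra(1) zero_less_power)
  \<comment> \<open>The partial sums put both \<open>r k\<close> and \<open>r (Suc k)\<close> beyond
    \<open>N k\<close>, so consecutive terms of the subsequence are 2^-k close; the summand
    \<open>k\<close> makes the indices tend to infinity.\<close>
  define r where "r k = (\<Sum>i\<le>k. N i) + k" for k
  have "N k \<le> (\<Sum>i\<le>k. N i)" for k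
    by (rule member_le_sum) auto
  then have r: "r k \<ge> N k" "r (Suc k) \<ge> N k" "k \<le> r k" for k
    by (auto simp: r_def trans_le_add1 intro: le_SucI)
  have "AE x in M. convergent (\<lambda>k. f (r k) x)"
    using N[OF r(2) r(1)] by (intro AE_convergent_if_fast_L2_Cauchy f) (auto simp: D_def less_imp_le)
  then have lim: "AE x in M. (\<lambda>k. f (r k) x) \<longlonglongrightarrow> lim (\<lambda>k. f (r k) x)"
    by (simp add: convergent_LIMSEQ_iff)
  define g where "g x = lim (\<lambda>k. f (r k) x)" for x
  have [measurable]: "f n \<in> borel_measurable M" for n using f by (auto simp: L2_fun_def)
  have g[measurable]: "g \<in> borel_measurable M"
    unfolding g_def by measurable
  have ev: "eventually (\<lambda>k. D n (r k) \<le> e\<^sup>2) sequentially" if "\<And>m. m \<ge> K \<Longrightarrow> D n m < e\<^sup>2" for e n K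
    unfolding eventually_sequentially using that r(3) by (meson le_trans less_imp_le)
  have lim': "AE x in M. (\<lambda>k. f n x - f (r k) x) \<longlonglongrightarrow> f n x - g x" for n
    using lim by eventually_elim (auto simp: g_def intro!: tendsto_intros)
  have diff: "(\<lambda>x. f n x - g x) \<in> L2_fun M" "(\<integral>x. (cmod (f n x - g x))\<^sup>2 \<partial>M) \<le> e\<^sup>2"
    if "\<And>m. m \<ge> K \<Longrightarrow> D n m < e\<^sup>2" for e n K
  proof -
    have "eventually (\<lambda>k. (\<integral>x. (cmod (f n x - f (r k) x))\<^sup>2 \<partial>M) \<le> e\<^sup>2) sequentially"
      using ev that unfolding D_def by blast
    note * = L2_fun_Fatou[OF L2_fun_diff[OF f f] _ lim' this]
    show "(\<lambda>x. f n x - g x) \<in> L2_fun M" "(\<integral>x. (cmod (f n x - g x))\<^sup>2 \<partial>M) \<le> e\<^sup>2"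
      by (rule *; measurable)+
  qed
  \<comment> \<open>\<open>g\<close> is recovered as f (N 0) - (f (N 0) - g), whose second term is
    square-integrable by Fatou.\<close>
  have gL: "g \<in> L2_fun M"
    using L2_fun_diff[OF f[of "N 0"] diff(1)[of "N 0" "N 0" 1]] N[of 0 "N 0"] by simp
  have "(\<lambda>n. vnorm (L2 M) (vdiff (L2 M) (A n) (L2_class M g))) \<longlonglongrightarrow> 0"
  proof (rule LIMSEQ_I)
    fix e :: real assume e: "e > 0"
    obtain K where K: "\<And>m n. m \<ge> K \<Longrightarrow> n \<ge> K \<Longrightarrow> D m n < (e/2)\<^sup>2"
      using C[of "e/2"] e by auto
    have "vnorm (L2 M) (vdiff (L2 M) (A n) (L2_class M g)) < e" if "n \<ge> K" for n
    proof -
      have "(\<integral>x. (cmod (f n x - g x))\<^sup>2 \<partial>M) \<le> (e/2)\<^sup>2"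
        using diff(2)[of K n "e/2"] K that by auto
      then have "sqrt (\<integral>x. (cmod (f n x - g x))\<^sup>2 \<partial>M) \<le> sqrt ((e/2)\<^sup>2)"
        by (rule real_sqrt_le_mono)
      also have "sqrt ((e/2)\<^sup>2) = e/2"
        using e by (intro real_sqrt_unique) auto
      finally have "sqrt (\<integral>x. (cmod (f n x - g x))\<^sup>2 \<partial>M) \<le> e/2" .
      then show ?thesis
        using e by (simp add: A vdiff_L2 vnorm_L2 f gL L2_fun_diff)
    qed
    then show "\<exists>no. \<forall>n\<ge>no. norm (vnorm (L2 M) (vdiff (L2 M) (A n) (L2_class M g)) - 0) < e"
      by (auto simp: A vdiff_L2 vnorm_L2 f gL L2_fun_diff)
  qed
  then show ?thesis
    using gL L2_class_in_vecs by blast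
qed

lemma (in prob_space) complex_hilbert_space_L2: "complex_hilbert_space (L2 M)"
proof
  note [simp] = vadd_L2 vscale_L2 vinner_L2 vzero_L2 L2_class_in_vecs
  note [simp] = L2_fun_add L2_fun_scale L2_class_eq_iff L2_integrable_inner
  show "vzero (L2 M) \<in> vecs (L2 M)" by simp
  show "vadd (L2 M) x y \<in> vecs (L2 M)" if "x \<in> vecs (L2 M)" "y \<in> vecs (L2 M)" for x y
    using that by (auto elim!: vecs_L2E simp: ac_simps)
  show "vscale (L2 M) a x \<in> vecs (L2 M)" if "x \<in> vecs (L2 M)" for a x
    using that by (auto elim!: vecs_L2E simp: ac_simps)
  show "vadd (L2 M) (vadd (L2 M) x y) z = vadd (L2 M) x (vadd (L2 M) y z)"
    if "x \<in> vecs (L2 M)" "y \<in> vecs (L2 M)" "z \<in> vecs (L2 M)" for x y z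
    using that by (auto elim!: vecs_L2E simp: ac_simps)
  show "vadd (L2 M) x y = vadd (L2 M) y x"
    if "x \<in> vecs (L2 M)" "y \<in> vecs (L2 M)" for x y
    using that by (auto elim!: vecs_L2E simp: ac_simps)
  show "vadd (L2 M) x (vzero (L2 M)) = x" if "x \<in> vecs (L2 M)" for x
    using that by (auto elim!: vecs_L2E simp: ac_simps)
  show "vadd (L2 M) x (vscale (L2 M) (- 1) x) = vzero (L2 M)" if "x \<in> vecs (L2 M)" for x
    using that L2_fun_scale[of _ M "-1"] by (auto elim!: vecs_L2E)
  show "vscale (L2 M) 1 x = x" if "x \<in> vecs (L2 M)" for x
    using that by (auto elim!: vecs_L2E simp: ac_simps)
  show "vscale (L2 M) a (vscale (L2 M) b x) = vscale (L2 M) (a * b) x" if "x \<in> vecs (L2 M)" for a b x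
    using that by (auto elim!: vecs_L2E simp: ac_simps)
  show "vscale (L2 M) a (vadd (L2 M) x y) = vadd (L2 M) (vscale (L2 M) a x) (vscale (L2 M) a y)"
    if v: "x \<in> vecs (L2 M)" "y \<in> vecs (L2 M)" for a x y
  proof -
    obtain f where f: "f \<in> L2_fun M" "x = L2_class M f" using v(1) by (rule vecs_L2E)
    obtain g where g: "g \<in> L2_fun M" "y = L2_class M g" using v(2) by (rule vecs_L2E)
    have "vscale (L2 M) a (vadd (L2 M) x y) = L2_class M (\<lambda>x. a * (f x + g x))"
      using f g by (simp del: L2_class_eq_iff)
    also have "\<dots> = L2_class M (\<lambda>x. a * f x + a * g x)"
      by (simp only: distrib_left)
    also have "\<dots> = vadd (L2 M) (vscale (L2 M) a x) (vscale (L2 M) a y)"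
      using f g by (simp del: L2_class_eq_iff)
    finally show ?thesis .
  qed
  show "vscale (L2 M) (a + b) x = vadd (L2 M) (vscale (L2 M) a x) (vscale (L2 M) b x)"
    if v: "x \<in> vecs (L2 M)" for a b x
  proof -
    obtain f where f: "f \<in> L2_fun M" "x = L2_class M f" using v by (rule vecs_L2E)
    show ?thesis
      unfolding f(2) vscale_L2[OF f(1)] vadd_L2[OF L2_fun_scale[OF f(1)] L2_fun_scale[OF f(1)]]
      by (rule arg_cong[where f = "L2_class M"], rule ext, rule distrib_right)
  qed
  show "vinner (L2 M) x (vadd (L2 M) y z) = vinner (L2 M) x y + vinner (L2 M) x z"
    if v: "x \<in> vecs (L2 M)" "y \<in> vecs (L2 M)" "z \<in> vecs (L2 M)" for x y z
  proof -
    obtain f where f: "f \<in> L2_fun M" "x = L2_class M f" using v(1) by (rule vecs_L2E)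
    obtain g where g: "g \<in> L2_fun M" "y = L2_class M g" using v(2) by (rule vecs_L2E)
    obtain h where h: "h \<in> L2_fun M" "z = L2_class M h" using v(3) by (rule vecs_L2E)
    note i = L2_integrable_inner[OF f(1) g(1)] L2_integrable_inner[OF f(1) h(1)]
    have d: "(\<lambda>x. cnj (f x) * (g x + h x)) = (\<lambda>x. cnj (f x) * g x + cnj (f x) * h x)"
      by (rule ext, rule distrib_left)
    have "(\<integral>x. cnj (f x) * (g x + h x) \<partial>M) = (\<integral>x. cnj (f x) * g x \<partial>M) + (\<integral>x. cnj (f x) * h x \<partial>M)"
      unfolding d by (rule Bochner_Integration.integral_add[OF i])
    then show ?thesis
      unfolding f(2) g(2) h(2) vadd_L2[OF g(1) h(1)] vinner_L2[OF f(1) g(1)] vinner_L2[OF f(1) h(1)]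
        vinner_L2[OF f(1) L2_fun_add[OF g(1) h(1)]] .
  qed
  show "vinner (L2 M) x (vscale (L2 M) a y) = a * vinner (L2 M) x y"
    if v: "x \<in> vecs (L2 M)" "y \<in> vecs (L2 M)" for x y a
  proof -
    obtain f where f: "f \<in> L2_fun M" "x = L2_class M f" using v(1) by (rule vecs_L2E)
    obtain g where g: "g \<in> L2_fun M" "y = L2_class M g" using v(2) by (rule vecs_L2E)
    have "(\<integral>x. cnj (f x) * (a * g x) \<partial>M) = (\<integral>x. a * (cnj (f x) * g x) \<partial>M)"
      by (simp only: mult.left_commute)
    also have "\<dots> = a * (\<integral>x. cnj (f x) * g x \<partial>M)"
      by (rule integral_mult_right_zero)
    finally show ?thesis
      unfolding f(2) g(2) vscale_L2[OF g(1)] vinner_L2[OF f(1) g(1)]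
        vinner_L2[OF f(1) L2_fun_scale[OF g(1)]] .
  qed
  show "vinner (L2 M) y x = cnj (vinner (L2 M) x y)"
    if v: "x \<in> vecs (L2 M)" "y \<in> vecs (L2 M)" for x y
  proof -
    obtain f where f: "f \<in> L2_fun M" "x = L2_class M f" using v(1) by (rule vecs_L2E)
    obtain g where g: "g \<in> L2_fun M" "y = L2_class M g" using v(2) by (rule vecs_L2E)
    have "cnj (\<integral>x. cnj (f x) * g x \<partial>M) = (\<integral>x. cnj (g x) * f x \<partial>M)"
      by (subst Bochner_Integration.integral_cnj[symmetric]) (simp add: mult.commute del: Bochner_Integration.integral_cnj)
    then show ?thesis
      unfolding f(2) g(2) vinner_L2[OF f(1) g(1)] vinner_L2[OF g(1) f(1)] by simp
  qed
  have self: "vinner (L2 M) (L2_class M f) (L2_class M f) = of_real (\<integral>x. (cmod (f x))\<^sup>2 \<partial>M)"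
    if "f \<in> L2_fun M" for f
    using that integral_cnj_mult_self[of M f] by (simp add: vinner_L2)
  show "Re (vinner (L2 M) x x) \<ge> 0" if "x \<in> vecs (L2 M)" for x
    using that by (auto elim!: vecs_L2E simp: self simp del: vinner_L2)
  show "x = vzero (L2 M)" if x: "x \<in> vecs (L2 M)" and 0: "vinner (L2 M) x x = 0" for x
  proof -
    obtain f where f: "f \<in> L2_fun M" "x = L2_class M f"
      using x by (rule vecs_L2E)
    then have "AE x in M. (cmod (f x))\<^sup>2 = 0"
      using 0 integral_nonneg_eq_0_iff_AE[of M "\<lambda>x. (cmod (f x))\<^sup>2"] L2_funD[of f M]
      by (simp add: self del: vinner_L2)
    then show ?thesis using f by simp
  qed
  show "\<exists>x\<in>vecs (L2 M). (\<lambda>n. vnorm (L2 M) (vdiff (L2 M) (f n) x)) \<longlonglongrightarrow> 0"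
    if "\<And>n. f n \<in> vecs (L2 M)" "\<forall>e>0. \<exists>N. \<forall>m\<ge>N. \<forall>n\<ge>N. vnorm (L2 M) (vdiff (L2 M) (f m) (f n)) < e"
    for f
    using L2_complete that by blast
qed

section \<open>Conditional expectation of complex random variables\<close>

lemma borel_measurable_Complex:
  assumes "f \<in> borel_measurable M" "g \<in> borel_measurable M"
  shows "(\<lambda>x. Complex (f x) (g x)) \<in> borel_measurable M"
  using assms by (simp add: borel_measurable_complex_iff)

lemma integrable_complex_iff:
  "integrable M f \<longleftrightarrow> integrable M (\<lambda>x. Re (f x)) \<and> integrable M (\<lambda>x. Im (f x))"
proof (safe intro!: integrable_Re integrable_Im)
  assume "integrable M (\<lambda>x. Re (f x))" "integrable M (\<lambda>x. Im (f x))"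
  then have "integrable M (\<lambda>x. complex_of_real (Re (f x)) + \<i> * complex_of_real (Im (f x)))"
    by (intro Bochner_Integration.integrable_add integrable_mult_right) auto
  then show "integrable M f" by (simp flip: complex_eq)
qed

lemma complex_integral_parts:
  assumes "integrable M f"
  shows "(\<integral>x. f x \<partial>M) = Complex (\<integral>x. Re (f x) \<partial>M) (\<integral>x. Im (f x) \<partial>M)"
  using assms by (simp add: complex_eq_iff)

context finite_measure_subalgebra begin

abbreviation CE :: "('a \<Rightarrow> complex) \<Rightarrow> 'a \<Rightarrow> complex" where
  "CE \<equiv> complex_cond_exp M F"

lemma CE_measurable: "CE f \<in> borel_measurable F" "CE f \<in> borel_measurable M"
  unfolding complex_cond_exp_def by (auto intro!: borel_measurable_Complex)

lemma CE_cong: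
  assumes "AE x in M. f x = g x" "f \<in> borel_measurable M" "g \<in> borel_measurable M"
  shows "AE x in M. CE f x = CE g x"
proof -
  have "AE x in M. real_cond_exp M F (\<lambda>w. Re (f w)) x = real_cond_exp M F (\<lambda>w. Re (g w)) x"
    "AE x in M. real_cond_exp M F (\<lambda>w. Im (f w)) x = real_cond_exp M F (\<lambda>w. Im (g w)) x"
    by (rule real_cond_exp_cong; use assms in auto)+
  then show ?thesis by (simp add: complex_cond_exp_def)
qed

lemma CE_add:
  assumes "integrable M f" "integrable M g"
  shows "AE x in M. CE (\<lambda>x. f x + g x) x = CE f x + CE g x"
  using real_cond_exp_add[OF integrable_Re[OF assms(1)] integrable_Re[OF assms(2)]]
    real_cond_exp_add[OF integrable_Im[OF assms(1)] integrable_Im[OF assms(2)]]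
  by (simp add: complex_cond_exp_def complex_eq_iff)

text \<open>All four products of real and imaginary parts are dominated by |m f|, so integrability
  of the complex product is enough to use the real rule on each.\<close>

lemma CE_mult:
  assumes m[measurable]: "m \<in> borel_measurable F" and f[measurable]: "f \<in> borel_measurable M"
    and mf: "integrable M (\<lambda>x. m x * f x)"
  shows "AE x in M. CE (\<lambda>x. m x * f x) x = m x * CE f x"
proof -
  have mM[measurable]: "m \<in> borel_measurable M"
    using measurable_from_subalg[OF subalg m] .
  have abs: "\<bar>a * b\<bar> \<le> cmod (u * v)" if "\<bar>a\<bar> \<le> cmod u" "\<bar>b\<bar> \<le> cmod v" for a b u v
    using mult_mono[OF that] by (simp add: abs_mult norm_mult)
  have i: "integrable M (\<lambda>x. Re (m x) * Re (f x))" "integrable M (\<lambda>x. Re (m x) * Im (f x))"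
    "integrable M (\<lambda>x. Im (m x) * Re (f x))" "integrable M (\<lambda>x. Im (m x) * Im (f x))"
    by (rule Bochner_Integration.integrable_bound[OF mf];
        auto intro!: AE_I2 abs abs_Re_le_cmod abs_Im_le_cmod)+
  have r: "(\<lambda>x. Re (m x)) \<in> borel_measurable F" "(\<lambda>x. Im (m x)) \<in> borel_measurable F"
    "(\<lambda>x. Re (f x)) \<in> borel_measurable M" "(\<lambda>x. Im (f x)) \<in> borel_measurable M"
    by auto
  note e = real_cond_exp_mult[OF r(1,3) i(1)] real_cond_exp_mult[OF r(1,4) i(2)]
    real_cond_exp_mult[OF r(2,3) i(3)] real_cond_exp_mult[OF r(2,4) i(4)]
    real_cond_exp_diff[OF i(1,4)] real_cond_exp_add[OF i(2,3)]
  show ?thesis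
    using e by eventually_elim (simp add: complex_cond_exp_def complex_eq_iff)
qed

lemma CE_F_meas:
  assumes "integrable M f" "f \<in> borel_measurable F"
  shows "AE x in M. CE f x = f x"
proof -
  have "AE x in M. real_cond_exp M F (\<lambda>w. Re (f w)) x = Re (f x)"
    "AE x in M. real_cond_exp M F (\<lambda>w. Im (f w)) x = Im (f x)"
    by (rule real_cond_exp_F_meas; use assms in auto)+
  then show ?thesis by (simp add: complex_cond_exp_def complex_eq_iff)
qed

lemma CE_integral:
  assumes "integrable M f"
  shows "integrable M (CE f)" "(\<integral>x. CE f x \<partial>M) = (\<integral>x. f x \<partial>M)"
proof -
  show i: "integrable M (CE f)"
    unfolding complex_cond_exp_def using assms
    by (subst integrable_complex_iff) (auto intro!: real_cond_exp_int integrable_Re integrable_Im)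
  show "(\<integral>x. CE f x \<partial>M) = (\<integral>x. f x \<partial>M)"
    using real_cond_exp_int(2)[OF integrable_Re[OF assms]] real_cond_exp_int(2)[OF integrable_Im[OF assms]]
    unfolding complex_integral_parts[OF i] complex_integral_parts[OF assms]
    by (simp add: complex_cond_exp_def)
qed

lemma CE_nested:
  assumes "subalgebra M G" "subalgebra G F" "integrable M f"
  shows "AE x in M. CE (complex_cond_exp M G f) x = CE f x"
  using real_cond_exp_nested_subalg[OF assms(1,2) integrable_Re[OF assms(3)]]
    real_cond_exp_nested_subalg[OF assms(1,2) integrable_Im[OF assms(3)]]
  by (simp add: complex_cond_exp_def complex_eq_iff)

text \<open>Conditional Jensen inequality for the square, applied to the real and the imaginary
  part.\<close>

lemma CE_L2:
  assumes f: "f \<in> L2_fun M"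
  shows "CE f \<in> L2_fun M"
proof -
  have sq: "integrable M (\<lambda>x. (real_cond_exp M F g x)\<^sup>2)"
    if g: "g \<in> borel_measurable M" "\<And>x. \<bar>g x\<bar> \<le> cmod (f x)" for g
  proof (rule integrable_convex_cond_exp[where X = g and q = "\<lambda>x. x\<^sup>2" and I = UNIV])
    show "integrable M g"
      by (rule Bochner_Integration.integrable_bound[OF L2_fun_integrable[OF f]]) (use g in auto)
    show "integrable M (\<lambda>x. (g x)\<^sup>2)"
      by (rule Bochner_Integration.integrable_bound[OF L2_funD(2)[OF f]])
        (use g in \<open>auto intro!: AE_I2 abs_le_square_iff[THEN iffD1]\<close>)
    show "convex_on UNIV (\<lambda>x::real. x\<^sup>2)"
      by (rule convex_power2)
  qed auto
  have [measurable]: "f \<in> borel_measurable M" using f by (auto simp: L2_fun_def)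
  have "integrable M (\<lambda>x. (real_cond_exp M F (\<lambda>w. Re (f w)) x)\<^sup>2 + (real_cond_exp M F (\<lambda>w. Im (f w)) x)\<^sup>2)"
    by (intro Bochner_Integration.integrable_add sq) (auto intro: abs_Re_le_cmod abs_Im_le_cmod)
  then show ?thesis
    by (simp add: L2_fun_def CE_measurable cmod_power2 complex_cond_exp_def
        CE_measurable[unfolded complex_cond_exp_def])
qed

lemma CE_mult_L2:
  assumes "m \<in> borel_measurable F" "f \<in> L2_fun M" "AE x in M. cmod (m x) \<le> C"
  shows "AE x in M. CE (\<lambda>x. m x * f x) x = m x * CE f x"
  by (intro CE_mult L2_fun_integrable L2_fun_bounded_mult[where C = C] assms L2_funD(1)
      measurable_from_subalg[OF subalg assms(1)])

text \<open>The first factor is F-measurable and can be pulled out of a conditional expectation. The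
  right-hand side is Hermitian symmetric in f and g, which gives self-adjointness in
  \<open>CE_inner\<close>.\<close>

lemma CE_inner_proj:
  assumes f: "f \<in> L2_fun M" and g: "g \<in> L2_fun M"
  shows "(\<integral>x. cnj (CE f x) * g x \<partial>M) = (\<integral>x. cnj (CE f x) * CE g x \<partial>M)"
proof -
  have i: "integrable M (\<lambda>x. cnj (CE f x) * g x)"
    by (intro L2_integrable_inner CE_L2 f g)
  have "(\<integral>x. cnj (CE f x) * g x \<partial>M) = (\<integral>x. CE (\<lambda>x. cnj (CE f x) * g x) x \<partial>M)"
    by (rule CE_integral(2)[OF i, symmetric])
  also have "\<dots> = (\<integral>x. cnj (CE f x) * CE g x \<partial>M)"
    by (intro integral_cong_AE CE_mult i L2_funD(1)[OF g] CE_measurable borel_measurable_cnj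
        borel_measurable_times)
  finally show ?thesis .
qed

lemma CE_inner:
  assumes f: "f \<in> L2_fun M" and g: "g \<in> L2_fun M"
  shows "(\<integral>x. cnj (CE f x) * g x \<partial>M) = (\<integral>x. cnj (f x) * CE g x \<partial>M)"
proof -
  have "(\<integral>x. cnj (f x) * CE g x \<partial>M) = cnj (\<integral>x. cnj (CE g x) * f x \<partial>M)"
    by (subst Bochner_Integration.integral_cnj[symmetric])
      (simp add: mult.commute del: Bochner_Integration.integral_cnj)
  also have "\<dots> = cnj (\<integral>x. cnj (CE g x) * CE f x \<partial>M)"
    by (simp only: CE_inner_proj[OF g f])
  also have "\<dots> = (\<integral>x. cnj (CE f x) * CE g x \<partial>M)"
    by (subst Bochner_Integration.integral_cnj[symmetric])
      (simp add: mult.commute del: Bochner_Integration.integral_cnj)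
  finally show ?thesis using CE_inner_proj[OF f g] by simp
qed

lemma cond_exp_op_L2:
  assumes "f \<in> L2_fun M"
  shows "cond_exp_op M F (L2_class M f) = L2_class M (CE f)"
proof -
  have "AE x in M. CE (L2_rep (L2_class M f)) x = CE f x"
    using L2_rep_class[OF assms] assms by (intro CE_cong L2_funD(1))
  then show ?thesis
    using L2_rep_class[OF assms] assms
    by (simp add: cond_exp_op_def L2_class_in_vecs L2_class_eq_iff CE_L2)
qed

text \<open>The action of \<open>I + (m - I) P\<close> on functions, \<open>P\<close> being the projection onto \<open>L\<^sup>2(F)\<close>.\<close>

definition twist :: "('a \<Rightarrow> complex) \<Rightarrow> ('a \<Rightarrow> complex) \<Rightarrow> 'a \<Rightarrow> complex" where
  "twist m f x = f x + (m x - 1) * CE f x"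

lemma twist_L2:
  assumes m: "m \<in> borel_measurable F" "AE x in M. cmod (m x) = 1" and f: "f \<in> L2_fun M"
  shows "twist m f \<in> L2_fun M"
proof -
  have "AE x in M. cmod (m x - 1) \<le> 2"
    using m(2) by eventually_elim (metis norm_triangle_ineq4 norm_one one_add_one)
  then show ?thesis
    unfolding twist_def[abs_def] using measurable_from_subalg[OF subalg m(1)]
    by (intro L2_fun_add f L2_fun_bounded_mult[where C = 2] CE_L2) auto
qed

lemma CE_add_mult:
  assumes m: "m \<in> borel_measurable F" "AE x in M. cmod (m x) \<le> C"
    and f: "f \<in> L2_fun M" and g: "g \<in> L2_fun M" "AE x in M. CE g x = g x"
  shows "AE x in M. CE (\<lambda>x. f x + m x * g x) x = CE f x + m x * g x"
proof -
  have mg: "(\<lambda>x. m x * g x) \<in> L2_fun M"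
    by (rule L2_fun_bounded_mult[OF g(1) measurable_from_subalg[OF subalg m(1)] m(2)])
  show ?thesis
    using CE_add[OF L2_fun_integrable[OF f] L2_fun_integrable[OF mg]] CE_mult_L2[OF m(1) g(1) m(2)] g(2)
    by eventually_elim simp
qed

lemma CE_idem: "f \<in> L2_fun M \<Longrightarrow> AE x in M. CE (CE f) x = CE f x"
  by (intro CE_F_meas CE_integral(1) L2_fun_integrable CE_measurable)

text \<open>On L^2(F) the twist is multiplication by \<open>m\<close>, and it fixes the orthogonal
  complement; hence the twist by the conjugate of \<open>m\<close> inverts it.\<close>

lemma CE_twist:
  assumes m: "m \<in> borel_measurable F" "AE x in M. cmod (m x) = 1" and f: "f \<in> L2_fun M"
  shows "AE x in M. CE (twist m f) x = m x * CE f x"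
proof -
  have "AE x in M. cmod (m x - 1) \<le> 2"
    using m(2) by eventually_elim (metis norm_triangle_ineq4 norm_one one_add_one)
  then have "AE x in M. CE (\<lambda>x. f x + (m x - 1) * CE f x) x = CE f x + (m x - 1) * CE f x"
    using m(1) by (intro CE_add_mult[where C = 2] CE_idem CE_L2 f) auto
  then show ?thesis
    by (simp add: twist_def[abs_def] algebra_simps)
qed

lemma twist_cong:
  assumes "AE x in M. f x = g x" "f \<in> borel_measurable M" "g \<in> borel_measurable M"
  shows "AE x in M. twist m f x = twist m g x"
  using CE_cong[OF assms] assms(1) by eventually_elim (simp add: twist_def)

lemma twist_twist_cnj:
  assumes m: "m \<in> borel_measurable F" "AE x in M. cmod (m x) = 1" and f: "f \<in> L2_fun M"
  shows "AE x in M. twist (\<lambda>x. cnj (m x)) (twist m f) x = f x"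
  using CE_twist[OF assms] m(2)
proof eventually_elim
  case (elim x)
  then have "cnj (m x) * m x = 1"
    by (metis complex_norm_square mult.commute of_real_1 one_power2)
  then show ?case
    using elim(1) by (simp add: twist_def[of "\<lambda>x. cnj (m x)"] twist_def[of m f] algebra_simps)
qed

text \<open>The adjoint of (m - I) P is P (cnj m - I), and F-measurable multipliers commute with
  P.\<close>

lemma twist_inner:
  assumes m: "m \<in> borel_measurable F" "AE x in M. cmod (m x) = 1"
    and f: "f \<in> L2_fun M" and g: "g \<in> L2_fun M"
  shows "(\<integral>x. cnj (twist m f x) * g x \<partial>M) = (\<integral>x. cnj (f x) * twist (\<lambda>x. cnj (m x)) g x \<partial>M)"
proof -
  define u where "u x = cnj (m x) - 1" for x
  have u: "u \<in> borel_measurable F" unfolding u_def using m(1) by auto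
  have u2: "AE x in M. cmod (u x) \<le> 2"
    using m(2) unfolding u_def by eventually_elim (metis complex_mod_cnj norm_triangle_ineq4 norm_one one_add_one)
  note ug = L2_fun_bounded_mult[OF g measurable_from_subalg[OF subalg u] u2]
  note uEg = L2_fun_bounded_mult[OF CE_L2[OF g] measurable_from_subalg[OF subalg u] u2]
  have "(\<integral>x. cnj (twist m f x) * g x \<partial>M) = (\<integral>x. cnj (f x) * g x + cnj (CE f x) * (u x * g x) \<partial>M)"
    by (simp add: twist_def u_def algebra_simps)
  also have "\<dots> = (\<integral>x. cnj (f x) * g x \<partial>M) + (\<integral>x. cnj (CE f x) * (u x * g x) \<partial>M)"
    by (intro Bochner_Integration.integral_add L2_integrable_inner f g ug CE_L2)
  also have "(\<integral>x. cnj (CE f x) * (u x * g x) \<partial>M) = (\<integral>x. cnj (f x) * CE (\<lambda>x. u x * g x) x \<partial>M)"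
    by (rule CE_inner[OF f ug])
  also have "\<dots> = (\<integral>x. cnj (f x) * (u x * CE g x) \<partial>M)"
    by (rule integral_cong_AE)
      (use CE_mult_L2[OF u g u2] L2_funD(1)[OF f] L2_funD(1)[OF uEg] CE_measurable(2) in auto)
  also have "(\<integral>x. cnj (f x) * g x \<partial>M) + (\<integral>x. cnj (f x) * (u x * CE g x) \<partial>M) =
      (\<integral>x. cnj (f x) * g x + cnj (f x) * (u x * CE g x) \<partial>M)"
    by (intro Bochner_Integration.integral_add[symmetric] L2_integrable_inner f g uEg)
  also have "\<dots> = (\<integral>x. cnj (f x) * twist (\<lambda>x. cnj (m x)) g x \<partial>M)"
    by (simp add: twist_def u_def algebra_simps)
  finally show ?thesis .
qed

end

section \<open>The multiplicative increment of two twisted projections\<close>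

lemma cnj_mult_self_if_norm_1: "cmod z = 1 \<Longrightarrow> cnj z * z = 1"
  by (metis complex_norm_square mult.commute of_real_1 one_power2)

text \<open>\<open>G\<close>, \<open>p\<close> and \<open>F\<close>, \<open>q\<close> are the
  sigma-algebra and the value of the process at times s <= t. Only adaptedness and modulus one are
  assumed; the Markov property and homogeneity enter later through the hypotheses \<open>mom\<close>
  and \<open>eq\<close>.\<close>

locale unitary_increment = prob_space M for M :: "'a measure" +
  fixes G F :: "'a measure" and p q :: "'a \<Rightarrow> complex"
  assumes subalg_F: "subalgebra M F" and subalg_G: "subalgebra M G"
    and sets_le: "sets G \<subseteq> sets F"
    and p: "p \<in> borel_measurable G" "AE x in M. cmod (p x) = 1"
    and q: "q \<in> borel_measurable F" "AE x in M. cmod (q x) = 1"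
begin

sublocale F: finite_measure_subalgebra M F
  by unfold_locales (rule subalg_F)

sublocale G: finite_measure_subalgebra M G
  by unfold_locales (rule subalg_G)

lemma subalg_FG: "subalgebra F G"
  using subalg_F subalg_G sets_le by (simp add: subalgebra_def)

lemma F_measurable_if_G: "f \<in> borel_measurable G \<Longrightarrow> f \<in> borel_measurable F"
  using measurable_from_subalg[OF subalg_FG] .

lemma cnj_p: "(\<lambda>x. cnj (p x)) \<in> borel_measurable G" "AE x in M. cmod (cnj (p x)) = 1"
  using p by auto

definition incr :: "('a \<Rightarrow> complex) \<Rightarrow> 'a \<Rightarrow> complex" where
  "incr f = G.twist (\<lambda>x. cnj (p x)) (F.twist q f)"

lemma incr_L2: "f \<in> L2_fun M \<Longrightarrow> incr f \<in> L2_fun M"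
  unfolding incr_def by (intro G.twist_L2 F.twist_L2 cnj_p q)

lemma incr_cong:
  assumes "AE x in M. f x = g x" "f \<in> L2_fun M" "g \<in> L2_fun M"
  shows "AE x in M. incr f x = incr g x"
  unfolding incr_def
  by (intro G.twist_cong F.twist_cong L2_funD(1) F.twist_L2 q assms)

lemma incr_power_L2: "f \<in> L2_fun M \<Longrightarrow> (incr ^^ n) f \<in> L2_fun M"
  by (induction n) (auto intro: incr_L2)

lemma CE_F_of_G:
  assumes "f \<in> L2_fun M"
  shows "AE x in M. F.CE (G.CE f) x = G.CE f x"
  by (intro F.CE_F_meas L2_fun_integrable G.CE_L2 assms F_measurable_if_G G.CE_measurable)

lemma CE_G_of_F:
  assumes "f \<in> L2_fun M"
  shows "AE x in M. G.CE (F.CE f) x = G.CE f x"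
  by (rule G.CE_nested[OF subalg_F subalg_FG L2_fun_integrable[OF assms]])

text \<open>Both twists change f only by adding F-measurable functions, so the component orthogonal
  to L^2(F) survives unchanged.\<close>

lemma CE_F_incr:
  assumes f: "f \<in> L2_fun M"
  shows "AE x in M. F.CE (incr f) x - incr f x = F.CE f x - f x"
proof -
  note tf = F.twist_L2[OF q f]
  have two: "AE x in M. cmod (cnj (p x) - 1) \<le> 2"
    using cnj_p(2) by eventually_elim (metis norm_triangle_ineq4 norm_one one_add_one)
  have "AE x in M. F.CE (\<lambda>x. F.twist q f x + (cnj (p x) - 1) * G.CE (F.twist q f) x) x =
      F.CE (F.twist q f) x + (cnj (p x) - 1) * G.CE (F.twist q f) x"
    using F_measurable_if_G[OF cnj_p(1)]
    by (intro F.CE_add_mult[where C = 2] tf G.CE_L2 CE_F_of_G two) auto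
  then show ?thesis
    using F.CE_twist[OF q f]
    by eventually_elim
      (simp add: incr_def G.twist_def[abs_def] F.twist_def[of q f] algebra_simps)
qed

lemma CE_F_incr_power:
  assumes f: "f \<in> L2_fun M"
  shows "AE x in M. F.CE ((incr ^^ n) f) x - (incr ^^ n) f x = F.CE f x - f x"
proof (induction n)
  case (Suc n)
  then show ?case
    using CE_F_incr[OF incr_power_L2[OF f, of n]] by eventually_elim simp
qed simp

text \<open>A function orthogonal to L^2(F) is also orthogonal to the smaller L^2(G), so neither
  twist moves it.\<close>

lemma incr_power_ortho:
  assumes f: "f \<in> L2_fun M" and 0: "AE x in M. F.CE f x = 0"
  shows "AE x in M. (incr ^^ n) f x = f x"
proof (induction n)
  case (Suc n)
  have "AE x in M. G.CE (F.CE f) x = G.CE (\<lambda>x. 0) x"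
    by (rule G.CE_cong[OF 0]) (auto simp: F.CE_measurable)
  moreover have "AE x in M. G.CE (\<lambda>x. 0) x = 0"
    by (rule G.CE_F_meas) auto
  ultimately have G0: "AE x in M. G.CE f x = 0"
    using CE_G_of_F[OF f] by eventually_elim simp
  have tw: "AE x in M. F.twist q f x = f x"
    using 0 by eventually_elim (simp add: F.twist_def)
  have "AE x in M. G.twist (\<lambda>x. cnj (p x)) (F.twist q f) x = G.twist (\<lambda>x. cnj (p x)) f x"
    by (intro G.twist_cong tw L2_funD(1) F.twist_L2 q f)
  then have 1: "AE x in M. incr f x = f x"
    using G0 by eventually_elim (simp add: incr_def G.twist_def[of _ f])
  have "AE x in M. incr ((incr ^^ n) f) x = incr f x"
    by (rule incr_cong[OF Suc incr_power_L2[OF f] f])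
  then show ?case
    using 1 by eventually_elim simp
qed simp

text \<open>The one-step recursion. Its correction term is expressed by the G-projection of the new
  vector, which is the quantity that the induction below controls.\<close>

lemma incr_of_F_measurable:
  assumes f: "f \<in> L2_fun M" "AE x in M. F.CE f x = f x"
  shows "AE x in M. G.CE (incr f) x = cnj (p x) * G.CE (\<lambda>x. q x * f x) x"
    "AE x in M. incr f x = q x * f x - (p x - 1) * G.CE (incr f) x"
proof -
  have qf: "(\<lambda>x. q x * f x) \<in> L2_fun M"
    by (rule L2_fun_bounded_mult[OF f(1) measurable_from_subalg[OF subalg_F q(1)], where C = 1])
      (use q in auto)
  have tw: "AE x in M. F.twist q f x = q x * f x"
    using f(2) by eventually_elim (simp add: F.twist_def algebra_simps)
  note tL = F.twist_L2[OF q f(1)]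
  have G_tw: "AE x in M. G.CE (F.twist q f) x = G.CE (\<lambda>x. q x * f x) x"
    by (rule G.CE_cong[OF tw L2_funD(1)[OF tL] L2_funD(1)[OF qf]])
  show 1: "AE x in M. G.CE (incr f) x = cnj (p x) * G.CE (\<lambda>x. q x * f x) x"
    unfolding incr_def using G.CE_twist[OF cnj_p tL] G_tw by eventually_elim simp
  show "AE x in M. incr f x = q x * f x - (p x - 1) * G.CE (incr f) x"
    using 1 G_tw tw p(2)
  proof eventually_elim
    case (elim x)
    have "cnj (p x) * p x = 1" by (rule cnj_mult_self_if_norm_1) fact
    \<comment> \<open>Since |p| = 1, cnj p - 1 = -(p - 1) cnj p, and cnj p times the projection of q
      f is the projection of the increment.\<close>
    then have "(cnj (p x) - 1) * y = - ((p x - 1) * (cnj (p x) * y))" for y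
      by (simp add: algebra_simps)
    then show ?case
      using elim unfolding incr_def G.twist_def[of _ "F.twist q f"] by (simp add: incr_def)
  qed
qed

text \<open>
  For \<open>h\<close> in \<open>L\<^sup>2(G)\<close> the vectors \<open>incr\<^sup>n h\<close> satisfy a linear recursion; the moment
  relation \<open>eq\<close> is what makes \<open>c n * h\<close> solve it after conditioning on \<open>G\<close>.
\<close>

lemma CE_G_incr_power:
  fixes \<mu> :: "nat \<Rightarrow> complex \<Rightarrow> complex" and c :: "nat \<Rightarrow> complex"
  assumes mom: "\<And>n. AE x in M. G.CE (\<lambda>x. q x ^ n) x = \<mu> n (p x)"
    and eq: "\<And>n. AE x in M. p x * c (Suc n) =
      \<mu> (Suc n) (p x) - (p x - 1) * (\<Sum>k=1..n. c k * \<mu> (Suc n - k) (p x))"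
    and c0: "c 0 = 1"
    and h: "h \<in> L2_fun M" "h \<in> borel_measurable G"
  shows "AE x in M. G.CE ((incr ^^ n) h) x = c n * h x"
proof -
  \<comment> \<open>The multiplier with V^n h = R_n h, obtained by unrolling \<open>R_Suc\<close>
    from R_0 = 1.\<close>
  define R where "R n x = q x ^ n - (p x - 1) * (\<Sum>k=1..n. c k * q x ^ (n - k))" for n x
  note [measurable] = measurable_from_subalg[OF subalg_F q(1)] measurable_from_subalg[OF subalg_G p(1)]
  have R_Suc: "R (Suc n) x = q x * R n x - (p x - 1) * c (Suc n)" for n x
  proof -
    have "(\<Sum>k=1..Suc n. c k * q x ^ (Suc n - k)) = q x * (\<Sum>k=1..n. c k * q x ^ (n - k)) + c (Suc n)"
      by (simp add: sum_distrib_left Suc_diff_le ac_simps)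
    then show ?thesis by (simp add: R_def algebra_simps)
  qed
  have qn: "AE x in M. cmod (q x ^ n) \<le> 1" for n
    using q(2) by eventually_elim (simp add: norm_power)
  have qL: "(\<lambda>x. q x ^ n) \<in> L2_fun M" for n
    using L2_fun_bounded_mult[OF _ _ qn, of "\<lambda>x. 1"] by (simp add: L2_fun_def)
  have two: "AE x in M. cmod (p x - 1) \<le> 2"
    using p(2) by eventually_elim (metis norm_triangle_ineq4 norm_one one_add_one)
  \<comment> \<open>q R_n = q^(n+1) + (1 - p) S_n, where \<open>S\<close> is a polynomial in q with
    constant coefficients: its conditional expectation is read off from \<open>mom\<close>, and 1 -
    p is G-measurable and pulls out.\<close>
  define S where "S n x = (\<Sum>k=1..n. c k * q x ^ (Suc n - k))" for n x
  \<comment> \<open>Square-integrability is carried through the induction because additivity of the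
    conditional expectation needs it at each step.\<close>
  have CE_sum: "(\<lambda>x. \<Sum>k\<in>K. c k * q x ^ (r k)) \<in> L2_fun M \<and>
      (AE x in M. G.CE (\<lambda>x. \<Sum>k\<in>K. c k * q x ^ (r k)) x = (\<Sum>k\<in>K. c k * \<mu> (r k) (p x)))"
    if "finite K" for K :: "nat set" and r
    using that
  proof induction
    case empty
    then show ?case using G.CE_F_meas[of "\<lambda>x. 0"] by simp
  next
    case (insert j K)
    have cq: "(\<lambda>x. c j * q x ^ r j) \<in> L2_fun M" by (rule L2_fun_scale[OF qL])
    have "AE x in M. G.CE (\<lambda>x. c j * q x ^ r j) x = c j * G.CE (\<lambda>x. q x ^ r j) x"
      by (rule G.CE_mult_L2[OF _ qL, where C = "cmod (c j)"]) auto
    then have "AE x in M. G.CE (\<lambda>x. c j * q x ^ r j + (\<Sum>k\<in>K. c k * q x ^ (r k))) x =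
        c j * \<mu> (r j) (p x) + (\<Sum>k\<in>K. c k * \<mu> (r k) (p x))"
      using G.CE_add[OF L2_fun_integrable[OF cq] L2_fun_integrable[OF conjunct1[OF insert.IH]]]
        conjunct2[OF insert.IH] mom[of "r j"]
      by eventually_elim simp
    then show ?case
      using insert.hyps L2_fun_add[OF cq conjunct1[OF insert.IH]] by simp
  qed
  have S: "S n \<in> L2_fun M" "AE x in M. G.CE (S n) x = (\<Sum>k=1..n. c k * \<mu> (Suc n - k) (p x))" for n
    using CE_sum[of "{1..n}" "\<lambda>k. Suc n - k"] by (simp_all add: S_def[abs_def])
  have qR: "q x * R n x = q x ^ Suc n + (1 - p x) * S n x" for n x
  proof -
    have "q x * (\<Sum>k=1..n. c k * q x ^ (n - k)) = S n x"
      by (simp add: S_def sum_distrib_left Suc_diff_le ac_simps)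
    then show ?thesis by (simp add: R_def algebra_simps)
  qed
  have tw: "AE x in M. cmod (1 - p x) \<le> 2"
    using two by (simp add: norm_minus_commute)
  have pS: "(\<lambda>x. (1 - p x) * S n x) \<in> L2_fun M" for n
    by (rule L2_fun_bounded_mult[OF S(1) _ tw]) measurable
  \<comment> \<open>The only place where the moment relation \<open>eq\<close> is used: it is
    precisely the consistency condition for the recursion.\<close>
  have CE_qR: "AE x in M. G.CE (\<lambda>x. q x * R n x) x = p x * c (Suc n)" for n
  proof -
    have "AE x in M. G.CE (\<lambda>x. (1 - p x) * S n x) x = (1 - p x) * G.CE (S n) x"
      using p(1) by (intro G.CE_mult_L2[OF _ S(1) tw]) auto
    then show ?thesis
      unfolding qR
      using G.CE_add[OF L2_fun_integrable[OF qL[of "Suc n"]] L2_fun_integrable[OF pS[of n]]]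
        mom[of "Suc n"] S(2)[of n] eq[of n]
      by eventually_elim (simp only:, simp add: algebra_simps)
  qed
  have R_meas[measurable]: "R n \<in> borel_measurable M" for n
    unfolding R_def[abs_def] by measurable
  \<comment> \<open>Boundedness keeps q R_n h square-integrable for every h in L^2, so that
    \<open>h\<close> can be taken out of the conditional expectation.\<close>
  have R_bd: "\<exists>C. AE x in M. cmod (R n x) \<le> C" for n
  proof (induction n)
    case 0
    then show ?case by (auto simp: R_def)
  next
    case (Suc n)
    then obtain C where "AE x in M. cmod (R n x) \<le> C" by blast
    then have "AE x in M. cmod (R (Suc n) x) \<le> C + 2 * cmod (c (Suc n))"
      using two q(2)
    proof eventually_elim
      case (elim x)
      have "cmod (R (Suc n) x) \<le> cmod (q x) * cmod (R n x) + cmod (p x - 1) * cmod (c (Suc n))"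
        unfolding R_Suc norm_mult[symmetric] by (rule norm_triangle_ineq4)
      also have "\<dots> \<le> C + 2 * cmod (c (Suc n))"
        using elim by (intro add_mono mult_right_mono) auto
      finally show ?case .
    qed
    then show ?case by blast
  qed
  have CE_qRh: "AE x in M. G.CE (\<lambda>x. q x * (R n x * h x)) x = p x * c (Suc n) * h x" for n
  proof -
    obtain C where C: "AE x in M. cmod (R n x) \<le> C" using R_bd by blast
    have C': "AE x in M. cmod (q x * R n x) \<le> C"
      using C q(2) by eventually_elim (simp add: norm_mult)
    have "(\<lambda>x. h x * (q x * R n x)) \<in> L2_fun M"
      using L2_fun_bounded_mult[OF h(1) _ C'] by (simp add: mult.commute)
    then have "AE x in M. G.CE (\<lambda>x. h x * (q x * R n x)) x = h x * G.CE (\<lambda>x. q x * R n x) x"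
      by (intro G.CE_mult h L2_fun_integrable) auto
    then show ?thesis
      using CE_qR[of n] by eventually_elim (simp add: ac_simps)
  qed
  \<comment> \<open>The two claims are interlocked: the projection at n + 1 needs the formula for
    V^n h, and the formula for V^(n+1) h contains the projection at n + 1.\<close>
  have "(AE x in M. (incr ^^ n) h x = R n x * h x) \<and> (AE x in M. G.CE ((incr ^^ n) h) x = c n * h x)"
  proof (induction n)
    case 0
    have "AE x in M. G.CE h x = h x"
      by (rule G.CE_F_meas[OF L2_fun_integrable[OF h(1)] h(2)])
    then show ?case by (simp add: R_def c0)
  next
    case (Suc n)
    let ?f = "(incr ^^ n) h"
    note fL = incr_power_L2[OF h(1), of n]
    have "AE x in M. F.CE h x = h x"
      by (rule F.CE_F_meas[OF L2_fun_integrable[OF h(1)] F_measurable_if_G[OF h(2)]])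
    then have fF: "AE x in M. F.CE ?f x = ?f x"
      using CE_F_incr_power[OF h(1), of n] by eventually_elim simp
    have "AE x in M. q x * ?f x = q x * (R n x * h x)"
      using conjunct1[OF Suc] by eventually_elim simp
    then have "AE x in M. G.CE (\<lambda>x. q x * ?f x) x = G.CE (\<lambda>x. q x * (R n x * h x)) x"
      by (rule G.CE_cong) (use L2_funD(1)[OF fL] L2_funD(1)[OF h(1)] in auto)
    then have 1: "AE x in M. G.CE (incr ?f) x = c (Suc n) * h x"
      using incr_of_F_measurable(1)[OF fL fF] CE_qRh[of n] p(2)
    proof eventually_elim
      case (elim x)
      have "cnj (p x) * (p x * y) = y" for y
        using cnj_mult_self_if_norm_1[OF elim(4)] by (simp flip: mult.assoc)
      then show ?case using elim by (simp add: mult.assoc)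
    qed
    have "AE x in M. incr ?f x = R (Suc n) x * h x"
      using incr_of_F_measurable(2)[OF fL fF] 1 conjunct1[OF Suc]
      by eventually_elim (simp add: R_Suc algebra_simps)
    with 1 show ?case by simp
  qed
  then show ?thesis by blast
qed

end

section \<open>Moments of measures on the circle\<close>

lemma space_circle [simp]: "space circle = sphere 0 1"
  by (simp add: circle_def)

lemma measurable_circle_borel: "f \<in> borel_measurable borel \<Longrightarrow> f \<in> borel_measurable circle"
  unfolding circle_def by (rule measurable_restrict_space1)

lemma circle_probD:
  assumes "circle_prob \<mu>"
  shows "prob_space \<mu>" "sets \<mu> = sets circle" "space \<mu> = sphere 0 1"
  using assms by (auto simp: space_prob_algebra dest: sets_eq_imp_space_eq)

lemma circle_prob_measurable:
  assumes "circle_prob \<mu>" "f \<in> borel_measurable circle"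
  shows "f \<in> borel_measurable \<mu>"
  using assms circle_probD(2)[OF assms(1)] by (simp cong: measurable_cong_sets)

lemma circle_prob_integrable:
  fixes f :: "complex \<Rightarrow> 'b :: {banach, second_countable_topology}"
  assumes \<mu>: "circle_prob \<mu>" and f: "f \<in> borel_measurable circle"
    and bd: "\<And>x. cmod x = 1 \<Longrightarrow> norm (f x) \<le> B"
  shows "integrable \<mu> f"
proof -
  interpret prob_space \<mu> by (rule circle_probD(1)[OF \<mu>])
  show ?thesis
    by (rule integrable_const_bound[where B = B])
      (use circle_probD(3)[OF \<mu>] bd circle_prob_measurable[OF \<mu> f] in auto)
qed

lemma power_measurable_circle: "(\<lambda>x. x ^ n) \<in> borel_measurable circle"
  by (intro measurable_circle_borel borel_measurable_power) auto

lemma circle_prob_integrable_power: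
  assumes "circle_prob \<mu>"
  shows "integrable \<mu> (\<lambda>x. x ^ n)"
  by (rule circle_prob_integrable[OF assms power_measurable_circle, where B = 1]) (simp add: norm_power)

definition moment :: "complex measure \<Rightarrow> nat \<Rightarrow> complex" where
  "moment \<mu> n = (\<integral>x. x ^ n \<partial>\<mu>)"

lemma moment_0: "circle_prob \<mu> \<Longrightarrow> moment \<mu> 0 = 1"
  using prob_space.prob_space[OF circle_probD(1)] by (simp add: moment_def)

lemma norm_moment_le:
  assumes "circle_prob \<mu>"
  shows "cmod (moment \<mu> n) \<le> 1"
proof -
  interpret prob_space \<mu> by (rule circle_probD(1)[OF assms])
  have "cmod (moment \<mu> n) \<le> (\<integral>x. cmod (x ^ n) \<partial>\<mu>)"
    unfolding moment_def by (rule integral_norm_bound)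
  also have "\<dots> = (\<integral>x. 1 \<partial>\<mu>)"
    by (intro Bochner_Integration.integral_cong) (auto simp: norm_power circle_probD(3)[OF assms])
  finally show ?thesis by (simp add: prob_space)
qed

definition psi_fps :: "complex measure \<Rightarrow> complex fps" where
  "psi_fps \<mu> = Abs_fps (\<lambda>n. if n = 0 then 0 else moment \<mu> n)"

lemma psi_fps_conv_radius:
  assumes "circle_prob \<mu>"
  shows "fps_conv_radius (psi_fps \<mu>) \<ge> ereal (1/2)"
proof -
  have "summable (\<lambda>n. fps_nth (psi_fps \<mu>) n * (1/2)^n)"
  proof (rule summable_comparison_test)
    show "\<exists>N. \<forall>n\<ge>N. norm (fps_nth (psi_fps \<mu>) n * (1/2)^n) \<le> (1/2)^n"
      using norm_moment_le[OF assms] by (auto simp: psi_fps_def norm_mult norm_power norm_divide)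
  qed (simp add: summable_geometric)
  from conv_radius_geI[OF this] show ?thesis
    by (simp add: fps_conv_radius_def norm_divide)
qed

text \<open>Termwise integration of the geometric series, which starts at n = 1; on the circle it is
  dominated by the powers of |z|.\<close>

lemma eval_psi_fps:
  assumes \<mu>: "circle_prob \<mu>" and z: "cmod z < 1"
  shows "eval_fps (psi_fps \<mu>) z = psi_transform \<mu> z"
proof -
  interpret prob_space \<mu> by (rule circle_probD(1)[OF \<mu>])
  define f where "f n x = (if n = 0 then 0 else (x * z) ^ n)" for n x
  have f_norm: "cmod (f n x) \<le> cmod z ^ n" if "cmod x = 1" for n x
    using that by (simp add: f_def norm_mult norm_power power_mult_distrib)
  have meas: "f n \<in> borel_measurable circle" for n
    unfolding f_def by (intro measurable_circle_borel) measurable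
  have i: "integrable \<mu> (f n)" for n
    by (rule circle_prob_integrable[OF \<mu> meas f_norm])
  have S: "summable (\<lambda>n. cmod z ^ n)" using z by (simp add: summable_geometric)
  have "(\<lambda>n. \<integral>x. f n x \<partial>\<mu>) sums (\<integral>x. (\<Sum>n. f n x) \<partial>\<mu>)"
  proof (rule sums_integral[OF i])
    show "AE x in \<mu>. summable (\<lambda>n. norm (f n x))"
      using circle_probD(3)[OF \<mu>] f_norm
      by (intro AE_I2 summable_comparison_test[OF _ S]) auto
    have "(\<integral>x. norm (f n x) \<partial>\<mu>) \<le> cmod z ^ n" for n
    proof -
      have "(\<integral>x. norm (f n x) \<partial>\<mu>) \<le> (\<integral>x. cmod z ^ n \<partial>\<mu>)"
        using circle_probD(3)[OF \<mu>] f_norm by (intro integral_mono integrable_norm i) auto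
      then show ?thesis by (simp add: prob_space)
    qed
    then show "summable (\<lambda>n. \<integral>x. norm (f n x) \<partial>\<mu>)"
      by (intro summable_comparison_test[OF _ S]) auto
  qed
  also have "(\<integral>x. (\<Sum>n. f n x) \<partial>\<mu>) = psi_transform \<mu> z"
    unfolding psi_transform_def
  proof (rule Bochner_Integration.integral_cong[OF refl])
    fix x assume "x \<in> space \<mu>"
    then have "cmod (x * z) < 1" using z circle_probD(3)[OF \<mu>] by (simp add: norm_mult)
    then have "(\<lambda>n. (x * z) ^ n - (if n = 0 then 1 else 0)) sums (1 / (1 - x * z) - 1)"
      by (intro sums_diff geometric_sums) (use sums_If_finite_set[of "{0::nat}" "\<lambda>_. 1 :: complex"] in simp_all)
    moreover have "(x * z) ^ n - (if n = 0 then 1 else 0) = f n x" for n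
      by (simp add: f_def)
    moreover have "x * z \<noteq> 1" using \<open>cmod (x * z) < 1\<close> by auto
    ultimately show "(\<Sum>n. f n x) = x * z / (1 - x * z)"
      by (simp add: sums_iff field_simps)
  qed
  also have "(\<lambda>n. \<integral>x. f n x \<partial>\<mu>) = (\<lambda>n. fps_nth (psi_fps \<mu>) n * z ^ n)"
    by (rule ext) (simp add: f_def psi_fps_def moment_def power_mult_distrib)
  finally show ?thesis by (simp add: eval_fps_def sums_iff)
qed

text \<open>For |z| < 1/4 the integrand is at most (1/4)/(3/4) = 1/3. Then |1 + psi| >= 2/3, so the
  eta transform is defined without a zero denominator and stays in the disc, where
  \<open>eta_transform_return\<close> applies.\<close>

lemma norm_psi_transform_le:
  assumes \<mu>: "circle_prob \<mu>" and z: "cmod z < 1/4"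
  shows "cmod (psi_transform \<mu> z) \<le> 1/3"
proof -
  interpret prob_space \<mu> by (rule circle_probD(1)[OF \<mu>])
  have "cmod (psi_transform \<mu> z) \<le> (\<integral>x. cmod (x * z / (1 - x * z)) \<partial>\<mu>)"
    unfolding psi_transform_def by (rule integral_norm_bound)
  also have "\<dots> \<le> (\<integral>x. 1/3 \<partial>\<mu>)"
  proof (rule integral_mono')
    fix x assume "x \<in> space \<mu>"
    then have x: "cmod (x * z) < 1/4" using z circle_probD(3)[OF \<mu>] by (simp add: norm_mult)
    have "3/4 \<le> cmod (1 - x * z)"
      using norm_triangle_ineq2[of 1 "x * z"] x by simp
    then show "cmod (x * z / (1 - x * z)) \<le> 1/3"
      using x by (simp add: norm_divide divide_simps)
  qed auto
  finally show ?thesis by (simp add: prob_space)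
qed

lemma eta_transform_return:
  assumes x: "cmod x = 1" and w: "cmod w < 1"
  shows "eta_transform (return circle x) w = x * w"
proof -
  have "(\<lambda>y. y * w / (1 - y * w)) \<in> borel_measurable circle"
    by (intro measurable_circle_borel) measurable
  then have "psi_transform (return circle x) w = x * w / (1 - x * w)"
    unfolding psi_transform_def using x by (subst integral_return) auto
  moreover have "x * w \<noteq> 1"
    using x w by (metis mult.left_neutral norm_mult norm_one less_irrefl)
  moreover from this have "1 + x * w / (1 - x * w) = 1 / (1 - x * w)"
    by (simp add: field_simps)
  ultimately show ?thesis
    by (simp add: eta_transform_def)
qed

text \<open>
  The coefficients of \<open>x C = X - (x - 1) C X\<close>, which is \<open>\<eta>\<^bsub>\<rho>\<^esub> = x \<eta>\<^bsub>\<mu>\<^esub>\<close> rewritten with \<open>C = \<psi>\<^bsub>\<mu>\<^esub>\<close>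
  and \<open>X = \<psi>\<^bsub>\<rho>\<^esub>\<close>.
\<close>

lemma rotated_moments:
  assumes \<mu>: "circle_prob \<mu>" and \<rho>: "circle_prob \<rho>" and x: "cmod x = 1"
    and conv: "is_mult_monotone_conv (return circle x) \<mu> \<rho>"
  shows "x * moment \<mu> (Suc n) =
    moment \<rho> (Suc n) - (x - 1) * (\<Sum>k=1..n. moment \<mu> k * moment \<rho> (Suc n - k))"
proof -
  let ?C = "psi_fps \<mu>" and ?X = "psi_fps \<rho>"
  have r: "cmod z < fps_conv_radius f" if "ereal (1/2) \<le> fps_conv_radius f" "cmod z < 1/4" for z and f :: "complex fps"
  proof -
    have "ereal (cmod z) < ereal (1/2)" using that(2) by simp
    then show ?thesis using that(1) by (rule less_le_trans)
  qed
  have R: "fps_conv_radius ?C \<ge> ereal (1/2)" "fps_conv_radius ?X \<ge> ereal (1/2)"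
    by (rule psi_fps_conv_radius; fact)+
  have Rc: "fps_conv_radius (fps_const a) \<ge> ereal (1/2)" for a :: complex
    by simp
  have mult: "fps_conv_radius (f * g) \<ge> ereal (1/2)" if "fps_conv_radius f \<ge> ereal (1/2)" "fps_conv_radius g \<ge> ereal (1/2)"
    for f g :: "complex fps"
    using fps_conv_radius_mult[of f g] that by (meson min.boundedI order_trans)
  have diff: "fps_conv_radius (f - g) \<ge> ereal (1/2)" if "fps_conv_radius f \<ge> ereal (1/2)" "fps_conv_radius g \<ge> ereal (1/2)"
    for f g :: "complex fps"
    using fps_conv_radius_diff[of f g] that by (meson min.boundedI order_trans)
  let ?l = "fps_const x * ?C" and ?r = "?X - fps_const (x - 1) * (?C * ?X)"
  have Rl: "fps_conv_radius ?l \<ge> ereal (1/2)" "fps_conv_radius ?r \<ge> ereal (1/2)"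
    by (intro mult diff R Rc)+
  have ev: "eval_fps ?l z = eval_fps ?r z" if z: "cmod z < 1/4" for z
  proof -
    define C X where "C = psi_transform \<mu> z" and "X = psi_transform \<rho> z"
    have C: "cmod C \<le> 1/3" and X: "cmod X \<le> 1/3"
      unfolding C_def X_def by (rule norm_psi_transform_le[OF _ z]; fact)+
    have low: "cmod (1 + y) \<ge> 2/3" if "cmod y \<le> 1/3" for y :: complex
      using norm_triangle_ineq2[of 1 "- y"] that by simp
    have "cmod (C / (1 + C)) < 1"
      using C low[OF C] by (simp add: norm_divide divide_simps)
    then have "eta_transform (return circle x) (C / (1 + C)) = x * (C / (1 + C))"
      by (rule eta_transform_return[OF x])
    moreover have "eta_transform \<rho> z = eta_transform (return circle x) (eta_transform \<mu> z)"
      using conv z by (simp add: is_mult_monotone_conv_def)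
    ultimately have "X / (1 + X) = x * (C / (1 + C))"
      by (simp add: eta_transform_def C_def X_def)
    moreover have "1 + C \<noteq> 0" "1 + X \<noteq> 0"
      using low[OF C] low[OF X] by auto
    ultimately have "x * C = X - (x - 1) * (C * X)"
      by (simp add: field_simps)
    moreover have "eval_fps ?C z = C" "eval_fps ?X z = X"
      using z by (simp_all add: eval_psi_fps \<mu> \<rho> C_def X_def)
    ultimately show ?thesis
      using r[OF _ z] by (simp add: eval_fps_mult eval_fps_diff R Rc mult diff)
  qed
  \<comment> \<open>Power series with positive radius of convergence that agree as functions near 0
    have equal coefficients.\<close>
  have "?l = ?r"
  proof (rule eval_fps_eqD)
    show "fps_conv_radius ?l > 0" "fps_conv_radius ?r > 0"
      using r[OF Rl(1), of 0] r[OF Rl(2), of 0] by (simp_all add: zero_ereal_def)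
    show "eventually (\<lambda>z. eval_fps ?l z = eval_fps ?r z) (nhds 0)"
      using eventually_nhds_in_open[of "ball 0 (1/4)" "0::complex"]
      by (auto elim!: eventually_mono intro: ev)
  qed
  then have "fps_nth ?l (Suc n) = fps_nth ?r (Suc n)" by (simp only:)
  moreover have "fps_nth (?C * ?X) (Suc n) = (\<Sum>k=1..n. moment \<mu> k * moment \<rho> (Suc n - k))"
  proof -
    have "fps_nth (?C * ?X) (Suc n) = (\<Sum>k=0..Suc n. fps_nth ?C k * fps_nth ?X (Suc n - k))"
      by (rule fps_mult_nth)
    \<comment> \<open>The end terms k = 0 and k = n + 1 contain a constant coefficient of a psi
      series, which is 0.\<close>
    also have "\<dots> = (\<Sum>k=1..n. fps_nth ?C k * fps_nth ?X (Suc n - k))"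
      by (rule sum.mono_neutral_right) (auto simp: psi_fps_def le_Suc_eq)
    also have "\<dots> = (\<Sum>k=1..n. moment \<mu> k * moment \<rho> (Suc n - k))"
      by (intro sum.cong) (auto simp: psi_fps_def)
    finally show ?thesis .
  qed
  ultimately show ?thesis by (simp add: psi_fps_def)
qed

text \<open>The difference of the two integrals is a functional as in
  \<open>functional_on_circle_eq_0\<close>. It kills constants, so f may be replaced by f - f 1; its
  values on negative powers are conjugates of those on positive ones.\<close>

lemma circle_prob_integral_eq:
  assumes \<mu>: "circle_prob \<mu>" and \<nu>: "circle_prob \<nu>" and eq: "\<And>n. moment \<mu> n = moment \<nu> n"
    and f: "continuous_on UNIV (f :: complex \<Rightarrow> complex)"
  shows "(\<integral>x. f x \<partial>\<mu>) = (\<integral>x. f x \<partial>\<nu>)"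
proof -
  have meas: "g \<in> borel_measurable circle" if "continuous_on UNIV g" for g :: "complex \<Rightarrow> complex"
    using that by (intro measurable_circle_borel borel_measurable_continuous_onI)
  have int: "integrable \<rho> g" if "circle_prob \<rho>" "continuous_on UNIV g" for \<rho> and g :: "complex \<Rightarrow> complex"
  proof -
    have "bounded (g ` sphere 0 1)"
      by (intro compact_imp_bounded compact_continuous_image continuous_on_subset[OF that(2)]) auto
    then obtain B where "\<forall>x\<in>sphere 0 1. cmod (g x) \<le> B"
      by (auto simp: bounded_iff)
    then show ?thesis
      by (intro circle_prob_integrable[OF that(1) meas[OF that(2)], where B = B]) auto
  qed
  note [simp] = int[OF \<mu>] int[OF \<nu>]
  have prob: "measure \<rho> (space \<rho>) = 1" if "circle_prob \<rho>" for \<rho>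
    using prob_space.prob_space[OF circle_probD(1)[OF that]] .
  have bound: "cmod (\<integral>x. g x \<partial>\<rho>) \<le> e"
    if \<rho>: "circle_prob \<rho>" "continuous_on UNIV g" and e: "\<And>z. cmod z = 1 \<Longrightarrow> cmod (g z) < e"
    for \<rho> and g :: "complex \<Rightarrow> complex" and e
  proof -
    interpret prob_space \<rho> by (rule circle_probD(1)[OF \<rho>(1)])
    have "cmod (\<integral>x. g x \<partial>\<rho>) \<le> (\<integral>x. cmod (g x) \<partial>\<rho>)" by (rule integral_norm_bound)
    also have "\<dots> \<le> (\<integral>x. e \<partial>\<rho>)"
      using e circle_probD(3)[OF \<rho>(1)] by (intro integral_mono integrable_norm int \<rho>) (auto simp: less_imp_le)
    finally show ?thesis by (simp add: prob_space)
  qed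
  define L where "L g = (\<integral>x. g x \<partial>\<mu>) - (\<integral>x. g x \<partial>\<nu>)" for g :: "complex \<Rightarrow> complex"
  have L_pow: "L (\<lambda>z. z ^ n - 1) = 0" for n
    using eq[of n] by (simp add: L_def moment_def continuous_intros prob \<mu> \<nu>)
  have L_cnj: "L (\<lambda>z. cnj (g z)) = cnj (L g)" for g
    by (simp add: L_def)
  have "L (\<lambda>z. f z - f 1) = 0"
  proof (rule functional_on_circle_eq_0[where L = L and C = 2])
    fix g :: "complex \<Rightarrow> complex" and e :: real
    assume g: "continuous_on UNIV g" "e > 0" "\<And>z. cmod z = 1 \<Longrightarrow> cmod (g z) < e"
    have "cmod (L g) \<le> cmod (\<integral>x. g x \<partial>\<mu>) + cmod (\<integral>x. g x \<partial>\<nu>)"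
      unfolding L_def by (rule norm_triangle_ineq4)
    also have "\<dots> \<le> e + e"
      by (intro add_mono bound \<mu> \<nu> g)
    finally show "cmod (L g) \<le> 2 * e" by simp
  next
    show "L (\<lambda>z. cnj z ^ n - 1) = 0" for n
      using L_cnj[of "\<lambda>z. z ^ n - 1"] L_pow[of n] by simp
  qed (auto simp: L_pow continuous_intros f, auto simp: L_def algebra_simps)
  then show ?thesis
    by (simp add: L_def f prob \<mu> \<nu>)
qed

lemma tendsto_tent_indicator:
  fixes x :: "'a :: metric_space"
  assumes "closed C" "C \<noteq> {}"
  shows "(\<lambda>n. max 0 (1 - real n * infdist x C)) \<longlonglongrightarrow> indicator C x"
proof (cases "x \<in> C")
  case True
  then show ?thesis by (simp add: infdist_zero)
next
  case False
  then have pos: "infdist x C > 0"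
    using assms in_closed_iff_infdist_zero[of C x] infdist_nonneg[of x C] by (auto simp: less_le)
  obtain N where N: "real N * infdist x C > 1"
    using reals_Archimedean3[OF pos] by blast
  have "max 0 (1 - real n * infdist x C) = 0" if "n \<ge> N" for n
  proof -
    have "real N * infdist x C \<le> real n * infdist x C"
      using that pos by (intro mult_right_mono) auto
    then show ?thesis using N by simp
  qed
  then have "eventually (\<lambda>n. max 0 (1 - real n * infdist x C) = indicator C x) sequentially"
    unfolding eventually_sequentially using False by (intro exI[of _ N]) auto
  then show ?thesis by (rule tendsto_eventually)
qed

text \<open>Uniqueness for the moment problem on the circle; it makes the \<open>THE\<close> in
  \<open>unitary_distribution\<close> denote the measure that is found.\<close>

lemma circle_prob_eqI:
  assumes \<mu>: "circle_prob \<mu>" and \<nu>: "circle_prob \<nu>" and eq: "\<And>n. moment \<mu> n = moment \<nu> n"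
  shows "\<mu> = \<nu>"
proof -
  \<comment> \<open>Closed sets are reached by dominated convergence of continuous tent
    functions.\<close>
  have meas: "measure \<mu> (C \<inter> sphere 0 1) = measure \<nu> (C \<inter> sphere 0 1)" if C: "closed C" for C
  proof (cases "C = {}")
    case False
    define g where "g n x = max 0 (1 - real n * infdist x C)" for n and x :: complex
    have cont: "continuous_on UNIV (g n)" for n
      unfolding g_def by (intro continuous_intros)
    have lim: "(\<lambda>n. \<integral>x. g n x \<partial>\<rho>) \<longlonglongrightarrow> measure \<rho> (C \<inter> sphere 0 1)" if \<rho>: "circle_prob \<rho>" for \<rho>
    proof -
      interpret prob_space \<rho> by (rule circle_probD(1)[OF \<rho>])
      have gm: "g n \<in> borel_measurable \<rho>" for n
        by (intro circle_prob_measurable[OF \<rho>] measurable_circle_borel borel_measurable_continuous_onI cont)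
      have im: "indicator C \<in> borel_measurable \<rho>"
        by (intro circle_prob_measurable[OF \<rho>] measurable_circle_borel) (use C in auto)
      have "(\<lambda>n. \<integral>x. g n x \<partial>\<rho>) \<longlonglongrightarrow> (\<integral>x. indicator C x \<partial>\<rho>)"
      proof (rule integral_dominated_convergence[where w = "\<lambda>_. 1"])
        show "AE x in \<rho>. (\<lambda>n. g n x) \<longlonglongrightarrow> indicator C x"
          unfolding g_def by (intro AE_I2 tendsto_tent_indicator C False)
        show "AE x in \<rho>. norm (g n x) \<le> 1" for n
          by (auto simp: g_def infdist_nonneg)
      qed (use gm im in auto)
      then show ?thesis
        using circle_probD(3)[OF \<rho>] by (simp add: Int_commute)
    qed
    have "(\<integral>x. g n x \<partial>\<mu>) = (\<integral>x. g n x \<partial>\<nu>)" for n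
    proof -
      have "(\<integral>x. complex_of_real (g n x) \<partial>\<mu>) = (\<integral>x. complex_of_real (g n x) \<partial>\<nu>)"
        by (rule circle_prob_integral_eq[OF \<mu> \<nu> eq]) (intro continuous_intros cont)
      then show ?thesis by simp
    qed
    then show ?thesis
      using LIMSEQ_unique[OF lim[OF \<mu>]] lim[OF \<nu>] by simp
  qed simp
  interpret \<mu>: prob_space \<mu> by (rule circle_probD(1)[OF \<mu>])
  interpret \<nu>: prob_space \<nu> by (rule circle_probD(1)[OF \<nu>])
  have id: "(\<lambda>x. x) \<in> measurable \<rho> borel" if "circle_prob \<rho>" for \<rho>
    by (intro circle_prob_measurable[OF that] measurable_circle_borel) simp
  have em: "emeasure (distr \<rho> borel (\<lambda>x. x)) B = emeasure \<rho> (B \<inter> sphere 0 1)"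
    if "circle_prob \<rho>" "B \<in> sets borel" for \<rho> B
    using that by (simp add: emeasure_distr id circle_probD(3))
  \<comment> \<open>Pushing both measures forward to the Borel sets of the plane lets the closed
    sets serve as an intersection-stable generator.\<close>
  have "distr \<mu> borel (\<lambda>x. x) = distr \<nu> borel (\<lambda>x. x)"
  proof (rule measure_eqI_generator_eq[where E = "{C. closed C}" and \<Omega> = UNIV and A = "\<lambda>_. UNIV"])
    show "Int_stable {C :: complex set. closed C}" by (auto simp: Int_stable_def)
    show "emeasure (distr \<mu> borel (\<lambda>x. x)) C = emeasure (distr \<nu> borel (\<lambda>x. x)) C"
      if "C \<in> {C. closed C}" for C
      using that meas[of C] by (simp add: em \<mu> \<nu> \<mu>.emeasure_eq_measure \<nu>.emeasure_eq_measure)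
    show "emeasure (distr \<mu> borel (\<lambda>x. x)) UNIV \<noteq> \<infinity>" by (simp add: em \<mu>)
  qed (auto simp: borel_eq_closed)
  then have eq': "emeasure \<mu> (B \<inter> sphere 0 1) = emeasure \<nu> (B \<inter> sphere 0 1)" if "B \<in> sets borel" for B
    using em[OF \<mu> that] em[OF \<nu> that] by simp
  show "\<mu> = \<nu>"
  proof (rule measure_eqI)
    show "sets \<mu> = sets \<nu>" using circle_probD(2)[OF \<mu>] circle_probD(2)[OF \<nu>] by simp
    fix B assume "B \<in> sets \<mu>"
    then obtain B' where "B = B' \<inter> sphere 0 1" "B' \<in> sets borel"
      by (auto simp: circle_probD(2)[OF \<mu>] circle_def sets_restrict_space)
    then show "emeasure \<mu> B = emeasure \<nu> B" using eq' by simp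
  qed
qed

section \<open>Conditional moments of a Markov process\<close>

lemma markov_processD:
  assumes "markov_process P F k X" "0 \<le> s" "s \<le> t"
  shows "transition_kernels k" "X s \<in> F s \<rightarrow>\<^sub>M circle" "X t \<in> F t \<rightarrow>\<^sub>M circle"
    "k s t \<in> circle \<rightarrow>\<^sub>M prob_algebra circle"
    "B \<in> sets circle \<Longrightarrow> AE w in P. real_cond_exp P (F s) (indicator (X t -` B \<inter> space P)) w =
      measure (k s t (X s w)) B"
  using assms by (auto simp: markov_process_def transition_kernels_def)

text \<open>The Markov property gives the conditional law event by event. To pass to functions, fix
  A in \<open>F s\<close>: under P restricted to A, the law of X_t and the mixture of the kernels
  agree on every Borel set, hence have the same integrals.\<close>

lemma markov_process_real_cond_exp:
  fixes \<phi> :: "complex \<Rightarrow> real"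
  assumes P: "prob_space P" and F: "is_filtration P F" and X: "markov_process P F k X"
    and st: "0 \<le> s" "s \<le> t"
    and \<phi>: "\<phi> \<in> borel_measurable circle" and bd: "\<And>x. cmod x = 1 \<Longrightarrow> 0 \<le> \<phi> x \<and> \<phi> x \<le> B"
  shows "AE w in P. real_cond_exp P (F s) (\<lambda>w. \<phi> (X t w)) w = (\<integral>x. \<phi> x \<partial>k s t (X s w))"
proof -
  interpret prob_space P by fact
  have sub: "subalgebra P (F s)" "subalgebra P (F t)"
    using F st by (auto simp: is_filtration_def)
  interpret finite_measure_subalgebra P "F s"
    by unfold_locales (rule sub)
  define K where "K w = k s t (X s w)" for w
  have KF: "K \<in> F s \<rightarrow>\<^sub>M prob_algebra circle"
    unfolding K_def by (rule measurable_compose[OF markov_processD(2)[OF X st] markov_processD(4)[OF X st]])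
  then have KP: "K \<in> P \<rightarrow>\<^sub>M prob_algebra circle"
    by (rule measurable_from_subalg[OF sub(1)])
  note KS = measurable_prob_algebraD[OF KP]
  have XP: "X t \<in> P \<rightarrow>\<^sub>M circle"
    by (rule measurable_from_subalg[OF sub(2) markov_processD(3)[OF X st]])
  have Kprob: "circle_prob (K w)" if "w \<in> space P" for w
    using measurable_space[OF KP that] .
  have Xsp: "cmod (X t w) = 1" if "w \<in> space P" for w
    using measurable_space[OF XP that] by simp
  have meas_int: "(\<lambda>w. \<integral>x. \<phi> x \<partial>K w) \<in> borel_measurable (F s)"
    by (rule measurable_compose[OF measurable_prob_algebraD[OF KF] integral_measurable_subprob_algebra[OF \<phi>]])
  have int_bd: "0 \<le> (\<integral>x. \<phi> x \<partial>K w) \<and> (\<integral>x. \<phi> x \<partial>K w) \<le> B" if w: "w \<in> space P" for w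
  proof -
    interpret Kw: prob_space "K w" by (rule circle_probD(1)[OF Kprob[OF w]])
    have i: "integrable (K w) \<phi>"
      using bd by (intro circle_prob_integrable[OF Kprob[OF w] \<phi>, where B = B]) force
    have "0 \<le> (\<integral>x. \<phi> x \<partial>K w)"
      using bd circle_probD(3)[OF Kprob[OF w]] by (intro Bochner_Integration.integral_nonneg) auto
    moreover have "(\<integral>x. \<phi> x \<partial>K w) \<le> (\<integral>x. B \<partial>K w)"
      using bd circle_probD(3)[OF Kprob[OF w]] by (intro integral_mono i) auto
    ultimately show ?thesis by (simp add: Kw.prob_space)
  qed
  have i1: "integrable P (\<lambda>w. \<phi> (X t w))"
    using bd Xsp measurable_compose[OF XP \<phi>] by (intro integrable_const_bound[where B = B]) auto
  have i2: "integrable P (\<lambda>w. \<integral>x. \<phi> x \<partial>K w)"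
    using int_bd measurable_from_subalg[OF sub(1) meas_int] by (intro integrable_const_bound[where B = B]) auto
  have "(\<integral>w\<in>A. \<phi> (X t w) \<partial>P) = (\<integral>w\<in>A. (\<integral>x. \<phi> x \<partial>K w) \<partial>P)" if A: "A \<in> sets (F s)" for A
  proof -
    have AP[measurable]: "A \<in> sets P" using A sub(1) by (auto simp: subalgebra_def)
    \<comment> \<open>Restriction of P to A. It may have total mass 0, but its underlying space is
      nonempty, which is what the bind rules ask for.\<close>
    define N where "N = density P (indicator A)"
    have sN[measurable_cong]: "sets N = sets P" by (simp add: N_def)
    have spN: "space N = space P" by (simp add: N_def)
    have XN: "X t \<in> N \<rightarrow>\<^sub>M circle" and KN: "K \<in> N \<rightarrow>\<^sub>M subprob_algebra circle"
      using XP KS by (simp_all add: measurable_cong_sets[OF sN refl])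
    have ne: "space N \<noteq> {}" using not_empty by (simp add: spN)
    have "distr N circle (X t) = N \<bind> K"
    proof (rule measure_eqI)
      show "sets (distr N circle (X t)) = sets (N \<bind> K)"
        using sets_bind[OF sets_kernel[OF KN] ne] by simp
      fix B assume "B \<in> sets (distr N circle (X t))"
      then have Bc: "B \<in> sets circle" by simp
      define D where "D = X t -` B \<inter> space P"
      have D[measurable]: "D \<in> sets P" unfolding D_def using XP Bc by (rule measurable_sets)
      have iAD: "integrable P (\<lambda>w. indicator A w * indicator D w :: real)"
        by (intro integrable_const_bound[where B = 1]) (auto simp: indicator_def)
      have mK: "(\<lambda>w. measure (K w) B) \<in> borel_measurable P"
        by (rule measurable_compose[OF KS measurable_measure_subprob_algebra[OF Bc]])
      have "emeasure (distr N circle (X t)) B = emeasure N D"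
        using XN Bc by (simp add: emeasure_distr D_def spN)
      also have "\<dots> = (\<integral>\<^sup>+w. indicator A w * indicator D w \<partial>P)"
        by (simp add: N_def emeasure_density)
      also have "\<dots> = (\<integral>\<^sup>+w. ennreal (indicator A w * indicator D w) \<partial>P)"
        by (intro nn_integral_cong) (auto simp: indicator_def)
      also have "\<dots> = ennreal (\<integral>w. indicator A w * indicator D w \<partial>P)"
        by (intro nn_integral_eq_integral iAD) auto
      also have "(\<integral>w. indicator A w * indicator D w \<partial>P) =
          (\<integral>w. indicator A w * real_cond_exp P (F s) (indicator D) w \<partial>P)"
        by (rule real_cond_exp_intg(2)[symmetric]) (use iAD A in auto)
      also have "\<dots> = (\<integral>w. indicator A w * measure (K w) B \<partial>P)"
        using markov_processD(5)[OF X st Bc] mK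
        by (intro integral_cong_AE) (auto simp: D_def K_def)
      also have "ennreal \<dots> = (\<integral>\<^sup>+w. ennreal (indicator A w * measure (K w) B) \<partial>P)"
        using mK circle_probD(1)[OF Kprob] AE_space
        by (intro nn_integral_eq_integral[symmetric] integrable_const_bound[where B = 1])
          (auto simp: indicator_def prob_space.prob_le_1)
      also have "\<dots> = (\<integral>\<^sup>+w. indicator A w * emeasure (K w) B \<partial>P)"
      proof (rule nn_integral_cong)
        fix w assume "w \<in> space P"
        then interpret Kw: prob_space "K w" by (intro circle_probD(1) Kprob)
        show "ennreal (indicator A w * measure (K w) B) = indicator A w * emeasure (K w) B"
          by (simp add: indicator_def Kw.emeasure_eq_measure)
      qed
      also have "\<dots> = (\<integral>\<^sup>+w. emeasure (K w) B \<partial>N)"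
        unfolding N_def
        using measurable_compose[OF KS measurable_emeasure_subprob_algebra[OF Bc]]
        by (subst nn_integral_density) auto
      also have "\<dots> = emeasure (N \<bind> K) B"
        by (rule emeasure_bind[OF ne KN Bc, symmetric])
      finally show "emeasure (distr N circle (X t)) B = emeasure (N \<bind> K) B" .
    qed
    then have "(\<integral>\<^sup>+x. ennreal (\<phi> x) \<partial>distr N circle (X t)) = (\<integral>\<^sup>+x. ennreal (\<phi> x) \<partial>(N \<bind> K))"
      by simp
    then have eq: "(\<integral>\<^sup>+w. ennreal (\<phi> (X t w)) \<partial>N) = (\<integral>\<^sup>+w. \<integral>\<^sup>+x. ennreal (\<phi> x) \<partial>K w \<partial>N)"
      using \<phi> by (simp add: nn_integral_distr[OF XN] nn_integral_bind[OF _ KN])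
    have "(\<integral>\<^sup>+w. ennreal (\<phi> (X t w)) \<partial>N) = (\<integral>\<^sup>+w. ennreal (indicator A w * \<phi> (X t w)) \<partial>P)"
      unfolding N_def using measurable_compose[OF XP \<phi>]
      by (subst nn_integral_density) (auto intro!: nn_integral_cong simp: indicator_def)
    also have "\<dots> = ennreal (\<integral>w. indicator A w * \<phi> (X t w) \<partial>P)"
      using integrable_mult_indicator[OF AP i1] bd Xsp by (intro nn_integral_eq_integral) auto
    finally have e1: "(\<integral>\<^sup>+w. ennreal (\<phi> (X t w)) \<partial>N) = ennreal (\<integral>w. indicator A w * \<phi> (X t w) \<partial>P)" .
    have "(\<integral>\<^sup>+w. \<integral>\<^sup>+x. ennreal (\<phi> x) \<partial>K w \<partial>N) = (\<integral>\<^sup>+w. ennreal (\<integral>x. \<phi> x \<partial>K w) \<partial>N)"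
    proof (rule nn_integral_cong)
      fix w assume "w \<in> space N"
      then have w: "w \<in> space P" by (simp add: spN)
      have "integrable (K w) \<phi>"
        using bd by (intro circle_prob_integrable[OF Kprob[OF w] \<phi>, where B = B]) force
      then show "(\<integral>\<^sup>+x. ennreal (\<phi> x) \<partial>K w) = ennreal (\<integral>x. \<phi> x \<partial>K w)"
        using bd circle_probD(3)[OF Kprob[OF w]] by (intro nn_integral_eq_integral AE_I2) auto
    qed
    also have "\<dots> = (\<integral>\<^sup>+w. ennreal (indicator A w * (\<integral>x. \<phi> x \<partial>K w)) \<partial>P)"
      unfolding N_def using measurable_from_subalg[OF sub(1) meas_int]
      by (subst nn_integral_density) (auto intro!: nn_integral_cong simp: indicator_def)
    also have "\<dots> = ennreal (\<integral>w. indicator A w * (\<integral>x. \<phi> x \<partial>K w) \<partial>P)"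
      using integrable_mult_indicator[OF AP i2] int_bd by (intro nn_integral_eq_integral) auto
    finally have e2: "(\<integral>\<^sup>+w. \<integral>\<^sup>+x. ennreal (\<phi> x) \<partial>K w \<partial>N) =
      ennreal (\<integral>w. indicator A w * (\<integral>x. \<phi> x \<partial>K w) \<partial>P)" .
    have "0 \<le> (\<integral>w. indicator A w * \<phi> (X t w) \<partial>P)" "0 \<le> (\<integral>w. indicator A w * (\<integral>x. \<phi> x \<partial>K w) \<partial>P)"
      using bd Xsp int_bd by (auto intro!: Bochner_Integration.integral_nonneg)
    then show ?thesis
      using eq unfolding e1 e2 set_lebesgue_integral_def by simp
  qed
  then show ?thesis
    using real_cond_exp_charact[OF _ i1 i2 meas_int] by (simp add: K_def)
qed

text \<open>With homogeneity this feeds the hypotheses of \<open>CE_G_incr_power\<close>: the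
  conditional moments are functions of the current value alone.\<close>

lemma markov_process_cond_moment:
  assumes P: "prob_space P" and F: "is_filtration P F" and X: "markov_process P F k X"
    and st: "0 \<le> s" "s \<le> t"
  shows "AE w in P. complex_cond_exp P (F s) (\<lambda>w. X t w ^ n) w = moment (k s t (X s w)) n"
proof -
  interpret prob_space P by fact
  have sub: "subalgebra P (F s)" "subalgebra P (F t)"
    using F st by (auto simp: is_filtration_def)
  interpret finite_measure_subalgebra P "F s"
    by unfold_locales (rule sub)
  have XP: "X t \<in> P \<rightarrow>\<^sub>M circle" and XsP: "X s \<in> P \<rightarrow>\<^sub>M circle"
    using measurable_from_subalg[OF sub(2) markov_processD(3)[OF X st]]
      measurable_from_subalg[OF sub(1) markov_processD(2)[OF X st]] by auto
  have k: "circle_prob (k s t (X s w))" if "w \<in> space P" for w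
    using measurable_space[OF markov_processD(4)[OF X st]] measurable_space[OF XsP that] by blast
  have part: "AE w in P. real_cond_exp P (F s) (\<lambda>w. \<phi> (X t w)) w = (\<integral>x. \<phi> x \<partial>k s t (X s w))"
    if \<phi>: "\<phi> \<in> borel_measurable circle" "\<And>x. cmod x = 1 \<Longrightarrow> \<bar>\<phi> x\<bar> \<le> 1" for \<phi> :: "complex \<Rightarrow> real"
  proof -
    have i: "integrable P (\<lambda>w. \<phi> (X t w))"
      using \<phi> measurable_compose[OF XP \<phi>(1)] measurable_space[OF XP]
      by (intro integrable_const_bound[where B = 1]) auto
    \<comment> \<open>Adding 1 moves the real and imaginary parts of x^n into [0, 2], the
      nonnegative range required by \<open>markov_process_real_cond_exp\<close>; the constant is
      subtracted again afterwards.\<close>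
    have b: "0 \<le> \<phi> x + 1 \<and> \<phi> x + 1 \<le> 2" if "cmod x = 1" for x
      using \<phi>(2)[OF that] by auto
    have "AE w in P. real_cond_exp P (F s) (\<lambda>w. \<phi> (X t w) + 1) w = (\<integral>x. \<phi> x + 1 \<partial>k s t (X s w))"
      by (rule markov_process_real_cond_exp[OF P F X st _ b]) (use \<phi> in auto)
    moreover have "AE w in P. real_cond_exp P (F s) (\<lambda>w. \<phi> (X t w) + 1) w =
        real_cond_exp P (F s) (\<lambda>w. \<phi> (X t w)) w + real_cond_exp P (F s) (\<lambda>w. 1) w"
      by (rule real_cond_exp_add[OF i]) auto
    moreover have "AE w in P. real_cond_exp P (F s) (\<lambda>w. 1) w = 1"
      by (rule real_cond_exp_F_meas) auto
    moreover have "AE w in P. (\<integral>x. \<phi> x + 1 \<partial>k s t (X s w)) = (\<integral>x. \<phi> x \<partial>k s t (X s w)) + 1"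
    proof (rule AE_I2)
      fix w assume w: "w \<in> space P"
      interpret k: prob_space "k s t (X s w)" by (rule circle_probD(1)[OF k[OF w]])
      have "integrable (k s t (X s w)) \<phi>"
        by (rule circle_prob_integrable[OF k[OF w] \<phi>(1)]) (use \<phi>(2) in auto)
      then show "(\<integral>x. \<phi> x + 1 \<partial>k s t (X s w)) = (\<integral>x. \<phi> x \<partial>k s t (X s w)) + 1"
        by (simp add: k.prob_space)
    qed
    ultimately show ?thesis by eventually_elim simp
  qed
  have le: "\<bar>Re (x ^ n)\<bar> \<le> 1" "\<bar>Im (x ^ n)\<bar> \<le> 1" if "cmod x = 1" for x
    using abs_Re_le_cmod[of "x ^ n"] abs_Im_le_cmod[of "x ^ n"] that by (simp_all add: norm_power)
  note m = power_measurable_circle[of n, unfolded borel_measurable_complex_iff[of "\<lambda>x. x ^ n"]]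
  have re: "AE w in P. real_cond_exp P (F s) (\<lambda>w. Re (X t w ^ n)) w = (\<integral>x. Re (x ^ n) \<partial>k s t (X s w))"
    apply (rule part[of "\<lambda>x. Re (x ^ n)"])
     apply (rule conjunct1[OF m])
    apply (erule le(1))
    done
  have im: "AE w in P. real_cond_exp P (F s) (\<lambda>w. Im (X t w ^ n)) w = (\<integral>x. Im (x ^ n) \<partial>k s t (X s w))"
    apply (rule part[of "\<lambda>x. Im (x ^ n)"])
     apply (rule conjunct2[OF m])
    apply (erule le(2))
    done
  show ?thesis
    using re im AE_space[of P]
  proof eventually_elim
    case (elim w)
    note i = circle_prob_integrable_power[OF k[OF elim(3)], of n]
    show ?case
      unfolding complex_cond_exp_def moment_def complex_integral_parts[OF i] elim(1,2) ..
  qed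
qed

section \<open>Operators on the space of square-integrable functions\<close>

context finite_measure_subalgebra begin

text \<open>The operator expression of the theorem for U_t, kept in the same form so that the two
  match by unfolding; \<open>twist_op_L2\<close> links it to the action on functions.\<close>

definition twist_op :: "('a \<Rightarrow> complex) \<Rightarrow> ('a \<Rightarrow> complex) set \<Rightarrow> ('a \<Rightarrow> complex) set" where
  "twist_op m = op_add (L2 M) (op_id (L2 M))
    (op_mult (L2 M) (op_diff (L2 M) (multiplication_op M m) (op_id (L2 M))) (cond_exp_op M F))"

lemma twist_op_L2:
  assumes m: "m \<in> borel_measurable F" "AE x in M. cmod (m x) = 1" and f: "f \<in> L2_fun M"
  shows "twist_op m (L2_class M f) = L2_class M (twist m f)"
proof -
  have m': "m \<in> borel_measurable M" by (rule measurable_from_subalg[OF subalg m(1)])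
  have le: "AE x in M. cmod (m x) \<le> 1" using m(2) by eventually_elim simp
  note E = CE_L2[OF f]
  note mE = L2_fun_bounded_mult[OF E m' le]
  have "twist_op m (L2_class M f) =
      L2_class M (\<lambda>x. f x + (m x * CE f x - CE f x))"
    using f E mE L2_fun_diff[OF mE E]
    by (simp add: twist_op_def op_add_def op_mult_def compose_def op_diff_def op_id_def
        L2_class_in_vecs cond_exp_op_L2 multiplication_op_L2[OF E m' le] vdiff_L2 vadd_L2)
  then show ?thesis
    by (simp add: twist_def[abs_def] algebra_simps)
qed

lemma twist_add:
  assumes "f \<in> L2_fun M" "g \<in> L2_fun M"
  shows "AE x in M. twist m (\<lambda>x. f x + g x) x = twist m f x + twist m g x"
  using CE_add[OF L2_fun_integrable[OF assms(1)] L2_fun_integrable[OF assms(2)]]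
  by eventually_elim (simp add: twist_def algebra_simps)

lemma twist_scale:
  assumes "f \<in> L2_fun M"
  shows "AE x in M. twist m (\<lambda>x. a * f x) x = a * twist m f x"
proof -
  have "AE x in M. CE (\<lambda>x. a * f x) x = a * CE f x"
    by (rule CE_mult_L2[OF _ assms, where C = "cmod a"]) auto
  then show ?thesis
    by eventually_elim (simp add: twist_def algebra_simps)
qed

text \<open>The twist is isometric because its adjoint, the twist by the conjugate, is also its left
  inverse; so the bound holds with constant 1.\<close>

lemma twist_op_bounded:
  assumes m: "m \<in> borel_measurable F" "AE x in M. cmod (m x) = 1"
  shows "twist_op m \<in> bounded_ops (L2 M)"
proof -
  note tw = twist_op_L2[OF m] twist_L2[OF m]
  have norm: "vnorm (L2 M) (L2_class M (twist m f)) = vnorm (L2 M) (L2_class M f)" if f: "f \<in> L2_fun M" for f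
  proof -
    have "(\<integral>x. cnj (twist m f x) * twist m f x \<partial>M) =
        (\<integral>x. cnj (f x) * twist (\<lambda>x. cnj (m x)) (twist m f) x \<partial>M)"
      by (rule twist_inner[OF m f tw(2)[OF f]])
    also have "\<dots> = (\<integral>x. cnj (f x) * f x \<partial>M)"
    proof (rule integral_cong_AE)
      have "(\<lambda>x. cnj (m x)) \<in> borel_measurable F" "AE x in M. cmod (cnj (m x)) = 1"
        using m by auto
      then have "twist (\<lambda>x. cnj (m x)) (twist m f) \<in> L2_fun M"
        by (rule twist_L2[OF _ _ tw(2)[OF f]])
      then show "(\<lambda>x. cnj (f x) * twist (\<lambda>x. cnj (m x)) (twist m f) x) \<in> borel_measurable M"
        using f by (intro borel_measurable_times borel_measurable_cnj L2_funD(1))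
      show "AE x in M. cnj (f x) * twist (\<lambda>x. cnj (m x)) (twist m f) x = cnj (f x) * f x"
        using twist_twist_cnj[OF m f] by eventually_elim simp
    qed (use L2_funD(1)[OF f] in auto)
    finally show ?thesis
      using f tw(2)[OF f] by (simp add: vnorm_def vinner_L2)
  qed
  have "twist_op m \<in> extensional (vecs (L2 M))"
    by (simp add: twist_op_def op_add_def)
  moreover have "\<forall>A\<in>vecs (L2 M). twist_op m A \<in> vecs (L2 M)"
    by (auto elim!: vecs_L2E simp: tw L2_class_in_vecs)
  moreover have "\<forall>A\<in>vecs (L2 M). \<forall>B\<in>vecs (L2 M).
      twist_op m (vadd (L2 M) A B) = vadd (L2 M) (twist_op m A) (twist_op m B)"
    by (intro ballI, elim vecs_L2E) (simp add: tw vadd_L2 L2_fun_add L2_class_eq_iff twist_add)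
  moreover have "\<forall>a. \<forall>A\<in>vecs (L2 M).
      twist_op m (vscale (L2 M) a A) = vscale (L2 M) a (twist_op m A)"
    by (intro allI ballI, elim vecs_L2E)
      (simp add: tw vscale_L2 L2_fun_scale L2_class_eq_iff twist_scale)
  moreover have "\<exists>C. \<forall>A\<in>vecs (L2 M). vnorm (L2 M) (twist_op m A) \<le> C * vnorm (L2 M) A"
    by (rule exI[of _ 1]) (auto elim!: vecs_L2E simp: tw norm)
  ultimately show ?thesis
    unfolding bounded_ops_def by (auto simp: PiE_def)
qed

end

context prob_space begin

lemma unitary_twist_op:
  assumes F: "finite_measure_subalgebra M F"
    and m: "m \<in> borel_measurable F" "AE x in M. cmod (m x) = 1"
  shows "unitary_op (L2 M) (finite_measure_subalgebra.twist_op M F m)"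
    "op_inverse (L2 M) (finite_measure_subalgebra.twist_op M F m) =
      finite_measure_subalgebra.twist_op M F (\<lambda>x. cnj (m x))"
proof -
  interpret finite_measure_subalgebra M F by fact
  interpret H: complex_hilbert_space "L2 M" by (rule complex_hilbert_space_L2)
  have m': "(\<lambda>x. cnj (m x)) \<in> borel_measurable F" "AE x in M. cmod (cnj (m x)) = 1"
    using m by auto
  note b = twist_op_bounded[OF m] twist_op_bounded[OF m']
  have inv1: "twist_op (\<lambda>x. cnj (m x)) (twist_op m A) = A" if "A \<in> vecs (L2 M)" for A
    using that
    by (elim vecs_L2E) (simp add: twist_op_L2 m m' twist_L2 L2_class_eq_iff twist_twist_cnj)
  have inv2: "twist_op m (twist_op (\<lambda>x. cnj (m x)) A) = A" if "A \<in> vecs (L2 M)" for A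
    using that twist_twist_cnj[OF m']
    by (elim vecs_L2E) (simp add: twist_op_L2 m m' twist_L2 L2_class_eq_iff)
  have adj: "vinner (L2 M) (twist_op m A) B = vinner (L2 M) A (twist_op (\<lambda>x. cnj (m x)) B)"
    if "A \<in> vecs (L2 M)" "B \<in> vecs (L2 M)" for A B
    using that
    by (auto elim!: vecs_L2E simp: twist_op_L2 m m' twist_L2 vinner_L2 twist_inner)
  show "unitary_op (L2 M) (twist_op m)"
    by (rule H.unitary_opI[OF b adj inv1 inv2])
  show "op_inverse (L2 M) (twist_op m) = twist_op (\<lambda>x. cnj (m x))"
    by (rule H.op_inverse_eqI)
      (auto simp: inv1 inv2 H.bounded_ops_closed[OF b(1)] H.bounded_ops_closed[OF b(2)] H.bounded_opsD(1)[OF b(2)])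
qed

lemma cond_exp_op_L2_projection:
  assumes F: "finite_measure_subalgebra M F"
  shows "A \<in> vecs (L2 M) \<Longrightarrow> cond_exp_op M F A \<in> vecs (L2 M)"
    and "A \<in> vecs (L2 M) \<Longrightarrow> B \<in> vecs (L2 M) \<Longrightarrow>
      vinner (L2 M) (cond_exp_op M F A) B = vinner (L2 M) A (cond_exp_op M F B)"
    and "f \<in> L2_fun M \<Longrightarrow> f \<in> borel_measurable F \<Longrightarrow> cond_exp_op M F (L2_class M f) = L2_class M f"
proof -
  interpret finite_measure_subalgebra M F by fact
  show "A \<in> vecs (L2 M) \<Longrightarrow> cond_exp_op M F A \<in> vecs (L2 M)"
    by (auto elim!: vecs_L2E simp: cond_exp_op_L2 CE_L2 L2_class_in_vecs)
  show "A \<in> vecs (L2 M) \<Longrightarrow> B \<in> vecs (L2 M) \<Longrightarrow>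
      vinner (L2 M) (cond_exp_op M F A) B = vinner (L2 M) A (cond_exp_op M F B)"
    by (auto elim!: vecs_L2E simp: cond_exp_op_L2 CE_L2 vinner_L2 CE_inner)
  show "f \<in> L2_fun M \<Longrightarrow> f \<in> borel_measurable F \<Longrightarrow> cond_exp_op M F (L2_class M f) = L2_class M f"
    by (auto simp: cond_exp_op_L2 CE_L2 L2_class_eq_iff intro!: CE_F_meas L2_fun_integrable)
qed

lemma indicator_space_L2:
  "indicator (space M) \<in> L2_fun M"
  "vinner (L2 M) (L2_class M (indicator (space M))) (L2_class M (indicator (space M))) = 1"
  "finite_measure_subalgebra M F \<Longrightarrow>
    cond_exp_op M F (L2_class M (indicator (space M))) = L2_class M (indicator (space M))"
proof -
  have i: "(indicator (space M) :: 'a \<Rightarrow> complex) \<in> borel_measurable M"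
    by simp
  show L: "indicator (space M) \<in> L2_fun M"
    by (rule L2_funI_bound[OF i, of "\<lambda>_. 1"]) auto
  have "(\<integral>x. cnj (indicator (space M) x) * indicator (space M) x \<partial>M) = (\<integral>x. 1 \<partial>M :: complex)"
    by (intro Bochner_Integration.integral_cong) auto
  then show "vinner (L2 M) (L2_class M (indicator (space M))) (L2_class M (indicator (space M))) = 1"
    using L by (simp add: vinner_L2 prob_space)
  assume F: "finite_measure_subalgebra M F"
  then interpret finite_measure_subalgebra M F .
  have "space F = space M" using subalg by (simp add: subalgebra_def)
  then have "(indicator (space M) :: 'a \<Rightarrow> complex) \<in> borel_measurable F"
    by (metis borel_measurable_indicator sets.top)
  then show "cond_exp_op M F (L2_class M (indicator (space M))) = L2_class M (indicator (space M))"
    by (rule cond_exp_op_L2_projection(3)[OF F L])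
qed

end

context unitary_increment begin

lemma cond_exp_op_nested:
  assumes "A \<in> vecs (L2 M)"
  shows "cond_exp_op M F (cond_exp_op M G A) = cond_exp_op M G A"
    "cond_exp_op M G (cond_exp_op M F A) = cond_exp_op M G A"
  using assms
  by (elim vecs_L2E; simp add: G.cond_exp_op_L2 F.cond_exp_op_L2 G.CE_L2 F.CE_L2
      L2_class_eq_iff CE_F_of_G CE_G_of_F)+

definition incr_op :: "('a \<Rightarrow> complex) set \<Rightarrow> ('a \<Rightarrow> complex) set" where
  "incr_op = op_mult (L2 M) (op_inverse (L2 M) (G.twist_op p)) (F.twist_op q)"

lemma unitary_incr_op: "unitary_op (L2 M) incr_op"
  unfolding incr_op_def
  using unitary_twist_op(1)[OF F.finite_measure_subalgebra_axioms q]
    unitary_twist_op(1)[OF G.finite_measure_subalgebra_axioms p]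
  by (intro complex_hilbert_space.unitary_op_mult_inverse complex_hilbert_space_L2)

lemma incr_op_L2: "f \<in> L2_fun M \<Longrightarrow> incr_op (L2_class M f) = L2_class M (incr f)"
  by (simp add: incr_op_def unitary_twist_op(2)[OF G.finite_measure_subalgebra_axioms p]
      op_mult_def compose_def L2_class_in_vecs F.twist_op_L2 q F.twist_L2 G.twist_op_L2 cnj_p p incr_def)

lemma incr_op_power_L2: "f \<in> L2_fun M \<Longrightarrow> (incr_op ^^ n) (L2_class M f) = L2_class M ((incr ^^ n) f)"
  by (induction n) (auto simp: incr_op_L2 incr_power_L2)

text \<open>Self-adjointness moves I - P from A to the other side, where (I - P) V^n B = (I - P) B
  by \<open>CE_F_incr_power\<close>.\<close>

lemma incr_op_inner_right:
  assumes "A \<in> vecs (L2 M)" "B \<in> vecs (L2 M)"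
  shows "vinner (L2 M) A ((incr_op ^^ n) B) - vinner (L2 M) A B =
    vinner (L2 M) (cond_exp_op M F A) ((incr_op ^^ n) B) - vinner (L2 M) (cond_exp_op M F A) B"
proof -
  obtain f where f: "f \<in> L2_fun M" "A = L2_class M f" using assms(1) by (rule vecs_L2E)
  obtain g where g: "g \<in> L2_fun M" "B = L2_class M g" using assms(2) by (rule vecs_L2E)
  let ?g = "(incr ^^ n) g"
  note L = incr_power_L2[OF g(1), of n]
  have d: "(\<lambda>x. ?g x - F.CE ?g x) \<in> L2_fun M" "(\<lambda>x. g x - F.CE g x) \<in> L2_fun M"
    by (intro L2_fun_diff L g F.CE_L2)+
  have split: "(\<integral>x. cnj (f x) * u x \<partial>M) - (\<integral>x. cnj (F.CE f x) * u x \<partial>M) =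
      (\<integral>x. cnj (f x) * (u x - F.CE u x) \<partial>M)" if u: "u \<in> L2_fun M" for u
  proof -
    have "(\<integral>x. cnj (f x) * (u x - F.CE u x) \<partial>M) =
        (\<integral>x. cnj (f x) * u x \<partial>M) - (\<integral>x. cnj (f x) * F.CE u x \<partial>M)"
      unfolding right_diff_distrib
      by (intro Bochner_Integration.integral_diff L2_integrable_inner f u F.CE_L2)
    then show ?thesis using F.CE_inner[OF f(1) u] by simp
  qed
  have "(\<integral>x. cnj (f x) * (?g x - F.CE ?g x) \<partial>M) = (\<integral>x. cnj (f x) * (g x - F.CE g x) \<partial>M)"
  proof (rule integral_cong_AE)
    show "AE x in M. cnj (f x) * (?g x - F.CE ?g x) = cnj (f x) * (g x - F.CE g x)"
      using CE_F_incr_power[OF g(1), of n] by eventually_elim (metis minus_diff_eq)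
  qed (intro borel_measurable_times borel_measurable_cnj L2_funD(1)[of _ M] d f)+
  then have "(\<integral>x. cnj (f x) * ?g x \<partial>M) - (\<integral>x. cnj (F.CE f x) * ?g x \<partial>M) =
      (\<integral>x. cnj (f x) * g x \<partial>M) - (\<integral>x. cnj (F.CE f x) * g x \<partial>M)"
    by (simp only: split[OF L] split[OF g(1)])
  then show ?thesis
    using f g L
    by (simp add: incr_op_power_L2 F.cond_exp_op_L2 vinner_L2 F.CE_L2 algebra_simps)
qed

lemma incr_op_inner_left:
  assumes "A \<in> vecs (L2 M)" "B \<in> vecs (L2 M)"
  shows "vinner (L2 M) A ((incr_op ^^ n) B) - vinner (L2 M) A B =
    vinner (L2 M) A ((incr_op ^^ n) (cond_exp_op M F B)) - vinner (L2 M) A (cond_exp_op M F B)"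
proof -
  interpret H: complex_hilbert_space "L2 M" by (rule complex_hilbert_space_L2)
  obtain g where g: "g \<in> L2_fun M" "B = L2_class M g" using assms(2) by (rule vecs_L2E)
  \<comment> \<open>The component of B orthogonal to L^2(F). V^n fixes it, so by linearity it
    contributes equally to both terms on the left and cancels.\<close>
  define z where "z x = g x - F.CE g x" for x
  have z: "z \<in> L2_fun M" unfolding z_def[abs_def] by (intro L2_fun_diff g F.CE_L2)
  have gz: "AE x in M. g x = z x + F.CE g x" by (simp add: z_def)
  have "AE x in M. F.CE g x = F.CE z x + F.CE (F.CE g) x"
  proof -
    have "AE x in M. F.CE (\<lambda>x. z x + F.CE g x) x = F.CE z x + F.CE (F.CE g) x"
      by (intro F.CE_add L2_fun_integrable z F.CE_L2 g)
    then show ?thesis by (simp add: z_def)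
  qed
  then have z0: "AE x in M. F.CE z x = 0"
    using F.CE_idem[OF g(1)] by eventually_elim simp
  have Bz: "B = vadd (L2 M) (L2_class M z) (cond_exp_op M F B)"
    using g z by (simp add: F.cond_exp_op_L2 vadd_L2 F.CE_L2 z_def)
  have Vz: "(incr_op ^^ n) (L2_class M z) = L2_class M z"
    using incr_power_ortho[OF z z0] z by (simp add: incr_op_power_L2 L2_class_eq_iff incr_power_L2)
  note PB = cond_exp_op_L2_projection(1)[OF F.finite_measure_subalgebra_axioms assms(2)]
  note zv = L2_class_in_vecs[OF z]
  have V: "incr_op \<in> bounded_ops (L2 M)" using unitary_incr_op by (simp add: unitary_op_def)
  have cl: "(incr_op ^^ n) C \<in> vecs (L2 M)" if "C \<in> vecs (L2 M)" for C n
    using that by (induction n) (auto intro: H.bounded_ops_closed[OF V])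
  have add: "(incr_op ^^ n) (vadd (L2 M) C D) = vadd (L2 M) ((incr_op ^^ n) C) ((incr_op ^^ n) D)"
    if "C \<in> vecs (L2 M)" "D \<in> vecs (L2 M)" for C D
    using that by (induction n) (auto simp: H.bounded_opsD(2)[OF V] cl)
  have "(incr_op ^^ n) B = vadd (L2 M) (L2_class M z) ((incr_op ^^ n) (cond_exp_op M F B))"
    by (subst Bz) (simp add: add zv PB Vz)
  then have "vinner (L2 M) A ((incr_op ^^ n) B) =
      vinner (L2 M) A (L2_class M z) + vinner (L2 M) A ((incr_op ^^ n) (cond_exp_op M F B))"
    by (simp add: H.inner_add_right assms zv cl PB)
  moreover have "vinner (L2 M) A B = vinner (L2 M) A (L2_class M z) + vinner (L2 M) A (cond_exp_op M F B)"
    by (subst Bz) (simp add: H.inner_add_right assms zv PB)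
  ultimately show ?thesis by simp
qed

lemma incr_op_compress:
  fixes \<mu> :: "nat \<Rightarrow> complex \<Rightarrow> complex" and c :: "nat \<Rightarrow> complex"
  assumes mom: "\<And>n. AE x in M. G.CE (\<lambda>x. q x ^ n) x = \<mu> n (p x)"
    and eq: "\<And>n. AE x in M. p x * c (Suc n) =
      \<mu> (Suc n) (p x) - (p x - 1) * (\<Sum>k=1..n. c k * \<mu> (Suc n - k) (p x))"
    and c0: "c 0 = 1"
    and A: "A \<in> vecs (L2 M)"
  shows "cond_exp_op M G ((incr_op ^^ n) (cond_exp_op M G A)) = vscale (L2 M) (c n) (cond_exp_op M G A)"
proof -
  obtain f where f: "f \<in> L2_fun M" "A = L2_class M f" using A by (rule vecs_L2E)
  note E = G.CE_L2[OF f(1)]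
  show ?thesis
    using CE_G_incr_power[OF mom eq c0 E G.CE_measurable(1), of n] incr_power_L2[OF E, of n]
    by (simp add: f G.cond_exp_op_L2 E incr_op_power_L2 vscale_L2 L2_class_eq_iff G.CE_L2 L2_fun_scale)
qed

end

section \<open>The increment process\<close>

lemma measurable_circleD:
  assumes "X \<in> N \<rightarrow>\<^sub>M circle"
  shows "X \<in> borel_measurable N" "w \<in> space N \<Longrightarrow> cmod (X w) = 1"
proof -
  show "X \<in> borel_measurable N"
    using measurable_compose[OF assms measurable_circle_borel[OF measurable_ident]] by simp
  show "w \<in> space N \<Longrightarrow> cmod (X w) = 1"
    using measurable_space[OF assms] by auto
qed

lemma markov_unitary_increment:
  assumes P: "prob_space P" and F: "is_filtration P F" and X: "markov_process P F k X"
    and st: "0 \<le> s" "s \<le> t"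
  shows "unitary_increment P (F s) (F t) (X s) (X t)"
proof -
  have sub: "subalgebra P (F s)" "subalgebra P (F t)" "sets (F s) \<subseteq> sets (F t)"
    using F st by (auto simp: is_filtration_def)
  note m = markov_processD(2,3)[OF X st]
  have "AE w in P. cmod (X s w) = 1" "AE w in P. cmod (X t w) = 1"
    using measurable_circleD(2)[OF measurable_from_subalg[OF sub(1) m(1)]]
      measurable_circleD(2)[OF measurable_from_subalg[OF sub(2) m(2)]] by auto
  then show ?thesis
    using P sub measurable_circleD(1)[OF m(1)] measurable_circleD(1)[OF m(2)]
    by (simp add: unitary_increment_def unitary_increment_axioms_def)
qed

lemma unitary_distributionI:
  assumes "circle_prob \<mu>" "\<And>n. state H \<xi> (op_power H U n) = moment \<mu> n"
  shows "unitary_distribution H \<xi> U = \<mu>"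
  unfolding unitary_distribution_def
proof (rule the_equality)
  show "circle_prob \<mu> \<and> (\<forall>n. state H \<xi> (op_power H U n) = (\<integral>x. x ^ n \<partial>\<mu>))"
    using assms by (simp add: moment_def)
  show "\<nu> = \<mu>" if "circle_prob \<nu> \<and> (\<forall>n. state H \<xi> (op_power H U n) = (\<integral>x. x ^ n \<partial>\<nu>))" for \<nu>
    using that assms by (intro circle_prob_eqI) (auto simp: moment_def)
qed

theorem theorem5p8:
  fixes P :: "'w measure"
    and F :: "real \<Rightarrow> 'w measure"
    and k :: "real \<Rightarrow> real \<Rightarrow> complex \<Rightarrow> complex measure"
    and M :: "real \<Rightarrow> 'w \<Rightarrow> complex"
  assumes "prob_space P"
    and "is_filtration P F"
    and "markov_process P F k M"
    and "monotone_homogeneous k"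
    and "AE w in P. M 0 w = 1"
  shows "UMIP (L2 P) (L2_class P (indicator (space P)))
    (\<lambda>t. op_add (L2 P) (op_id (L2 P))
      (op_mult (L2 P)
        (op_diff (L2 P) (multiplication_op P (M t)) (op_id (L2 P)))
        (cond_exp_op P (F t))))"
    (is "UMIP ?H ?\<xi> ?U")
proof -
  interpret prob_space P by fact
  interpret H: complex_hilbert_space ?H by (rule complex_hilbert_space_L2)
  note incr = markov_unitary_increment[OF assms(1-3)]
  define Q where "Q t = cond_exp_op P (F t)" for t
  have sub: "finite_measure_subalgebra P (F t)" if "0 \<le> t" for t
    using unitary_increment.subalg_F[OF incr[OF that order_refl]] finite_measure_axioms
    by (simp add: finite_measure_subalgebra_def finite_measure_subalgebra_axioms_def)
  note Q_vecs = cond_exp_op_L2_projection(1)[OF sub, folded Q_def]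
  note Q_adj = cond_exp_op_L2_projection(2)[OF sub, folded Q_def]
  have \<xi>: "?\<xi> \<in> vecs ?H" "vinner ?H ?\<xi> ?\<xi> = 1" and Q_\<xi>: "0 \<le> t \<Longrightarrow> Q t ?\<xi> = ?\<xi>" for t
    using indicator_space_L2 sub by (auto simp: L2_class_in_vecs Q_def)
  have U: "?U t = finite_measure_subalgebra.twist_op P (F t) (M t)" if "0 \<le> t" for t
    by (simp add: finite_measure_subalgebra.twist_op_def[OF sub[OF that]])
  have unitary: "unitary_op ?H (?U t)" if "0 \<le> t" for t
    unfolding U[OF that]
    using unitary_increment.q[OF incr[OF that order_refl]] by (intro unitary_twist_op(1) sub that)
  have V: "mult_increment ?H ?U s t = unitary_increment.incr_op P (F s) (F t) (M s) (M t)"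
    if "0 \<le> s" "s \<le> t" for s t
    using that by (simp add: mult_increment_def unitary_increment.incr_op_def[OF incr] U)
  have V_unitary: "unitary_op ?H (mult_increment ?H ?U s t)" if "0 \<le> s" "s \<le> t" for s t
    unfolding V[OF that] by (rule unitary_increment.unitary_incr_op[OF incr[OF that]])
  have kernel: "circle_prob (k s t x)" if "0 \<le> s" "s \<le> t" "cmod x = 1" for s t x
    using measurable_space[OF markov_processD(4)[OF assms(3) that(1,2)]] that(3) by simp
  define c where "c s t n = moment (k s t 1) n" for s t n
  have compress: "Q s ((mult_increment ?H ?U s t ^^ n) (Q s A)) = vscale ?H (c s t n) (Q s A)"
    if st: "0 \<le> s" "s \<le> t" and A: "A \<in> vecs ?H" for s t n A
    unfolding V[OF st] Q_def
  proof (rule unitary_increment.incr_op_compress[OF incr[OF st], where \<mu> = "\<lambda>n x. moment (k s t x) n"])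
    show "AE x in P. complex_cond_exp P (F s) (\<lambda>x. M t x ^ n) x = moment (k s t (M s x)) n" for n
      by (rule markov_process_cond_moment[OF assms(1-3) st])
    show "AE x in P. M s x * c s t (Suc n) = moment (k s t (M s x)) (Suc n) -
        (M s x - 1) * (\<Sum>j = 1..n. c s t j * moment (k s t (M s x)) (Suc n - j))" for n
      using unitary_increment.p(2)[OF incr[OF st]]
    proof eventually_elim
      case (elim w)
      \<comment> \<open>Homogeneity with base point 1: the kernel at M_s is the convolution of the
        point mass at M_s with the kernel at 1.\<close>
      have "is_mult_monotone_conv (return circle (M s w)) (k s t 1) (k s t (M s w * 1))"
        using assms(4) st elim unfolding monotone_homogeneous_def by (metis mem_sphere_0 norm_one)
      then show ?case
        unfolding c_def using elim by (intro rotated_moments kernel st) auto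
    qed
    show "c s t 0 = 1"
      unfolding c_def by (rule moment_0[OF kernel[OF st norm_one]])
  qed (rule A)
  have distribution: "unitary_distribution ?H ?\<xi> (mult_increment ?H ?U s t) = k s t 1"
    if st: "0 \<le> s" "s \<le> t" for s t
  proof (rule unitary_distributionI[OF kernel[OF st norm_one]])
    fix n
    let ?V = "mult_increment ?H ?U s t"
    have Vb: "?V \<in> bounded_ops ?H" using V_unitary[OF st] by (simp add: unitary_op_def)
    have Vn: "(?V ^^ n) ?\<xi> \<in> vecs ?H"
      by (induction n) (auto intro: H.bounded_ops_closed[OF Vb] \<xi>)
    have "state ?H ?\<xi> (op_power ?H ?V n) = vinner ?H ?\<xi> ((?V ^^ n) ?\<xi>)"
      by (simp add: state_def H.op_power_apply H.bounded_ops_closed[OF Vb] \<xi>)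
    also have "\<dots> = vinner ?H ?\<xi> (Q s ((?V ^^ n) (Q s ?\<xi>)))"
      using Q_adj[OF st(1) \<xi>(1) Vn] Q_\<xi>[OF st(1)] by simp
    also have "\<dots> = moment (k s t 1) n"
      unfolding compress[OF st \<xi>(1)] unfolding Q_\<xi>[OF st(1)]
      using \<xi> by (simp add: H.inner_scale_right c_def)
    finally show "state ?H ?\<xi> (op_power ?H ?V n) = moment (k s t 1) n" .
  qed
  \<comment> \<open>This is where M_0 = 1 is used: the factor M_0 - 1 of the twist vanishes.\<close>
  have U0: "?U 0 = op_id ?H"
  proof (rule H.op_eqI[OF _ H.op_id_extensional])
    show "?U 0 \<in> extensional (vecs ?H)" by (simp add: op_add_def)
    fix A assume A: "A \<in> vecs ?H"
    obtain f where f: "f \<in> L2_fun P" "A = L2_class P f" using A by (rule vecs_L2E)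
    interpret F0: finite_measure_subalgebra P "F 0" by (rule sub) simp
    have m: "M 0 \<in> borel_measurable (F 0)" "AE x in P. cmod (M 0 x) = 1"
      using unitary_increment.q[OF incr[OF order_refl order_refl]] by auto
    have "AE x in P. F0.twist (M 0) f x = f x"
      using assms(5) by eventually_elim (simp add: F0.twist_def)
    then show "?U 0 A = op_id ?H A"
      unfolding U[OF order_refl] using A f
      by (simp add: F0.twist_op_L2[OF m] L2_class_eq_iff F0.twist_L2[OF m])
  qed
  have "weakly_continuous (\<lambda>s t. k s t 1)"
    using assms(4) by (simp add: monotone_homogeneous_def)
  then have wc: "weakly_continuous (\<lambda>s t. unitary_distribution ?H ?\<xi> (mult_increment ?H ?U s t))"
    unfolding weakly_continuous_def
  proof (intro allI impI)
    fix f :: "complex \<Rightarrow> real"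
    assume *: "\<forall>f :: complex \<Rightarrow> real. continuous_on (sphere 0 1) f \<longrightarrow>
      continuous_on {(s, t). 0 \<le> s \<and> s \<le> t} (\<lambda>(s, t). \<integral>x. f x \<partial>k s t 1)"
      and "continuous_on (sphere 0 1) f"
    then have "continuous_on {(s, t). 0 \<le> s \<and> s \<le> t} (\<lambda>(s, t). \<integral>x. f x \<partial>k s t 1)"
      by blast
    \<comment> \<open>The identification of the distribution is available for 0 <= s <= t, exactly
      the set on which continuity is asked.\<close>
    then show "continuous_on {(s, t). 0 \<le> s \<and> s \<le> t}
        (\<lambda>(s, t). \<integral>x. f x \<partial>unitary_distribution ?H ?\<xi> (mult_increment ?H ?U s t))"
      by (rule continuous_on_eq) (auto simp: distribution)
  qed
  have mono: "monotonically_independent_tuple ?H ?\<xi> n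
      (\<lambda>i. op_diff ?H (if i = 1 then ?U (t 1) else mult_increment ?H ?U (t (i - 1)) (t i)) (op_id ?H))"
    if n: "n \<ge> 1" and t: "0 \<le> t 1 \<and> (\<forall>i\<in>{1..<n}. t i \<le> t (Suc i))" for n and t :: "nat \<Rightarrow> real"
  proof -
    \<comment> \<open>Prepending time 0 turns the first operator U_(t 1) into the increment from 0,
      since U_0 is the identity; all indices are then treated alike.\<close>
    define \<tau> where "\<tau> i = (if i = 0 then 0 else t i)" for i
    have mono_\<tau>: "\<tau> i \<le> \<tau> j" if "i \<le> j" "j \<le> n" for i j
      using that
    proof (induction j rule: dec_induct)
      case (step m)
      have "\<tau> m \<le> \<tau> (Suc m)"
        using t step by (cases "m = 0") (auto simp: \<tau>_def)
      then show ?case using step by simp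
    qed simp
    have \<tau>_nonneg: "0 \<le> \<tau> i" if "i \<le> n" for i
      using mono_\<tau>[of 0 i] that by (simp add: \<tau>_def)
    define T where "T i = (if i = 1 then ?U (t 1) else mult_increment ?H ?U (t (i - 1)) (t i))" for i
    have T_eq: "T i = mult_increment ?H ?U (\<tau> (i - 1)) (\<tau> i)" if i: "i \<in> {1..n}" for i
    proof (cases "i = 1")
      case True
      have "mult_increment ?H ?U (\<tau> (i - 1)) (\<tau> i) = op_mult ?H (op_inverse ?H (?U 0)) (?U (t 1))"
        by (simp add: True \<tau>_def mult_increment_def)
      also have "\<dots> = ?U (t 1)"
        unfolding U0 H.op_inverse_id
        using unitary[of "t 1"] t by (intro H.op_mult_id_left) (simp add: unitary_op_def)
      finally show ?thesis by (simp add: T_def True)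
    next
      case False
      then show ?thesis using i by (simp add: T_def \<tau>_def)
    qed
    have st: "0 \<le> \<tau> (i - 1)" "\<tau> (i - 1) \<le> \<tau> i" "0 \<le> \<tau> i" if "i \<in> {1..n}" for i
      using that mono_\<tau>[of "i - 1" i] \<tau>_nonneg[of i] \<tau>_nonneg[of "i - 1"] by auto
    have Tu: "unitary_op ?H (T i)" if "i \<in> {1..n}" for i
      unfolding T_eq[OF that] by (rule V_unitary[OF st(1,2)[OF that]])
    let ?A = "\<lambda>i. generated_algebra ?H (op_diff ?H (T i) (op_id ?H))"
    \<comment> \<open>The algebra of increment i lives on L^2 of the sigma-algebra at the end \<tau>
      i of its time interval.\<close>
    have absorb: "Q (\<tau> i) (X A) = X A" "X (Q (\<tau> i) A) = X A"
      if i: "i \<in> {1..n}" and X: "X \<in> ?A i" and A: "A \<in> vecs ?H" for i X A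
    proof -
      note T_V = T_eq[OF i, unfolded V[OF st(1,2)[OF i]]]
      note Qi = Q_vecs[OF st(3)[OF i]] Q_adj[OF st(3)[OF i]]
      note * = H.generated_algebra_increment[OF Tu[OF i] X, where P = "Q (\<tau> i)"]
      have right: "vinner ?H A ((T i ^^ n) B) - vinner ?H A B =
          vinner ?H (Q (\<tau> i) A) ((T i ^^ n) B) - vinner ?H (Q (\<tau> i) A) B"
        if "A \<in> vecs ?H" "B \<in> vecs ?H" for n A B
        unfolding T_V Q_def
        by (rule unitary_increment.incr_op_inner_right[OF incr[OF st(1,2)[OF i]] that])
      have left: "vinner ?H A ((T i ^^ n) B) - vinner ?H A B =
          vinner ?H A ((T i ^^ n) (Q (\<tau> i) B)) - vinner ?H A (Q (\<tau> i) B)"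
        if "A \<in> vecs ?H" "B \<in> vecs ?H" for n A B
        unfolding T_V Q_def
        by (rule unitary_increment.incr_op_inner_left[OF incr[OF st(1,2)[OF i]] that])
      show "Q (\<tau> i) (X A) = X A" "X (Q (\<tau> i) A) = X A"
        by (rule *; fact Qi right left A)+
    qed
    \<comment> \<open>The projection of index j belongs to the start \<tau> (j - 1) of its interval,
      since that is where the j-th increment is compressed to a scalar.\<close>
    have indep: "monotonically_independent ?H ?\<xi> {1..n} ?A"
    proof (rule H.monotonically_independentI[where Q = "\<lambda>j. Q (\<tau> (j - 1))"])
      show "X \<in> bounded_ops ?H" if "X \<in> ?A i" for i X
        using that by (rule H.generated_algebra_bounded)
      show "Q (\<tau> (i - 1)) A \<in> vecs ?H" if "i \<in> {1..n}" "A \<in> vecs ?H" for i A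
        by (rule Q_vecs[OF st(1)[OF that(1)] that(2)])
      show "Q (\<tau> (j - 1)) (X A) = X A \<and> X (Q (\<tau> (j - 1)) A) = X A"
        if i: "i \<in> {1..n}" and j: "j \<in> {1..n}" and lt: "i < j" and X: "X \<in> ?A i" and A: "A \<in> vecs ?H"
        for i j X A
      proof -
        \<comment> \<open>An increment of smaller index ends no later than the j-th one starts, so
          absorption at \<tau> i implies absorption at \<tau> (j - 1) through nested
          projections.\<close>
        have le: "\<tau> i \<le> \<tau> (j - 1)" using i j lt by (intro mono_\<tau>) auto
        note nest = unitary_increment.cond_exp_op_nested[OF incr[OF st(3)[OF i] le], folded Q_def]
        have XA: "X A \<in> vecs ?H"
          by (rule H.bounded_ops_closed[OF H.generated_algebra_bounded[OF X] A])
        note QA = Q_vecs[OF st(1)[OF j] A]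
        have "Q (\<tau> (j - 1)) (X A) = X A"
          using nest(1)[OF XA] absorb(1)[OF i X A] by simp
        \<comment> \<open>Both sides are rewritten with the projection at \<tau> i to the right of
          X, which swallows the one at \<tau> (j - 1).\<close>
        moreover have "X (Q (\<tau> (j - 1)) A) = X A"
          using absorb(2)[OF i X QA] absorb(2)[OF i X A] nest(2)[OF A] by simp
        ultimately show ?thesis by blast
      qed
      show "Q (\<tau> (j - 1)) (X (Q (\<tau> (j - 1)) A)) = vscale ?H (state ?H ?\<xi> X) (Q (\<tau> (j - 1)) A)"
        if j: "j \<in> {1..n}" and X: "X \<in> ?A j" and A: "A \<in> vecs ?H" for j X A
        by (rule H.generated_algebra_compress[OF Tu[OF j] X, where c = "c (\<tau> (j - 1)) (\<tau> j)"])
          (use Q_vecs[OF st(1)[OF j]] Q_adj[OF st(1)[OF j]] Q_\<xi>[OF st(1)[OF j]] \<xi> A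
            compress[OF st(1,2)[OF j]] in \<open>simp_all add: T_eq[OF j]\<close>)
      show "Q (\<tau> (j - 1)) ?\<xi> = ?\<xi>" if "j \<in> {1..n}" for j
        by (rule Q_\<xi>[OF st(1)[OF that]])
      show "vinner ?H ?\<xi> (Q (\<tau> (j - 1)) A) = vinner ?H ?\<xi> A" if "j \<in> {1..n}" "A \<in> vecs ?H" for j A
        using Q_adj[OF st(1)[OF that(1)] \<xi>(1) that(2)] Q_\<xi>[OF st(1)[OF that(1)]] by simp
    qed (rule \<xi>)
    show ?thesis
      unfolding monotonically_independent_tuple_def T_def[symmetric]
      using indep Tu H.normal_op_unitary_minus_id by blast
  qed
  show ?thesis
    unfolding UMIP_def quantum_probability_space_def
    using H.complex_hilbert_space_axioms \<xi> unitary U0 wc mono by blast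
qed

end
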